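(* Let $\Bbbk$ be an algebraically closed field, and let $L$, $B$, $\triangleleft$, $e=e^{(1)}\otimes e^{(2)}$, $\omega$, $\triangleright$ be quantum transformation groupoid data over $\Bbbk$ as defined in the context; let $H=H(L,B,\triangleleft)$ be the corresponding quantum transformation groupoid. Consider the assignment $\Gamma:\mathcal{M}^L\to\mathcal{M}^H$ given on a right $L$-comodule $X$ by $\Gamma(X)=B^{op}\otimes X\otimes B$ with $$\rho_{\Gamma(X)}(a\otimes x\otimes b)=(a\otimes x_{[0]}\otimes e^{(1)})\otimes\big((x_{[1],1}\triangleright e^{(2)})\otimes x_{[1],2}\otimes b\big)\in\Gamma(X)\otimes H,$$ and on a morphism $f$ of $\mathcal{M}^L$ by $\Gamma(f)=\mathrm{id}_{B^{op}}\otimes f\otimes\mathrm{id}_B$. Then: (i) $\Gamma$ is a functor. (ii) Let $U':L\text{-}\mathsf{Bicomod}\to\mathcal{M}^L$ be the functor forgetting the left $L$-comodule structure. Then $\widehat\Gamma=\Gamma\circ U':L\text{-}\mathsf{Bicomod}\to\mathcal{M}^H$ admits the structure of a monoidal functor, with $$\widehat\Gamma_{X,X'}:\widehat\Gamma(X)\,\bar\otimes\,\widehat\Gamma(X')\to\widehat\Gamma(X\otimes X'),\quad (a\otimes x\otimes b)\,\bar\otimes\,(a'\otimes x'\otimes b')\mapsto (x_{[-1]}\triangleright a')a\otimes x_{[0]}\otimes x'_{[0]}\otimes(b\triangleleft x'_{[1]})b',$$ $$\widehat\Gamma_0:H_s\to\widehat\Gamma(\Bbbk),\quad 1_B\otimes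 1_L\otimes b\mapsto 1_B\otimes 1_\Bbbk\otimes b,$$ where $H_s=1_B\otimes 1_L\otimes B$ is the unit object of $\mathcal{M}^H$ and $\Bbbk$ is the unit object of $L\text{-}\mathsf{Bicomod}$.
   Context: $\otimes=\otimes_\Bbbk$. Sweedler notation: $\Delta(h)=h_1\otimes h_2$; right coaction $x\mapsto x_{[0]}\otimes x_{[1]}$; left coaction $x\mapsto x_{[-1]}\otimes x_{[0]}$; e.g. $x_{[1],1}\otimes x_{[1],2}=\Delta(x_{[1]})$. Products such as $(h\triangleright a')a$ and $(b\triangleleft h)b'$ are products in $B$. **Quantum transformation groupoid data.** $L$ is a Hopf algebra over $\Bbbk$ with invertible antipode $S_L$. $B$ is a strongly separable $\Bbbk$-algebra with symmetric separability idempotent $e=e^{(1)}\otimes e^{(2)}\in B\otimes B^{op}$ (sum omitted): $e$ is an idempotent of $B\otimes B^{op}$, $e^{(1)}\otimes e^{(2)}=e^{(2)}\otimes e^{(1)}$, $be^{(1)}\otimes e^{(2)}=e^{(1)}\otimes e^{(2)}b$ for all $b\in B$, and $e^{(1)}e^{(2)}=1_B$. $B$ is a right $L$-module algebra via $b\otimes h\mapsto b\triangleleft h$, so $B^{op}$ is a left $L$-module algebra via $h\triangleright a:=a\triangleleft S_L(h)$. $\omega:B\to\Bbbk$ is the nondegenerate trace form of $B$ (so $\omega(ab)=\omega(ba)$), characterized by $\omega(e^{(1)})e^{(2)}=e^{(1)}\omega(e^{(2)})=1_B$. It is assumed that for all $a\in B^{op}$, $b\in B$, $h\in L$: $\omega((h\triangleright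 a)b)=\omega(a(b\triangleleft h))$ and $e^{(1)}\otimes(h\triangleright e^{(2)})=(e^{(1)}\triangleleft h)\otimes e^{(2)}$. **Quantum transformation groupoid $H=H(L,B,\triangleleft)$.** The weak Hopf algebra with underlying space $B^{op}\otimes L\otimes B$ and - multiplication $(a\otimes h\otimes b)(a'\otimes h'\otimes b')=(h_1\triangleright a')a\otimes h_2h_1'\otimes(b\triangleleft h_2')b'$, unit $1_B\otimes 1_L\otimes 1_B$; - comultiplication $\Delta(a\otimes h\otimes b)=(a\otimes h_1\otimes e^{(1)})\otimes((h_2\triangleright e^{(2)})\otimes h_3\otimes b)$; - counit $\varepsilon(a\otimes h\otimes b)=\omega(a(b\triangleleft S_L^{-1}(h)))$; - antipode $S(a\otimes h\otimes b)=b\otimes S_L(h)\otimes a$. (A weak bialgebra is an algebra and coalgebra $H$ with $\Delta(ab)=\Delta(a)\Delta(b)$, $\varepsilon(abc)=\varepsilon(ab_1)\varepsilon(b_2c)=\varepsilon(ab_2)\varepsilon(b_1c)$, $(\Delta\otimes\mathrm{Id})\Delta(1)=(\Delta(1)\otimes1)(1\otimes\Delta(1))=(1\otimes\Delta(1))(\Delta(1)\otimes1)$; with $\varepsilon_s(x)=1_1\varepsilon(x1_2)$, $\varepsilon_t(x)=\varepsilon(1_1x)1_2$, a weak Hopf algebra has in addition a linear $S:H\to H$ with $S(h_1)h_2=\varepsilon_s(h)$, $h_1S(h_2)=\varepsilon_t(h)$, $S(h_1)h_2S(h_3)=S(h)$. Put $H_s=\varepsilon_s(H)$. That $H(L,B,\triangleleft)$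 is a weak Hopf algebra, and that $H_s=1_B\otimes 1_L\otimes B$, is taken as known.) **Monoidal category $\mathcal{M}^H$.** Right $H$-comodules and comodule maps; $M\,\bar\otimes\, N\subseteq M\otimes N$ is the subspace of elements fixed by the linear map $m\otimes n\mapsto\varepsilon(m_{[1]}n_{[1]})m_{[0]}\otimes n_{[0]}$, with coaction induced by $m\otimes n\mapsto m_{[0]}\otimes n_{[0]}\otimes m_{[1]}n_{[1]}$; unit object $H_s$ with coaction $\Delta|_{H_s}:H_s\to H_s\otimes H$; associativity as for vector spaces; unit isomorphisms $l_M(x\,\bar\otimes\, m)=\varepsilon(xm_{[1]})m_{[0]}$, $r_M(m\,\bar\otimes\, x)=\varepsilon(m_{[1]}x)m_{[0]}$. $\mathcal{M}^L$ denotes the category of right $L$-comodules. **Monoidal category $L\text{-}\mathsf{Bicomod}$.** $L$-bicomodules (commuting left and right $L$-coactions) with monoidal product $\otimes_\Bbbk$, coactions $x\otimes x'\mapsto x_{[-1]}x'_{[-1]}\otimes x_{[0]}\otimes x'_{[0]}$ and $x\otimes x'\mapsto x_{[0]}\otimes x'_{[0]}\otimes x_{[1]}x'_{[1]}$, unit object $\Bbbk$ with trivial coactions $1_\Bbbk\mapsto 1_L\otimes1_\Bbbk$, $1_\Bbbk\mapsto1_\Bbbk\otimes 1_L$, and the canonical associativity and unit isomorphisms. **Monoidal functor.** A lax monoidal functor $(F,F_{*,*},F_0):\mathcal{C}\to\mathcal{D}$: a functor $F$, a natural transformation $F_{X,Y}:F(X)\otimes_{\mathcal D}F(Y)\to F(X\otimes_{\mathcal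 C}Y)$ and a morphism $F_0:\mathbb{1}_{\mathcal D}\to F(\mathbb{1}_{\mathcal C})$ in $\mathcal{D}$ satisfying the usual associativity and left and right unit constraints (not required to be isomorphisms). *)

theory Defs
  imports
    "HOL-Library.Poly_Mapping"
    "HOL-Library.FuncSet"
    "HOL-Computational_Algebra.Polynomial"
begin

section \<open>Vector spaces and tensor products\<close>

text \<open>
  All vector spaces over the field \<open>'k\<close> are linear subspaces of one ambient space: the free
  vector space on an index type that contains an arbitrary type \<open>'i\<close> and is closed under
  pairing. Since every vector space has a basis and \<open>'i\<close> is arbitrary, every vector space (indeed
  every set of vector spaces) is represented up to isomorphism. As the index type is closed
  under pairing, the tensor product of two such spaces is again such a space, so that comodules
  and their tensor products are objects of one and the same type and form honest categories.
\<close>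

datatype 'i idx = Gen 'i | Triv | Join "'i idx" "'i idx"

type_synonym ('k, 'i) vec = "'i idx \<Rightarrow>\<^sub>0 'k"

lift_definition scale :: "'k::field \<Rightarrow> ('k, 'i) vec \<Rightarrow> ('k, 'i) vec"
  is "\<lambda>c f i. c * f i"
  by (auto elim: rev_finite_subset)

text \<open>The tensor product of vectors sends the basis vectors \<open>i\<close>, \<open>j\<close> to the basis vector \<open>Join i j\<close>.\<close>

lift_definition tens :: "('k::field, 'i) vec \<Rightarrow> ('k, 'i) vec \<Rightarrow> ('k, 'i) vec"  (infixr \<open>\<otimes>\<close> 70)
  is "\<lambda>f g k. case k of Join i j \<Rightarrow> f i * g j | _ \<Rightarrow> 0"
proof -
  fix f g :: "'i idx \<Rightarrow> 'k"
  assume fg: "finite {x. f x \<noteq> 0}" "finite {x. g x \<noteq> 0}"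
  have "{k. (case k of Join i j \<Rightarrow> f i * g j | _ \<Rightarrow> 0) \<noteq> 0}
      \<subseteq> (\<lambda>(i, j). Join i j) ` ({x. f x \<noteq> 0} \<times> {x. g x \<noteq> 0})"
    by (force split: idx.splits)
  then show "finite {k. (case k of Join i j \<Rightarrow> f i * g j | _ \<Rightarrow> 0) \<noteq> 0}"
    using fg by (meson finite_SigmaI finite_imageI finite_subset)
qed

global_interpretation kv: vector_space "scale :: 'k::field \<Rightarrow> ('k, 'i) vec \<Rightarrow> ('k, 'i) vec"
  by unfold_locales (transfer; simp add: algebra_simps fun_eq_iff)+

abbreviation ksubspace :: "('k::field, 'i) vec set \<Rightarrow> bool"
  where "ksubspace \<equiv> module.subspace scale"

abbreviation kspan :: "('k::field, 'i) vec set \<Rightarrow> ('k, 'i) vec set"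
  where "kspan \<equiv> module.span scale"

definition tensS :: "('k::field, 'i) vec set \<Rightarrow> ('k, 'i) vec set \<Rightarrow> ('k, 'i) vec set"
    (infixr \<open>\<otimes>\<^sub>S\<close> 70)
  where "V \<otimes>\<^sub>S W = kspan {v \<otimes> w | v w. v \<in> V \<and> w \<in> W}"

text \<open>The ground field as an object is the line spanned by \<open>unitv\<close>.\<close>

definition unitv :: "('k::field, 'i) vec"
  where "unitv = Poly_Mapping.single Triv 1"

definition kline :: "('k::field, 'i) vec set"
  where "kline = kspan {unitv}"

definition linear_on :: "('k::field, 'i) vec set \<Rightarrow> ('k, 'i) vec set \<Rightarrow> (('k, 'i) vec \<Rightarrow> ('k, 'i) vec) \<Rightarrow> bool"
  where "linear_on V W f \<longleftrightarrow>
    (\<forall>v\<in>V. f v \<in> W) \<and>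
    (\<forall>v\<in>V. \<forall>v'\<in>V. f (v + v') = f v + f v') \<and>
    (\<forall>c. \<forall>v\<in>V. f (scale c v) = scale c (f v))"

definition functional_on :: "('k::field, 'i) vec set \<Rightarrow> (('k, 'i) vec \<Rightarrow> 'k) \<Rightarrow> bool"
  where "functional_on V f \<longleftrightarrow>
    (\<forall>v\<in>V. \<forall>v'\<in>V. f (v + v') = f v + f v') \<and>
    (\<forall>c. \<forall>v\<in>V. f (scale c v) = c * f v)"

definition bilinear_on :: "('k::field, 'i) vec set \<Rightarrow> ('k, 'i) vec set \<Rightarrow> ('k, 'i) vec set \<Rightarrow>
    (('k, 'i) vec \<Rightarrow> ('k, 'i) vec \<Rightarrow> ('k, 'i) vec) \<Rightarrow> bool"
  where "bilinear_on U V W f \<longleftrightarrow>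
    (\<forall>u\<in>U. linear_on V W (f u)) \<and> (\<forall>v\<in>V. linear_on U W (\<lambda>u. f u v))"

text \<open>
  Sweedler notation: for \<open>z = v\<^sub>1 \<otimes> w\<^sub>1 + \<dots> + v\<^sub>n \<otimes> w\<^sub>n\<close> in \<open>V \<otimes>\<^sub>S W\<close>, \<open>sw V W z f\<close> is
  \<open>f v\<^sub>1 w\<^sub>1 + \<dots> + f v\<^sub>n w\<^sub>n\<close>. For \<open>f\<close> bilinear on \<open>V \<times> W\<close> this does not depend on the chosen
  expression (lemma \<open>sw_eq\<close> below), so \<open>\<lambda>z. sw V W z f\<close> is the linear map on \<open>V \<otimes>\<^sub>S W\<close> induced by \<open>f\<close>.
\<close>

definition tensor_rep :: "('k::field, 'i) vec set \<Rightarrow> ('k, 'i) vec set \<Rightarrow> ('k, 'i) vec \<Rightarrow>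
    (('k, 'i) vec \<times> ('k, 'i) vec) list \<Rightarrow> bool"
  where "tensor_rep V W z ps \<longleftrightarrow> set ps \<subseteq> V \<times> W \<and> z = (\<Sum>(v, w)\<leftarrow>ps. v \<otimes> w)"

definition sw :: "('k::field, 'i) vec set \<Rightarrow> ('k, 'i) vec set \<Rightarrow> ('k, 'i) vec \<Rightarrow>
    (('k, 'i) vec \<Rightarrow> ('k, 'i) vec \<Rightarrow> 'c::comm_monoid_add) \<Rightarrow> 'c"
  where "sw V W z f = (\<Sum>(v, w)\<leftarrow>(SOME ps. tensor_rep V W z ps). f v w)"

definition sw3 :: "('k::field, 'i) vec set \<Rightarrow> ('k, 'i) vec set \<Rightarrow> ('k, 'i) vec set \<Rightarrow> ('k, 'i) vec \<Rightarrow>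
    (('k, 'i) vec \<Rightarrow> ('k, 'i) vec \<Rightarrow> ('k, 'i) vec \<Rightarrow> 'c::comm_monoid_add) \<Rightarrow> 'c"
  where "sw3 U V W z f = sw U (V \<otimes>\<^sub>S W) z (\<lambda>u y. sw V W y (f u))"

lemma tens_add_left: "(u + u') \<otimes> v = u \<otimes> v + u' \<otimes> v"
  by transfer (auto simp: fun_eq_iff algebra_simps split: idx.splits)

lemma tens_add_right: "u \<otimes> (v + v') = u \<otimes> v + u \<otimes> v'"
  by transfer (auto simp: fun_eq_iff algebra_simps split: idx.splits)

lemma tens_scale_left: "scale c u \<otimes> v = scale c (u \<otimes> v)"
  by transfer (auto simp: fun_eq_iff algebra_simps split: idx.splits)

lemma tens_scale_right: "u \<otimes> scale c v = scale c (u \<otimes> v)"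
  by transfer (auto simp: fun_eq_iff algebra_simps split: idx.splits)

lemma tensor_rep_exists:
  assumes "ksubspace V" "z \<in> V \<otimes>\<^sub>S W"
  shows "\<exists>ps. tensor_rep V W z ps"
  using assms(2) unfolding tensS_def
proof (induction rule: kv.span_induct_alt)
  case base
  then show ?case by (intro exI[of _ "[]"]) (simp add: tensor_rep_def)
next
  case (step c x y)
  then obtain v w ps where "x = v \<otimes> w" "v \<in> V" "w \<in> W" "tensor_rep V W y ps" by blast
  then have "tensor_rep V W (scale c x + y) ((scale c v, w) # ps)"
    using assms(1) by (auto simp: tensor_rep_def tens_scale_left kv.subspace_def)
  then show ?case by blast
qed

lemma sum_of_singles: "(u :: ('k::field, 'i) vec)
    = (\<Sum>i\<in>Poly_Mapping.keys u. scale (Poly_Mapping.lookup u i) (Poly_Mapping.single i 1))"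
proof (rule poly_mapping_eqI)
  fix k :: "'i idx"
  have *: "Poly_Mapping.lookup (scale c (Poly_Mapping.single i 1)) k = (if k = i then c else 0)" for c :: 'k and i
    by transfer auto
  show "Poly_Mapping.lookup u k = Poly_Mapping.lookup (\<Sum>i\<in>Poly_Mapping.keys u. scale (Poly_Mapping.lookup u i) (Poly_Mapping.single i 1)) k"
    by (simp add: lookup_sum * in_keys_iff sum.delta)
qed

text \<open>The universal property of the tensor product.\<close>

lemma tensor_universal:
  fixes s :: "'k::field \<Rightarrow> 'c::ab_group_add \<Rightarrow> 'c" and V W :: "('k, 'i) vec set"
  assumes "vector_space s" and V: "ksubspace V" and W: "ksubspace W"
    and al: "\<And>v v' w. v \<in> V \<Longrightarrow> v' \<in> V \<Longrightarrow> w \<in> W \<Longrightarrow> f (v + v') w = f v w + f v' w"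
    and sl: "\<And>c v w. v \<in> V \<Longrightarrow> w \<in> W \<Longrightarrow> f (scale c v) w = s c (f v w)"
    and ar: "\<And>v w w'. v \<in> V \<Longrightarrow> w \<in> W \<Longrightarrow> w' \<in> W \<Longrightarrow> f v (w + w') = f v w + f v w'"
    and sr: "\<And>c v w. v \<in> V \<Longrightarrow> w \<in> W \<Longrightarrow> f v (scale c w) = s c (f v w)"
  obtains \<Phi> where "\<And>x y. \<Phi> (x + y) = \<Phi> x + \<Phi> y" "\<And>c x. \<Phi> (scale c x) = s c (\<Phi> x)"
    "\<And>v w. v \<in> V \<Longrightarrow> w \<in> W \<Longrightarrow> \<Phi> (v \<otimes> w) = f v w"
proof -
  interpret s: vector_space s by fact
  interpret kk: vector_space_pair "scale :: 'k \<Rightarrow> ('k, 'i) vec \<Rightarrow> _" scale by unfold_locales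
  have proj: "\<exists>g. (\<forall>x. g x \<in> X) \<and> Vector_Spaces.linear scale scale g \<and> (\<forall>v\<in>X. g v = v)"
    if "ksubspace X" for X :: "('k, 'i) vec set"
    using kk.linear_exists_left_inverse_on[OF kv.linear_id that] by auto
  obtain p where p: "\<And>x. p x \<in> V" "Vector_Spaces.linear scale scale p" "\<And>v. v \<in> V \<Longrightarrow> p v = v"
    using proj[OF V] by blast
  obtain q where q: "\<And>x. q x \<in> W" "Vector_Spaces.linear scale scale q" "\<And>v. v \<in> W \<Longrightarrow> q v = v"
    using proj[OF W] by blast
  interpret p: Vector_Spaces.linear scale scale p by fact
  interpret q: Vector_Spaces.linear scale scale q by fact
  let ?e = "\<lambda>i::'i idx. Poly_Mapping.single i (1::'k)"
  define g where "g k = (case k of Join i j \<Rightarrow> f (p (?e i)) (q (?e j)) | _ \<Rightarrow> 0)" for k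
  define \<Phi> where "\<Phi> z = (\<Sum>k\<in>Poly_Mapping.keys z. s (Poly_Mapping.lookup z k) (g k))" for z :: "('k, 'i) vec"
  have sup: "\<Phi> z = (\<Sum>k\<in>K. s (Poly_Mapping.lookup z k) (g k))" if "finite K" "Poly_Mapping.keys z \<subseteq> K" for z K
    unfolding \<Phi>_def using that by (intro sum.mono_neutral_left) (auto simp: in_keys_iff)
  have add: "\<Phi> (x + y) = \<Phi> x + \<Phi> y" for x y
  proof -
    let ?K = "Poly_Mapping.keys x \<union> Poly_Mapping.keys y"
    have "\<Phi> (x + y) = (\<Sum>k\<in>?K. s (Poly_Mapping.lookup (x + y) k) (g k))"
      by (intro sup) (auto simp: keys_add)
    also have "\<dots> = (\<Sum>k\<in>?K. s (Poly_Mapping.lookup x k) (g k)) + (\<Sum>k\<in>?K. s (Poly_Mapping.lookup y k) (g k))"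
      by (simp add: lookup_add s.scale_left_distrib sum.distrib)
    also have "\<dots> = \<Phi> x + \<Phi> y"
      using sup[of ?K x] sup[of ?K y] by simp
    finally show ?thesis .
  qed
  have lsc: "Poly_Mapping.lookup (scale c x) k = c * Poly_Mapping.lookup x k" for c x and k :: "'i idx"
    by transfer simp
  have scl: "\<Phi> (scale c x) = s c (\<Phi> x)" for c x
  proof -
    have "\<Phi> (scale c x) = (\<Sum>k\<in>Poly_Mapping.keys x. s (Poly_Mapping.lookup (scale c x) k) (g k))"
      by (intro sup) (auto simp: in_keys_iff lsc)
    then show ?thesis by (simp add: lsc \<Phi>_def s.scale_sum_right)
  qed
  have z0: "\<Phi> 0 = 0" by (simp add: \<Phi>_def)
  have sm: "\<Phi> (\<Sum>i\<in>I. h i) = (\<Sum>i\<in>I. \<Phi> (h i))" for I :: "'i idx set" and h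
    by (induction I rule: infinite_finite_induct) (auto simp: add z0)
  have ee: "?e i \<otimes> ?e j = ?e (Join i j)" for i j
    by transfer (auto simp: fun_eq_iff when_def split: idx.splits)
  have ge: "\<Phi> (?e k) = g k" for k by (simp add: \<Phi>_def)
  have lin_l: "f (p (\<Sum>i\<in>I. scale (c i) (h i))) (q y) = (\<Sum>i\<in>I. s (c i) (f (p (h i)) (q y)))"
    for I :: "'i idx set" and c h y
  proof (induction I rule: infinite_finite_induct)
    case empty
    show ?case using sl[OF p(1)[of 0] q(1)[of y], of 0] by (simp add: p.zero)
  next
    case (infinite I)
    show ?case using sl[OF p(1)[of 0] q(1)[of y], of 0] infinite by (simp add: p.zero)
  next
    case (insert i I)
    then show ?case by (simp add: p.add p.scale al sl p(1) q(1) kv.subspace_scale[OF V])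
  qed
  have lin_r: "f (p x) (q (\<Sum>i\<in>I. scale (c i) (h i))) = (\<Sum>i\<in>I. s (c i) (f (p x) (q (h i))))"
    for I :: "'i idx set" and c h x
  proof (induction I rule: infinite_finite_induct)
    case empty
    show ?case using sr[OF p(1)[of x] q(1)[of 0], of 0] by (simp add: q.zero)
  next
    case (infinite I)
    show ?case using sr[OF p(1)[of x] q(1)[of 0], of 0] infinite by (simp add: q.zero)
  next
    case (insert i I)
    then show ?case by (simp add: q.add q.scale ar sr p(1) q(1) kv.subspace_scale[OF W])
  qed
  have tl: "(\<Sum>i\<in>I. scale (c i) (h i)) \<otimes> y = (\<Sum>i\<in>I. scale (c i) (h i \<otimes> y))"
    for I :: "'i idx set" and c h and y :: "('k, 'i) vec"
    by (induction I rule: infinite_finite_induct)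
      (auto simp: tens_add_left tens_scale_left intro: tens_scale_left[of 0, simplified])
  have tr: "y \<otimes> (\<Sum>i\<in>I. scale (c i) (h i)) = (\<Sum>i\<in>I. scale (c i) (y \<otimes> h i))"
    for I :: "'i idx set" and c h and y :: "('k, 'i) vec"
    by (induction I rule: infinite_finite_induct)
      (auto simp: tens_add_right tens_scale_right intro: tens_scale_right[of _ 0, simplified])
  have main: "\<Phi> (u \<otimes> w) = f (p u) (q w)" for u w
  proof -
    have "\<Phi> (u \<otimes> w) = \<Phi> ((\<Sum>i\<in>Poly_Mapping.keys u. scale (Poly_Mapping.lookup u i) (?e i)) \<otimes> (\<Sum>j\<in>Poly_Mapping.keys w. scale (Poly_Mapping.lookup w j) (?e j)))"
      by (simp flip: sum_of_singles)
    also have "\<dots> = (\<Sum>i\<in>Poly_Mapping.keys u. s (Poly_Mapping.lookup u i) (\<Sum>j\<in>Poly_Mapping.keys w. s (Poly_Mapping.lookup w j) (f (p (?e i)) (q (?e j)))))"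
      unfolding tl sm scl unfolding tr sm scl ee ge by (simp add: g_def)
    also have "\<dots> = f (p (\<Sum>i\<in>Poly_Mapping.keys u. scale (Poly_Mapping.lookup u i) (?e i))) (q (\<Sum>j\<in>Poly_Mapping.keys w. scale (Poly_Mapping.lookup w j) (?e j)))"
      unfolding lin_l unfolding lin_r ..
    also have "\<dots> = f (p u) (q w)" by (simp flip: sum_of_singles)
    finally show ?thesis .
  qed
  show thesis by (rule that[of \<Phi>]) (auto simp: add scl main p q)
qed

lemma sw_eq:
  fixes s :: "'k::field \<Rightarrow> 'c::ab_group_add \<Rightarrow> 'c" and V W :: "('k, 'i) vec set"
  assumes "vector_space s" and V: "ksubspace V" and W: "ksubspace W"
    and "\<And>v v' w. v \<in> V \<Longrightarrow> v' \<in> V \<Longrightarrow> w \<in> W \<Longrightarrow> f (v + v') w = f v w + f v' w"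
    and "\<And>c v w. v \<in> V \<Longrightarrow> w \<in> W \<Longrightarrow> f (scale c v) w = s c (f v w)"
    and "\<And>v w w'. v \<in> V \<Longrightarrow> w \<in> W \<Longrightarrow> w' \<in> W \<Longrightarrow> f v (w + w') = f v w + f v w'"
    and "\<And>c v w. v \<in> V \<Longrightarrow> w \<in> W \<Longrightarrow> f v (scale c w) = s c (f v w)"
    and z: "tensor_rep V W z ps"
  shows "sw V W z f = (\<Sum>(v, w)\<leftarrow>ps. f v w)"
proof -
  obtain \<Phi> where \<Phi>: "\<And>x y. \<Phi> (x + y) = \<Phi> x + \<Phi> y" "\<And>c x. \<Phi> (scale c x) = s c (\<Phi> x)"
    "\<And>v w. v \<in> V \<Longrightarrow> w \<in> W \<Longrightarrow> \<Phi> (v \<otimes> w) = f v w"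
    using tensor_universal[of s V W f] assms(1-7) by blast
  have "\<Phi> 0 = 0" using \<Phi>(1)[of 0 0] by simp
  then have *: "set qs \<subseteq> V \<times> W \<Longrightarrow> \<Phi> (\<Sum>(v, w)\<leftarrow>qs. v \<otimes> w) = (\<Sum>(v, w)\<leftarrow>qs. f v w)" for qs
    by (induction qs) (auto simp: \<Phi>)
  have "tensor_rep V W z (SOME ps. tensor_rep V W z ps)" using z by (rule someI)
  then show ?thesis using z *[of ps] *[of "SOME ps. tensor_rep V W z ps"]
    by (simp add: sw_def tensor_rep_def)
qed


section \<open>Algebras, coalgebras, Hopf algebras\<close>

record (overloaded) ('k::zero, 'i) alg =
  carr :: "('k, 'i) vec set"
  mul :: "('k, 'i) vec \<Rightarrow> ('k, 'i) vec \<Rightarrow> ('k, 'i) vec"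
  one :: "('k, 'i) vec"

text \<open>The same record of operations serves for Hopf algebras and for weak Hopf algebras.\<close>

record (overloaded) ('k::zero, 'i) hopf = "('k, 'i) alg" +
  cop :: "('k, 'i) vec \<Rightarrow> ('k, 'i) vec"
  cou :: "('k, 'i) vec \<Rightarrow> 'k"
  antp :: "('k, 'i) vec \<Rightarrow> ('k, 'i) vec"

definition is_algebra :: "('k::field, 'i, 'z) alg_scheme \<Rightarrow> bool"
  where "is_algebra A \<longleftrightarrow>
    ksubspace (carr A) \<and>
    bilinear_on (carr A) (carr A) (carr A) (mul A) \<and>
    one A \<in> carr A \<and>
    (\<forall>x\<in>carr A. mul A (one A) x = x \<and> mul A x (one A) = x) \<and>
    (\<forall>x\<in>carr A. \<forall>y\<in>carr A. \<forall>z\<in>carr A. mul A (mul A x y) z = mul A x (mul A y z))"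

definition is_coalgebra :: "('k::field, 'i, 'z) hopf_scheme \<Rightarrow> bool"
  where "is_coalgebra C \<longleftrightarrow>
    ksubspace (carr C) \<and>
    linear_on (carr C) (carr C \<otimes>\<^sub>S carr C) (cop C) \<and>
    functional_on (carr C) (cou C) \<and>
    (\<forall>x\<in>carr C.
      sw (carr C) (carr C) (cop C x) (\<lambda>x1 x2.
        sw (carr C) (carr C) (cop C x1) (\<lambda>x11 x12. x11 \<otimes> x12 \<otimes> x2)) =
      sw (carr C) (carr C) (cop C x) (\<lambda>x1 x2. x1 \<otimes> cop C x2)) \<and>
    (\<forall>x\<in>carr C.
      sw (carr C) (carr C) (cop C x) (\<lambda>x1 x2. scale (cou C x1) x2) = x \<and>
      sw (carr C) (carr C) (cop C x) (\<lambda>x1 x2. scale (cou C x2) x1) = x)"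

definition is_hopf_algebra :: "('k::field, 'i, 'z) hopf_scheme \<Rightarrow> bool"
  where "is_hopf_algebra L \<longleftrightarrow>
    is_algebra L \<and> is_coalgebra L \<and>
    (\<forall>x\<in>carr L. \<forall>y\<in>carr L.
      cop L (mul L x y) =
        sw (carr L) (carr L) (cop L x) (\<lambda>x1 x2. sw (carr L) (carr L) (cop L y) (\<lambda>y1 y2.
          mul L x1 y1 \<otimes> mul L x2 y2)) \<and>
      cou L (mul L x y) = cou L x * cou L y) \<and>
    cop L (one L) = one L \<otimes> one L \<and>
    cou L (one L) = 1 \<and>
    linear_on (carr L) (carr L) (antp L) \<and>
    (\<forall>x\<in>carr L.
      sw (carr L) (carr L) (cop L x) (\<lambda>x1 x2. mul L (antp L x1) x2) = scale (cou L x) (one L) \<and>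
      sw (carr L) (carr L) (cop L x) (\<lambda>x1 x2. mul L x1 (antp L x2)) = scale (cou L x) (one L))"

abbreviation antp_inv :: "('k::field, 'i, 'z) hopf_scheme \<Rightarrow> ('k, 'i) vec \<Rightarrow> ('k, 'i) vec"
  where "antp_inv L \<equiv> the_inv_into (carr L) (antp L)"

definition is_right_module_algebra ::
    "('k::field, 'i) hopf \<Rightarrow> ('k, 'i) alg \<Rightarrow> (('k, 'i) vec \<Rightarrow> ('k, 'i) vec \<Rightarrow> ('k, 'i) vec) \<Rightarrow> bool"
  where "is_right_module_algebra L B act \<longleftrightarrow>
    bilinear_on (carr B) (carr L) (carr B) act \<and>
    (\<forall>b\<in>carr B. act b (one L) = b) \<and>
    (\<forall>b\<in>carr B. \<forall>h\<in>carr L. \<forall>h'\<in>carr L. act (act b h) h' = act b (mul L h h')) \<and>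
    (\<forall>b\<in>carr B. \<forall>b'\<in>carr B. \<forall>h\<in>carr L.
      act (mul B b b') h =
        sw (carr L) (carr L) (cop L h) (\<lambda>h1 h2. mul B (act b h1) (act b' h2))) \<and>
    (\<forall>h\<in>carr L. act (one B) h = scale (cou L h) (one B))"


section \<open>Quantum transformation groupoids\<close>

text \<open>
  \<open>B\<close> and its opposite algebra have the same underlying space; \<open>mul B\<close> is always the product of \<open>B\<close>.
  The first product clause below is idempotency of \<open>e\<close> in the tensor product of \<open>B\<close> with its opposite.
\<close>

definition is_symmetric_separability_idempotent :: "('k::field, 'i) alg \<Rightarrow> ('k, 'i) vec \<Rightarrow> bool"
  where "is_symmetric_separability_idempotent B e \<longleftrightarrow>
    e \<in> carr B \<otimes>\<^sub>S carr B \<and>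
    sw (carr B) (carr B) e (\<lambda>e1 e2. sw (carr B) (carr B) e (\<lambda>f1 f2. mul B e1 f1 \<otimes> mul B f2 e2)) = e \<and>
    sw (carr B) (carr B) e (\<lambda>e1 e2. e2 \<otimes> e1) = e \<and>
    (\<forall>b\<in>carr B.
      sw (carr B) (carr B) e (\<lambda>e1 e2. mul B b e1 \<otimes> e2) =
      sw (carr B) (carr B) e (\<lambda>e1 e2. e1 \<otimes> mul B e2 b)) \<and>
    sw (carr B) (carr B) e (\<lambda>e1 e2. mul B e1 e2) = one B"

text \<open>The left action of \<open>L\<close> on the opposite algebra of \<open>B\<close>.\<close>

definition lact :: "('k::field, 'i) hopf \<Rightarrow> (('k, 'i) vec \<Rightarrow> ('k, 'i) vec \<Rightarrow> ('k, 'i) vec) \<Rightarrow>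
    ('k, 'i) vec \<Rightarrow> ('k, 'i) vec \<Rightarrow> ('k, 'i) vec"
  where "lact L act h a = act a (antp L h)"

definition qtg_data :: "('k::field, 'i) hopf \<Rightarrow> ('k, 'i) alg \<Rightarrow>
    (('k, 'i) vec \<Rightarrow> ('k, 'i) vec \<Rightarrow> ('k, 'i) vec) \<Rightarrow> ('k, 'i) vec \<Rightarrow> (('k, 'i) vec \<Rightarrow> 'k) \<Rightarrow> bool"
  where "qtg_data L B act e \<omega> \<longleftrightarrow>
    is_hopf_algebra L \<and> bij_betw (antp L) (carr L) (carr L) \<and>
    is_algebra B \<and> is_symmetric_separability_idempotent B e \<and>
    is_right_module_algebra L B act \<and>
    functional_on (carr B) \<omega> \<and>
    (\<forall>a\<in>carr B. \<forall>b\<in>carr B. \<omega> (mul B a b) = \<omega> (mul B b a)) \<and>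
    (\<forall>a\<in>carr B. (\<forall>b\<in>carr B. \<omega> (mul B a b) = 0) \<longrightarrow> a = 0) \<and>
    sw (carr B) (carr B) e (\<lambda>e1 e2. scale (\<omega> e1) e2) = one B \<and>
    sw (carr B) (carr B) e (\<lambda>e1 e2. scale (\<omega> e2) e1) = one B \<and>
    (\<forall>a\<in>carr B. \<forall>b\<in>carr B. \<forall>h\<in>carr L. \<omega> (mul B (lact L act h a) b) = \<omega> (mul B a (act b h))) \<and>
    (\<forall>h\<in>carr L.
      sw (carr B) (carr B) e (\<lambda>e1 e2. e1 \<otimes> lact L act h e2) =
      sw (carr B) (carr B) e (\<lambda>e1 e2. act e1 h \<otimes> e2))"

definition qtg :: "('k::field, 'i) hopf \<Rightarrow> ('k, 'i) alg \<Rightarrow>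
    (('k, 'i) vec \<Rightarrow> ('k, 'i) vec \<Rightarrow> ('k, 'i) vec) \<Rightarrow> ('k, 'i) vec \<Rightarrow> (('k, 'i) vec \<Rightarrow> 'k) \<Rightarrow> ('k, 'i) hopf"
  where "qtg L B act e \<omega> =
    \<lparr>carr = carr B \<otimes>\<^sub>S carr L \<otimes>\<^sub>S carr B,
     mul = (\<lambda>u v.
       sw3 (carr B) (carr L) (carr B) u (\<lambda>a h b.
       sw3 (carr B) (carr L) (carr B) v (\<lambda>a' h' b'.
       sw (carr L) (carr L) (cop L h) (\<lambda>h1 h2.
       sw (carr L) (carr L) (cop L h') (\<lambda>h1' h2'.
         mul B (lact L act h1 a') a \<otimes> mul L h2 h1' \<otimes> mul B (act b h2') b'))))),
     one = one B \<otimes> one L \<otimes> one B,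
     cop = (\<lambda>u.
       sw3 (carr B) (carr L) (carr B) u (\<lambda>a h b.
       sw (carr L) (carr L) (cop L h) (\<lambda>h1 h'.
       sw (carr L) (carr L) (cop L h') (\<lambda>h2 h3.
       sw (carr B) (carr B) e (\<lambda>e1 e2.
         (a \<otimes> h1 \<otimes> e1) \<otimes> (lact L act h2 e2 \<otimes> h3 \<otimes> b)))))),
     cou = (\<lambda>u.
       sw3 (carr B) (carr L) (carr B) u (\<lambda>a h b. \<omega> (mul B a (act b (antp_inv L h))))),
     antp = (\<lambda>u.
       sw3 (carr B) (carr L) (carr B) u (\<lambda>a h b. b \<otimes> antp L h \<otimes> a))\<rparr>"

definition eps_s :: "('k::field, 'i) hopf \<Rightarrow> ('k, 'i) vec \<Rightarrow> ('k, 'i) vec"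
  where "eps_s H x =
    sw (carr H) (carr H) (cop H (one H)) (\<lambda>u1 u2. scale (cou H (mul H x u2)) u1)"


section \<open>Categories, functors, lax monoidal functors\<close>

record ('o, 'a) cat =
  Obj :: "'o set"
  Arr :: "'a set"
  Dom :: "'a \<Rightarrow> 'o"
  Cod :: "'a \<Rightarrow> 'o"
  Id :: "'o \<Rightarrow> 'a"
  Cmp :: "'a \<Rightarrow> 'a \<Rightarrow> 'a"

definition hom :: "('o, 'a, 'z) cat_scheme \<Rightarrow> 'o \<Rightarrow> 'o \<Rightarrow> 'a set"
  where "hom C X Y = {f \<in> Arr C. Dom C f = X \<and> Cod C f = Y}"

definition is_category :: "('o, 'a, 'z) cat_scheme \<Rightarrow> bool"
  where "is_category C \<longleftrightarrow>
    (\<forall>f\<in>Arr C. Dom C f \<in> Obj C \<and> Cod C f \<in> Obj C) \<and>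
    (\<forall>X\<in>Obj C. Id C X \<in> hom C X X) \<and>
    (\<forall>f\<in>Arr C. \<forall>g\<in>Arr C. Dom C g = Cod C f \<longrightarrow> Cmp C g f \<in> hom C (Dom C f) (Cod C g)) \<and>
    (\<forall>f\<in>Arr C. Cmp C f (Id C (Dom C f)) = f \<and> Cmp C (Id C (Cod C f)) f = f) \<and>
    (\<forall>f\<in>Arr C. \<forall>g\<in>Arr C. \<forall>h\<in>Arr C. Dom C g = Cod C f \<longrightarrow> Dom C h = Cod C g \<longrightarrow>
      Cmp C h (Cmp C g f) = Cmp C (Cmp C h g) f)"

text \<open>
  Only the data of a monoidal category, which is all that the constraints of a lax monoidal
  functor refer to. That the two categories below satisfy the pentagon and triangle axioms is
  standard and is neither assumed nor asserted.
\<close>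

record ('o, 'a) moncat = "('o, 'a) cat" +
  TenO :: "'o \<Rightarrow> 'o \<Rightarrow> 'o"
  TenA :: "'a \<Rightarrow> 'a \<Rightarrow> 'a"
  UnitO :: 'o
  Assoc :: "'o \<Rightarrow> 'o \<Rightarrow> 'o \<Rightarrow> 'a"
  LUnit :: "'o \<Rightarrow> 'a"
  RUnit :: "'o \<Rightarrow> 'a"

record ('o, 'a, 'p, 'b) func =
  FO :: "'o \<Rightarrow> 'p"
  FA :: "'a \<Rightarrow> 'b"

definition is_functor ::
    "('o, 'a, 'y) cat_scheme \<Rightarrow> ('p, 'b, 'z) cat_scheme \<Rightarrow> ('o, 'a, 'p, 'b) func \<Rightarrow> bool"
  where "is_functor C D F \<longleftrightarrow>
    is_category C \<and> is_category D \<and>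
    (\<forall>X\<in>Obj C. FO F X \<in> Obj D) \<and>
    (\<forall>f\<in>Arr C. FA F f \<in> hom D (FO F (Dom C f)) (FO F (Cod C f))) \<and>
    (\<forall>X\<in>Obj C. FA F (Id C X) = Id D (FO F X)) \<and>
    (\<forall>f\<in>Arr C. \<forall>g\<in>Arr C. Dom C g = Cod C f \<longrightarrow> FA F (Cmp C g f) = Cmp D (FA F g) (FA F f))"

definition func_comp :: "('p, 'b, 'q, 'c) func \<Rightarrow> ('o, 'a, 'p, 'b) func \<Rightarrow> ('o, 'a, 'q, 'c) func"
  where "func_comp G F = \<lparr>FO = (\<lambda>X. FO G (FO F X)), FA = (\<lambda>f. FA G (FA F f))\<rparr>"

definition lax_monoidal_functor ::
    "('o, 'a) moncat \<Rightarrow> ('p, 'b) moncat \<Rightarrow> ('o, 'a, 'p, 'b) func \<Rightarrow>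
      ('o \<Rightarrow> 'o \<Rightarrow> 'b) \<Rightarrow> 'b \<Rightarrow> bool"
  where "lax_monoidal_functor C D F F2 F0 \<longleftrightarrow>
    is_functor C D F \<and>
    (\<forall>X\<in>Obj C. \<forall>Y\<in>Obj C. F2 X Y \<in> hom D (TenO D (FO F X) (FO F Y)) (FO F (TenO C X Y))) \<and>
    (\<forall>f\<in>Arr C. \<forall>g\<in>Arr C.
      Cmp D (FA F (TenA C f g)) (F2 (Dom C f) (Dom C g)) =
      Cmp D (F2 (Cod C f) (Cod C g)) (TenA D (FA F f) (FA F g))) \<and>
    F0 \<in> hom D (UnitO D) (FO F (UnitO C)) \<and>
    (\<forall>X\<in>Obj C. \<forall>Y\<in>Obj C. \<forall>Z\<in>Obj C.
      Cmp D (FA F (Assoc C X Y Z))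
        (Cmp D (F2 (TenO C X Y) Z) (TenA D (F2 X Y) (Id D (FO F Z)))) =
      Cmp D (F2 X (TenO C Y Z))
        (Cmp D (TenA D (Id D (FO F X)) (F2 Y Z)) (Assoc D (FO F X) (FO F Y) (FO F Z)))) \<and>
    (\<forall>X\<in>Obj C.
      LUnit D (FO F X) =
        Cmp D (FA F (LUnit C X)) (Cmp D (F2 (UnitO C) X) (TenA D F0 (Id D (FO F X))))) \<and>
    (\<forall>X\<in>Obj C.
      RUnit D (FO F X) =
        Cmp D (FA F (RUnit C X)) (Cmp D (F2 X (UnitO C)) (TenA D (Id D (FO F X)) F0)))"


section \<open>Categories of comodules\<close>

record (overloaded) ('k::zero, 'i) comod =
  sp :: "('k, 'i) vec set"
  rco :: "('k, 'i) vec \<Rightarrow> ('k, 'i) vec"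

record (overloaded) ('k::zero, 'i) bicomod = "('k, 'i) comod" +
  lco :: "('k, 'i) vec \<Rightarrow> ('k, 'i) vec"

definition is_right_comodule :: "('k::field, 'i) hopf \<Rightarrow> ('k, 'i, 'z) comod_scheme \<Rightarrow> bool"
  where "is_right_comodule C X \<longleftrightarrow>
    ksubspace (sp X) \<and>
    linear_on (sp X) (sp X \<otimes>\<^sub>S carr C) (rco X) \<and>
    (\<forall>x\<in>sp X.
      sw (sp X) (carr C) (rco X x) (\<lambda>x0 x1.
        sw (sp X) (carr C) (rco X x0) (\<lambda>x00 x01. x00 \<otimes> x01 \<otimes> x1)) =
      sw (sp X) (carr C) (rco X x) (\<lambda>x0 x1. x0 \<otimes> cop C x1)) \<and>
    (\<forall>x\<in>sp X. sw (sp X) (carr C) (rco X x) (\<lambda>x0 x1. scale (cou C x1) x0) = x)"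

definition is_bicomodule :: "('k::field, 'i) hopf \<Rightarrow> ('k, 'i) bicomod \<Rightarrow> bool"
  where "is_bicomodule C X \<longleftrightarrow>
    is_right_comodule C X \<and>
    linear_on (sp X) (carr C \<otimes>\<^sub>S sp X) (lco X) \<and>
    (\<forall>x\<in>sp X.
      sw (carr C) (sp X) (lco X x) (\<lambda>y x0. y \<otimes> lco X x0) =
      sw (carr C) (sp X) (lco X x) (\<lambda>y x0. sw (carr C) (carr C) (cop C y) (\<lambda>y1 y2. y1 \<otimes> y2 \<otimes> x0))) \<and>
    (\<forall>x\<in>sp X. sw (carr C) (sp X) (lco X x) (\<lambda>y x0. scale (cou C y) x0) = x) \<and>
    (\<forall>x\<in>sp X.
      sw (carr C) (sp X) (lco X x) (\<lambda>y x0. sw (sp X) (carr C) (rco X x0) (\<lambda>x00 z. y \<otimes> x00 \<otimes> z)) =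
      sw (sp X) (carr C) (rco X x) (\<lambda>x0 z. sw (carr C) (sp X) (lco X x0) (\<lambda>y x00. y \<otimes> x00 \<otimes> z)))"

text \<open>
  A morphism is its source, its target and a function that is extensional on the source, so that
  equality of morphisms is equality of the maps on the underlying space of the source.
\<close>

record (overloaded) ('o, 'k::zero, 'i) arrow =
  src :: 'o
  trg :: 'o
  fn :: "('k, 'i) vec \<Rightarrow> ('k, 'i) vec"

definition is_right_comodule_map ::
    "('k::field, 'i) hopf \<Rightarrow> (('k, 'i, 'z) comod_scheme, 'k, 'i) arrow \<Rightarrow> bool"
  where "is_right_comodule_map C f \<longleftrightarrow>
    fn f \<in> extensional (sp (src f)) \<and>
    linear_on (sp (src f)) (sp (trg f)) (fn f) \<and>
    (\<forall>x\<in>sp (src f).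
      rco (trg f) (fn f x) =
      sw (sp (src f)) (carr C) (rco (src f) x) (\<lambda>x0 x1. fn f x0 \<otimes> x1))"

definition is_bicomodule_map ::
    "('k::field, 'i) hopf \<Rightarrow> (('k, 'i) bicomod, 'k, 'i) arrow \<Rightarrow> bool"
  where "is_bicomodule_map C f \<longleftrightarrow>
    is_right_comodule_map C f \<and>
    (\<forall>x\<in>sp (src f).
      lco (trg f) (fn f x) =
      sw (carr C) (sp (src f)) (lco (src f) x) (\<lambda>y x0. y \<otimes> fn f x0))"

definition arr_id :: "('k::field, 'i, 'z) comod_scheme \<Rightarrow> (('k, 'i, 'z) comod_scheme, 'k, 'i) arrow"
  where "arr_id X = \<lparr>src = X, trg = X, fn = (\<lambda>x\<in>sp X. x)\<rparr>"

definition arr_comp :: "(('k::field, 'i, 'z) comod_scheme, 'k, 'i) arrow \<Rightarrow>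
    (('k, 'i, 'z) comod_scheme, 'k, 'i) arrow \<Rightarrow> (('k, 'i, 'z) comod_scheme, 'k, 'i) arrow"
  where "arr_comp g f = \<lparr>src = src f, trg = trg g, fn = compose (sp (src f)) (fn g) (fn f)\<rparr>"

text \<open>
  In the next two definitions \<open>T\<close> is the monoidal product on objects, whose underlying space is a
  subspace of the tensor product of the underlying spaces.
\<close>

definition arr_tens :: "(('k::field, 'i, 'z) comod_scheme \<Rightarrow> ('k, 'i, 'z) comod_scheme \<Rightarrow> ('k, 'i, 'z) comod_scheme) \<Rightarrow>
    (('k, 'i, 'z) comod_scheme, 'k, 'i) arrow \<Rightarrow> (('k, 'i, 'z) comod_scheme, 'k, 'i) arrow \<Rightarrow>
    (('k, 'i, 'z) comod_scheme, 'k, 'i) arrow"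
  where "arr_tens T f g =
    \<lparr>src = T (src f) (src g),
     trg = T (trg f) (trg g),
     fn = (\<lambda>z\<in>sp (T (src f) (src g)). sw (sp (src f)) (sp (src g)) z (\<lambda>x y. fn f x \<otimes> fn g y))\<rparr>"

definition arr_assoc :: "(('k::field, 'i, 'z) comod_scheme \<Rightarrow> ('k, 'i, 'z) comod_scheme \<Rightarrow> ('k, 'i, 'z) comod_scheme) \<Rightarrow>
    ('k, 'i, 'z) comod_scheme \<Rightarrow> ('k, 'i, 'z) comod_scheme \<Rightarrow> ('k, 'i, 'z) comod_scheme \<Rightarrow>
    (('k, 'i, 'z) comod_scheme, 'k, 'i) arrow"
  where "arr_assoc T X Y Z =
    \<lparr>src = T (T X Y) Z,
     trg = T X (T Y Z),
     fn = (\<lambda>u\<in>sp (T (T X Y) Z).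
       sw (sp X \<otimes>\<^sub>S sp Y) (sp Z) u (\<lambda>v z. sw (sp X) (sp Y) v (\<lambda>x y. x \<otimes> y \<otimes> z)))\<rparr>"

definition comod_cat :: "('k::field, 'i) hopf \<Rightarrow>
    (('k, 'i) comod, (('k, 'i) comod, 'k, 'i) arrow) cat"
  where "comod_cat C =
    \<lparr>Obj = {X. is_right_comodule C X},
     Arr = {f. is_right_comodule C (src f) \<and> is_right_comodule C (trg f) \<and> is_right_comodule_map C f},
     Dom = src, Cod = trg, Id = arr_id, Cmp = arr_comp\<rparr>"


subsection \<open>Comodules over a weak Hopf algebra\<close>

text \<open>
  Subspaces are literal subsets of the ambient space and \<open>\<otimes>\<^sub>S\<close> is monotone, so a coaction induced
  on a subspace is given by the same function.
\<close>

definition wtens :: "('k::field, 'i) hopf \<Rightarrow> ('k, 'i) comod \<Rightarrow> ('k, 'i) comod \<Rightarrow> ('k, 'i) comod"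
  where "wtens H M N =
    \<lparr>sp = {z \<in> sp M \<otimes>\<^sub>S sp N.
       sw (sp M) (sp N) z (\<lambda>m n.
       sw (sp M) (carr H) (rco M m) (\<lambda>m0 m1.
       sw (sp N) (carr H) (rco N n) (\<lambda>n0 n1. scale (cou H (mul H m1 n1)) (m0 \<otimes> n0)))) = z},
     rco = (\<lambda>z.
       sw (sp M) (sp N) z (\<lambda>m n.
       sw (sp M) (carr H) (rco M m) (\<lambda>m0 m1.
       sw (sp N) (carr H) (rco N n) (\<lambda>n0 n1. (m0 \<otimes> n0) \<otimes> mul H m1 n1))))\<rparr>"

definition wunit :: "('k::field, 'i) hopf \<Rightarrow> ('k, 'i) comod"
  where "wunit H = \<lparr>sp = eps_s H ` carr H, rco = cop H\<rparr>"

definition wcomod_moncat :: "('k::field, 'i) hopf \<Rightarrow>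
    (('k, 'i) comod, (('k, 'i) comod, 'k, 'i) arrow) moncat"
  where "wcomod_moncat H =
    \<lparr>Obj = Obj (comod_cat H), Arr = Arr (comod_cat H),
     Dom = Dom (comod_cat H), Cod = Cod (comod_cat H),
     Id = Id (comod_cat H), Cmp = Cmp (comod_cat H),
     TenO = wtens H,
     TenA = arr_tens (wtens H),
     UnitO = wunit H,
     Assoc = arr_assoc (wtens H),
     LUnit = (\<lambda>M.
       \<lparr>src = wtens H (wunit H) M, trg = M,
        fn = (\<lambda>z\<in>sp (wtens H (wunit H) M).
          sw (sp (wunit H)) (sp M) z (\<lambda>x m.
          sw (sp M) (carr H) (rco M m) (\<lambda>m0 m1. scale (cou H (mul H x m1)) m0)))\<rparr>),
     RUnit = (\<lambda>M.
       \<lparr>src = wtens H M (wunit H), trg = M,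
        fn = (\<lambda>z\<in>sp (wtens H M (wunit H)).
          sw (sp M) (sp (wunit H)) z (\<lambda>m x.
          sw (sp M) (carr H) (rco M m) (\<lambda>m0 m1. scale (cou H (mul H m1 x)) m0)))\<rparr>)\<rparr>"


subsection \<open>Bicomodules over a Hopf algebra\<close>

definition btens :: "('k::field, 'i) hopf \<Rightarrow> ('k, 'i) bicomod \<Rightarrow> ('k, 'i) bicomod \<Rightarrow> ('k, 'i) bicomod"
  where "btens L X Y =
    \<lparr>sp = sp X \<otimes>\<^sub>S sp Y,
     rco = (\<lambda>z.
       sw (sp X) (sp Y) z (\<lambda>x y.
       sw (sp X) (carr L) (rco X x) (\<lambda>x0 x1.
       sw (sp Y) (carr L) (rco Y y) (\<lambda>y0 y1. (x0 \<otimes> y0) \<otimes> mul L x1 y1)))),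
     lco = (\<lambda>z.
       sw (sp X) (sp Y) z (\<lambda>x y.
       sw (carr L) (sp X) (lco X x) (\<lambda>xm x0.
       sw (carr L) (sp Y) (lco Y y) (\<lambda>ym y0. mul L xm ym \<otimes> (x0 \<otimes> y0)))))\<rparr>"

definition bunit :: "('k::field, 'i) hopf \<Rightarrow> ('k, 'i) bicomod"
  where "bunit L = \<lparr>sp = kline, rco = (\<lambda>c. c \<otimes> one L), lco = (\<lambda>c. one L \<otimes> c)\<rparr>"

text \<open>Below, \<open>Poly_Mapping.lookup c Triv\<close> is the scalar that the element \<open>c\<close> of the line \<open>kline\<close> stands for.\<close>

definition bicomod_moncat :: "('k::field, 'i) hopf \<Rightarrow>
    (('k, 'i) bicomod, (('k, 'i) bicomod, 'k, 'i) arrow) moncat"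
  where "bicomod_moncat L =
    \<lparr>Obj = {X. is_bicomodule L X},
     Arr = {f. is_bicomodule L (src f) \<and> is_bicomodule L (trg f) \<and> is_bicomodule_map L f},
     Dom = src, Cod = trg, Id = arr_id, Cmp = arr_comp,
     TenO = btens L,
     TenA = arr_tens (btens L),
     UnitO = bunit L,
     Assoc = arr_assoc (btens L),
     LUnit = (\<lambda>X.
       \<lparr>src = btens L (bunit L) X, trg = X,
        fn = (\<lambda>z\<in>sp (btens L (bunit L) X). sw kline (sp X) z (\<lambda>c x. scale (Poly_Mapping.lookup c Triv) x))\<rparr>),
     RUnit = (\<lambda>X.
       \<lparr>src = btens L X (bunit L), trg = X,
        fn = (\<lambda>z\<in>sp (btens L X (bunit L)). sw (sp X) kline z (\<lambda>x c. scale (Poly_Mapping.lookup c Triv) x))\<rparr>)\<rparr>"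

definition forget_left :: "(('k::field, 'i) bicomod, (('k, 'i) bicomod, 'k, 'i) arrow,
    ('k, 'i) comod, (('k, 'i) comod, 'k, 'i) arrow) func"
  where "forget_left =
    \<lparr>FO = comod.truncate,
     FA = (\<lambda>f. \<lparr>src = comod.truncate (src f), trg = comod.truncate (trg f), fn = fn f\<rparr>)\<rparr>"


section \<open>The functor \<open>\<Gamma>\<close> and its monoidal structure\<close>

definition Gamma_obj :: "('k::field, 'i) hopf \<Rightarrow> ('k, 'i) alg \<Rightarrow>
    (('k, 'i) vec \<Rightarrow> ('k, 'i) vec \<Rightarrow> ('k, 'i) vec) \<Rightarrow> ('k, 'i) vec \<Rightarrow> ('k, 'i) comod \<Rightarrow> ('k, 'i) comod"
  where "Gamma_obj L B act e X =
    \<lparr>sp = carr B \<otimes>\<^sub>S sp X \<otimes>\<^sub>S carr B,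
     rco = (\<lambda>z.
       sw3 (carr B) (sp X) (carr B) z (\<lambda>a x b.
       sw (sp X) (carr L) (rco X x) (\<lambda>x0 x1.
       sw (carr L) (carr L) (cop L x1) (\<lambda>x11 x12.
       sw (carr B) (carr B) e (\<lambda>e1 e2.
         (a \<otimes> x0 \<otimes> e1) \<otimes> (lact L act x11 e2 \<otimes> x12 \<otimes> b))))))\<rparr>"

definition Gamma :: "('k::field, 'i) hopf \<Rightarrow> ('k, 'i) alg \<Rightarrow>
    (('k, 'i) vec \<Rightarrow> ('k, 'i) vec \<Rightarrow> ('k, 'i) vec) \<Rightarrow> ('k, 'i) vec \<Rightarrow>
    (('k, 'i) comod, (('k, 'i) comod, 'k, 'i) arrow, ('k, 'i) comod, (('k, 'i) comod, 'k, 'i) arrow) func"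
  where "Gamma L B act e =
    \<lparr>FO = Gamma_obj L B act e,
     FA = (\<lambda>f.
       \<lparr>src = Gamma_obj L B act e (src f),
        trg = Gamma_obj L B act e (trg f),
        fn = (\<lambda>z\<in>sp (Gamma_obj L B act e (src f)).
          sw3 (carr B) (sp (src f)) (carr B) z (\<lambda>a x b. a \<otimes> fn f x \<otimes> b))\<rparr>)\<rparr>"

definition Gamma_hat :: "('k::field, 'i) hopf \<Rightarrow> ('k, 'i) alg \<Rightarrow>
    (('k, 'i) vec \<Rightarrow> ('k, 'i) vec \<Rightarrow> ('k, 'i) vec) \<Rightarrow> ('k, 'i) vec \<Rightarrow>
    (('k, 'i) bicomod, (('k, 'i) bicomod, 'k, 'i) arrow, ('k, 'i) comod, (('k, 'i) comod, 'k, 'i) arrow) func"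
  where "Gamma_hat L B act e = func_comp (Gamma L B act e) forget_left"

definition Gamma_hat2 :: "('k::field, 'i) hopf \<Rightarrow> ('k, 'i) alg \<Rightarrow>
    (('k, 'i) vec \<Rightarrow> ('k, 'i) vec \<Rightarrow> ('k, 'i) vec) \<Rightarrow> ('k, 'i) vec \<Rightarrow> (('k, 'i) vec \<Rightarrow> 'k) \<Rightarrow>
    ('k, 'i) bicomod \<Rightarrow> ('k, 'i) bicomod \<Rightarrow> (('k, 'i) comod, 'k, 'i) arrow"
  where "Gamma_hat2 L B act e \<omega> X X' =
    (let G = FO (Gamma_hat L B act e); T = wtens (qtg L B act e \<omega>) (G X) (G X')
     in \<lparr>src = T,
         trg = G (btens L X X'),
         fn = (\<lambda>z\<in>sp T.
           sw (sp (G X)) (sp (G X')) z (\<lambda>u v.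
           sw3 (carr B) (sp X) (carr B) u (\<lambda>a x b.
           sw3 (carr B) (sp X') (carr B) v (\<lambda>a' x' b'.
           sw (carr L) (sp X) (lco X x) (\<lambda>xm x0.
           sw (sp X') (carr L) (rco X' x') (\<lambda>x0' x1'.
             mul B (lact L act xm a') a \<otimes> (x0 \<otimes> x0') \<otimes> mul B (act b x1') b'))))))\<rparr>)"

definition Gamma_hat0 :: "('k::field, 'i) hopf \<Rightarrow> ('k, 'i) alg \<Rightarrow>
    (('k, 'i) vec \<Rightarrow> ('k, 'i) vec \<Rightarrow> ('k, 'i) vec) \<Rightarrow> ('k, 'i) vec \<Rightarrow> (('k, 'i) vec \<Rightarrow> 'k) \<Rightarrow>
    (('k, 'i) comod, 'k, 'i) arrow"
  where "Gamma_hat0 L B act e \<omega> =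
    \<lparr>src = wunit (qtg L B act e \<omega>),
     trg = FO (Gamma_hat L B act e) (bunit L),
     fn = (\<lambda>z\<in>sp (wunit (qtg L B act e \<omega>)).
       one B \<otimes> unitv \<otimes> (THE b. b \<in> carr B \<and> z = one B \<otimes> one L \<otimes> b))\<rparr>"

end

theory Submission
  imports Defs
begin

text \<open>
  Let \<open>\<rho>\<close> be the coaction on \<open>\<Gamma>(X)\<close> and \<open>\<phi>\<close> the structure map of the functor. As a comodule over itself, \<open>H\<close>
  is \<open>\<Gamma>(L)\<close>, and its product is \<open>\<phi>\<close> at \<open>(L, L)\<close> followed by \<open>\<Gamma>\<close> of the product of \<open>L\<close>. Hence coassociativity of
  \<open>\<rho>\<close> and colinearity and associativity of \<open>\<phi>\<close>, for arbitrary (bi)comodules, yield the axioms of \<open>H\<close> as well.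
  Colinearity of \<open>\<phi>\<close> rests on the invariance of \<open>e\<close> under \<open>L\<close> and on the idempotency of \<open>e\<close>. The product of
  comodules over \<open>H\<close> consists of the elements of the plain tensor product that satisfy the counit law;
  besides associativity of the product of \<open>H\<close> it only needs a multiplicative coproduct and one counit law.
\<close>

section \<open>Linear calculus of Sweedler sums\<close>

text \<open>The obstacle is bookkeeping. \<open>sw\<close> chooses a representation and behaves well
  only for maps that are bilinear on the given subspaces, while colinearity of \<phi> nests ten
  Sweedler sums. Structure maps are therefore made total, each \<open>sw\<close> is traded for a
  linear operator, and calculations reduce to exchanging sums and applying one axiom at a time. As
  that operator has vector values, scalars are always compared through their multiples of a vector.
  Why \<phi> is colinear: the coaction of a product contains one copy of \<open>e\<close>, the
  product of two coactions contains two, with an element of \<open>L\<close> acting on a first leg.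
  Invariance moves this action to the second leg, multiplicativity of the left action gathers both
  second legs under one element of \<open>L\<close>, and idempotency merges the copies. The counit
  laws use \<open>e\<close> differently, namely as a pair of dual bases for \<omega>. Coactions
  enter the main identities as bare linear maps, so that one lemma serves both for comodules and for
  the coproduct of \<open>L\<close>.\<close>

definition lin :: "(('k::field, 'i) vec \<Rightarrow> ('k, 'i) vec) \<Rightarrow> bool"
  where "lin f \<longleftrightarrow> (\<forall>x y. f (x + y) = f x + f y) \<and> (\<forall>c x. f (scale c x) = scale c (f x))"

definition linf :: "(('k::field, 'i) vec \<Rightarrow> 'k) \<Rightarrow> bool"
  where "linf f \<longleftrightarrow> (\<forall>x y. f (x + y) = f x + f y) \<and> (\<forall>c x. f (scale c x) = c * f x)"

definition bilin :: "(('k::field, 'i) vec \<Rightarrow> ('k, 'i) vec \<Rightarrow> ('k, 'i) vec) \<Rightarrow> bool"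
  where "bilin f \<longleftrightarrow> (\<forall>v. lin (\<lambda>u. f u v)) \<and> (\<forall>u. lin (\<lambda>v. f u v))"

definition trilin :: "(('k::field, 'i) vec \<Rightarrow> ('k, 'i) vec \<Rightarrow> ('k, 'i) vec \<Rightarrow> ('k, 'i) vec) \<Rightarrow> bool"
  where "trilin f \<longleftrightarrow> (\<forall>v w. lin (\<lambda>u. f u v w)) \<and> (\<forall>u w. lin (\<lambda>v. f u v w)) \<and> (\<forall>u v. lin (\<lambda>w. f u v w))"

lemma linD: "lin f \<Longrightarrow> f (x + y) = f x + f y" "lin f \<Longrightarrow> f (scale c x) = scale c (f x)"
  by (auto simp: lin_def)

lemma lin_0: "lin f \<Longrightarrow> f 0 = 0"
  using linD(1)[of f 0 0] by simp

lemma lin_sum: "lin f \<Longrightarrow> f (sum g A) = (\<Sum>i\<in>A. f (g i))"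
  by (induction A rule: infinite_finite_induct) (auto simp: lin_0 linD)

lemma bilinI: "(\<And>v. lin (\<lambda>u. f u v)) \<Longrightarrow> (\<And>u. lin (\<lambda>v. f u v)) \<Longrightarrow> bilin f"
  by (auto simp: bilin_def)

lemma trilinI:
  "(\<And>v w. lin (\<lambda>u. f u v w)) \<Longrightarrow> (\<And>u w. lin (\<lambda>v. f u v w)) \<Longrightarrow> (\<And>u v. lin (\<lambda>w. f u v w)) \<Longrightarrow> trilin f"
  by (auto simp: trilin_def)

text \<open>Apart from the base case \<open>lin_id\<close>, the rules conclude linearity of an
  operation applied to a linear argument. Each peels off one operation, so linearity in a single
  slot of a nested Sweedler term follows from its structure alone.\<close>

named_theorems lin_intros

lemma lin_id [lin_intros]: "lin (\<lambda>x. x)" by (simp add: lin_def)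

lemma lin_comp: "lin g \<Longrightarrow> lin f \<Longrightarrow> lin (\<lambda>x. g (f x))" by (simp add: lin_def)

lemma bilin_comp1: "bilin g \<Longrightarrow> lin f \<Longrightarrow> lin (\<lambda>x. g (f x) c)"
  unfolding bilin_def by (rule lin_comp[where g = "\<lambda>u. g u c"]) auto

lemma bilin_comp2: "bilin g \<Longrightarrow> lin f \<Longrightarrow> lin (\<lambda>x. g c (f x))"
  unfolding bilin_def by (rule lin_comp[where g = "\<lambda>u. g c u"]) auto

lemma trilin_comp1: "trilin g \<Longrightarrow> lin f \<Longrightarrow> lin (\<lambda>x. g (f x) c d)"
  unfolding trilin_def by (rule lin_comp[where g = "\<lambda>u. g u c d"]) auto

lemma trilin_comp2: "trilin g \<Longrightarrow> lin f \<Longrightarrow> lin (\<lambda>x. g c (f x) d)"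
  unfolding trilin_def by (rule lin_comp[where g = "\<lambda>u. g c u d"]) auto

lemma trilin_comp3: "trilin g \<Longrightarrow> lin f \<Longrightarrow> lin (\<lambda>x. g c d (f x))"
  unfolding trilin_def by (rule lin_comp[where g = "\<lambda>u. g c d u"]) auto

lemma bilin_tens: "bilin (\<otimes>)"
  by (auto simp: bilin_def lin_def tens_add_left tens_add_right tens_scale_left tens_scale_right)

lemmas lin_tens [lin_intros] = bilin_comp1[OF bilin_tens] bilin_comp2[OF bilin_tens]

lemma lin_scale [lin_intros]: "lin f \<Longrightarrow> lin (\<lambda>x. scale c (f x))"
  by (auto simp: lin_def kv.scale_right_distrib mult.commute)

lemma lin_scale_left: "linf g \<Longrightarrow> lin f \<Longrightarrow> lin (\<lambda>x. scale (g (f x)) v)"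
  by (auto simp: lin_def linf_def kv.scale_left_distrib)

lemma lin_add: "lin f \<Longrightarrow> lin g \<Longrightarrow> lin (\<lambda>x. f x + g x)"
  by (auto simp: lin_def kv.scale_right_distrib)

lemma lin_zero: "lin (\<lambda>x. 0)"
  by (auto simp: lin_def)

lemma lin_lsum: "(\<And>i. i \<in> A \<Longrightarrow> lin (f i)) \<Longrightarrow> lin (\<lambda>x. \<Sum>i\<in>A. f i x)"
  by (induction A rule: infinite_finite_induct) (auto intro: lin_add lin_zero)

text \<open>
  Every bilinear map on the ambient space factors through the basis vectors \<open>Join i j\<close>, so
  \<open>swt z f\<close> is the value at \<open>z\<close> of the linear map induced by \<open>f\<close>. In contrast to \<open>sw\<close> it is
  linear in \<open>z\<close> and \<open>f\<close> without side conditions.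
\<close>

definition swt :: "('k::field, 'i) vec \<Rightarrow> (('k, 'i) vec \<Rightarrow> ('k, 'i) vec \<Rightarrow> ('k, 'i) vec) \<Rightarrow> ('k, 'i) vec"
  where "swt z f = (\<Sum>k\<in>Poly_Mapping.keys z. scale (Poly_Mapping.lookup z k)
    (case k of Join i j \<Rightarrow> f (Poly_Mapping.single i 1) (Poly_Mapping.single j 1) | _ \<Rightarrow> 0))"

syntax "_swt" :: "idt \<Rightarrow> idt \<Rightarrow> logic \<Rightarrow> logic \<Rightarrow> logic"  (\<open>(3\<Oplus>_ _\<in>_./ _)\<close> [1000, 1000, 51, 10] 10)
translations "\<Oplus>u v\<in>z. t" \<rightleftharpoons> "CONST swt z (\<lambda>u v. t)"

definition swt3 :: "('k::field, 'i) vec \<Rightarrow> (('k, 'i) vec \<Rightarrow> ('k, 'i) vec \<Rightarrow> ('k, 'i) vec \<Rightarrow> ('k, 'i) vec) \<Rightarrow> ('k, 'i) vec"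
  where "swt3 z f = (\<Oplus>u y\<in>z. \<Oplus>v w\<in>y. f u v w)"

syntax "_swt3" :: "idt \<Rightarrow> idt \<Rightarrow> idt \<Rightarrow> logic \<Rightarrow> logic \<Rightarrow> logic"  (\<open>(3\<Oplus>_ _ _\<in>_./ _)\<close> [1000, 1000, 1000, 51, 10] 10)
translations "\<Oplus>u v w\<in>z. t" \<rightleftharpoons> "CONST swt3 z (\<lambda>u v w. t)"

section \<open>Linearity, exchange and evaluation of Sweedler sums\<close>

lemma lookup_scale: "Poly_Mapping.lookup (scale c x) k = c * Poly_Mapping.lookup x k"
  by transfer simp

text \<open>Summands outside \<open>keys z\<close> have coefficient zero. Additivity needs a common
  index set for two arguments.\<close>

lemma swt_superset:
  "finite K \<Longrightarrow> Poly_Mapping.keys z \<subseteq> K \<Longrightarrow> swt z f = (\<Sum>k\<in>K. scale (Poly_Mapping.lookup z k)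
    (case k of Join i j \<Rightarrow> f (Poly_Mapping.single i 1) (Poly_Mapping.single j 1) | _ \<Rightarrow> 0))"
  unfolding swt_def by (intro sum.mono_neutral_left) (auto simp: in_keys_iff)

lemma swt_add: "swt (x + y) f = swt x f + swt y f"
proof -
  let ?K = "Poly_Mapping.keys x \<union> Poly_Mapping.keys y"
  have "swt (x + y) f = (\<Sum>k\<in>?K. scale (Poly_Mapping.lookup (x + y) k)
    (case k of Join i j \<Rightarrow> f (Poly_Mapping.single i 1) (Poly_Mapping.single j 1) | _ \<Rightarrow> 0))"
    by (intro swt_superset) (auto simp: keys_add)
  also have "\<dots> = swt x f + swt y f"
    by (simp add: swt_superset[of ?K x] swt_superset[of ?K y] lookup_add kv.scale_left_distrib sum.distrib)
  finally show ?thesis .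
qed

lemma swt_scale: "swt (scale c x) f = scale c (swt x f)"
proof -
  have "swt (scale c x) f = (\<Sum>k\<in>Poly_Mapping.keys x. scale (Poly_Mapping.lookup (scale c x) k)
    (case k of Join i j \<Rightarrow> f (Poly_Mapping.single i 1) (Poly_Mapping.single j 1) | _ \<Rightarrow> 0))"
    by (intro swt_superset) (auto simp: in_keys_iff lookup_scale)
  then show ?thesis by (simp add: swt_def lookup_scale kv.scale_sum_right)
qed

lemma swt_0 [simp]: "swt 0 f = 0"
  by (simp add: swt_def)

lemma lin_swt_left: "lin (\<lambda>z. swt z f)"
  by (simp add: lin_def swt_add swt_scale)

lemma lin_swt_arg [lin_intros]: "lin g \<Longrightarrow> lin (\<lambda>x. swt (g x) f)"
  by (rule lin_comp[OF lin_swt_left])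

lemma lin_swt_fun [lin_intros]: "(\<And>u v. lin (\<lambda>x. f x u v)) \<Longrightarrow> lin (\<lambda>x. swt z (f x))"
  unfolding swt_def
proof (rule lin_lsum, rule lin_scale)
  fix k assume "\<And>u v. lin (\<lambda>x. f x u v)"
  then show "lin (\<lambda>x. case k of Join i j \<Rightarrow> f x (Poly_Mapping.single i 1) (Poly_Mapping.single j 1) | _ \<Rightarrow> 0)"
    by (cases k) (auto intro: lin_zero)
qed

lemma lin_swt3_arg [lin_intros]: "lin g \<Longrightarrow> lin (\<lambda>x. swt3 (g x) f)"
  unfolding swt3_def by (rule lin_swt_arg)

lemma lin_swt3_fun [lin_intros]: "(\<And>u v w. lin (\<lambda>x. f x u v w)) \<Longrightarrow> lin (\<lambda>x. swt3 z (f x))"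
  unfolding swt3_def by (intro lin_swt_fun)

lemma lin_swt_out:
  fixes z :: "('k::field, 'i) vec"
  assumes g: "lin g"
  shows "g (swt z f) = (\<Oplus>u v\<in>z. g (f u v))"
proof -
  \<comment> \<open>The default value 0 at basis vectors that are not of the form
    \<open>Join i j\<close> survives because a linear map sends 0 to 0.\<close>
  have "g (case k of Join i j \<Rightarrow> h i j | _ \<Rightarrow> 0) = (case k of Join i j \<Rightarrow> g (h i j) | _ \<Rightarrow> 0)" for k :: "'i idx" and h
    by (cases k) (auto simp: lin_0[OF g])
  then show ?thesis by (simp add: swt_def lin_sum[OF g] linD(2)[OF g])
qed

lemma lin_swt3_out: "lin g \<Longrightarrow> g (swt3 z f) = (\<Oplus>u v w\<in>z. g (f u v w))"
  by (simp add: swt3_def lin_swt_out[of g])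

lemma swt_plus_fun: "(\<Oplus>u v\<in>z. f u v + g u v) = swt z f + swt z g"
  unfolding swt_def sum.distrib[symmetric]
  by (intro sum.cong refl) (simp add: kv.scale_right_distrib split: idx.split)

lemma swt_zero_fun [simp]: "(\<Oplus>u v\<in>z. 0) = 0"
  unfolding swt_def by (intro sum.neutral) (simp split: idx.split)

lemma swt_scale_fun: "(\<Oplus>u v\<in>z. scale c (f u v)) = scale c (swt z f)"
  by (rule lin_swt_out[symmetric]) (intro lin_intros)

lemma swt_sum_fun: "(\<Oplus>u v\<in>z. \<Sum>i\<in>A. f i u v) = (\<Sum>i\<in>A. swt z (f i))"
  by (induction A rule: infinite_finite_induct) (auto simp: swt_plus_fun)

text \<open>Both sides are finite double sums over keys, so the exchange holds for arbitrary
  \<open>f\<close> and leaves no linearity to check.\<close>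

lemma swt_swap:
  fixes z w :: "('k::field, 'i) vec"
  shows "(\<Oplus>u v\<in>z. \<Oplus>s t\<in>w. f u v s t) = (\<Oplus>s t\<in>w. \<Oplus>u v\<in>z. f u v s t)"
proof -
  have "(\<Oplus>u v\<in>z. \<Oplus>s t\<in>w. f u v s t) = (\<Oplus>u v\<in>z. (\<Sum>k\<in>Poly_Mapping.keys w. scale (Poly_Mapping.lookup w k)
    (case k of Join i j \<Rightarrow> f u v (Poly_Mapping.single i 1) (Poly_Mapping.single j 1) | _ \<Rightarrow> 0)))"
    by (simp add: swt_def[of w])
  also have "\<dots> = (\<Sum>k\<in>Poly_Mapping.keys w. scale (Poly_Mapping.lookup w k)
    (\<Oplus>u v\<in>z. case k of Join i j \<Rightarrow> f u v (Poly_Mapping.single i 1) (Poly_Mapping.single j 1) | _ \<Rightarrow> 0))"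
    by (simp add: swt_sum_fun swt_scale_fun)
  also have "\<dots> = (\<Oplus>s t\<in>w. \<Oplus>u v\<in>z. f u v s t)"
  proof -
    have "(\<Oplus>u v\<in>z. case k of Join i j \<Rightarrow> h u v i j | _ \<Rightarrow> 0)
        = (case k of Join i j \<Rightarrow> (\<Oplus>u v\<in>z. h u v i j) | _ \<Rightarrow> 0)" for k :: "'i idx" and h
      by (cases k) auto
    then show ?thesis by (simp add: swt_def[of w])
  qed
  finally show ?thesis .
qed

lemma tens_single: "Poly_Mapping.single i (1::'k::field) \<otimes> Poly_Mapping.single j 1 = Poly_Mapping.single (Join i j) 1"
  by transfer (auto simp: fun_eq_iff when_def split: idx.splits)

lemma tens_sum_left: "sum f A \<otimes> v = (\<Sum>i\<in>A. f i \<otimes> v)"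
  by (rule lin_sum[of "\<lambda>x. x \<otimes> v"]) (intro lin_intros)

lemma tens_sum_right: "v \<otimes> sum f A = (\<Sum>i\<in>A. v \<otimes> f i)"
  by (rule lin_sum[of "\<lambda>x. v \<otimes> x"]) (intro lin_intros)

lemma swt_sum: "swt (sum g A) f = (\<Sum>i\<in>A. swt (g i) f)"
  by (rule lin_sum[OF lin_swt_left])

text \<open>The tensor product of two basis vectors is a basis vector, at which \<open>swt\<close>
  evaluates \<open>f\<close> directly. Bilinearity extends this to all pure tensors.\<close>

lemma swt_tens:
  fixes x y :: "('k::field, 'i) vec"
  assumes f: "bilin f"
  shows "swt (x \<otimes> y) f = f x y"
proof -
  let ?e = "\<lambda>i::'i idx. Poly_Mapping.single i (1::'k)"
  have f1: "lin (\<lambda>u. f u v)" and f2: "lin (\<lambda>u. f v u)" for v using f by (auto simp: bilin_def)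
  have b: "swt (?e i \<otimes> ?e j) f = f (?e i) (?e j)" for i j
    by (simp add: tens_single swt_def)
  have "swt (x \<otimes> y) f = swt ((\<Sum>i\<in>Poly_Mapping.keys x. scale (Poly_Mapping.lookup x i) (?e i))
      \<otimes> (\<Sum>j\<in>Poly_Mapping.keys y. scale (Poly_Mapping.lookup y j) (?e j))) f"
    by (simp flip: sum_of_singles)
  also have "\<dots> = (\<Sum>i\<in>Poly_Mapping.keys x. scale (Poly_Mapping.lookup x i)
      (\<Sum>j\<in>Poly_Mapping.keys y. scale (Poly_Mapping.lookup y j) (f (?e i) (?e j))))"
    by (subst tens_sum_left) (simp only: tens_scale_left swt_sum swt_scale tens_sum_right tens_scale_right b kv.scale_sum_right kv.scale_left_commute)
  also have "\<dots> = f (\<Sum>i\<in>Poly_Mapping.keys x. scale (Poly_Mapping.lookup x i) (?e i))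
      (\<Sum>j\<in>Poly_Mapping.keys y. scale (Poly_Mapping.lookup y j) (?e j))"
    by (subst lin_sum[OF f1]) (simp only: linD(2)[OF f1] lin_sum[OF f2] linD(2)[OF f2] kv.scale_sum_right kv.scale_left_commute)
  also have "\<dots> = f x y" by (simp flip: sum_of_singles)
  finally show ?thesis .
qed

lemma swt3_tens:
  assumes "trilin f"
  shows "swt3 (x \<otimes> y \<otimes> z) f = f x y z"
proof -
  have *: "bilin (f u)" "\<And>v w. lin (\<lambda>u. f u v w)" for u
    using assms by (auto simp: bilin_def trilin_def)
  have "bilin (\<lambda>u y. swt y (f u))" by (intro bilinI lin_intros *)
  then show ?thesis by (simp add: swt3_def swt_tens *)
qed

text \<open>Splits only the outer tensor factor, for terms such as \<open>x0 \<otimes> D x1\<close>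
  whose inner factor is not pure.\<close>

lemma swt3_tens1:
  assumes "trilin f"
  shows "swt3 (x \<otimes> y) f = swt y (f x)"
proof -
  have *: "\<And>v w. lin (\<lambda>u. f u v w)" using assms by (auto simp: trilin_def)
  have "bilin (\<lambda>u y. swt y (f u))" by (intro bilinI lin_intros *)
  then show ?thesis by (simp add: swt3_def swt_tens)
qed

lemma swt_comp: "swt (swt z f) g = (\<Oplus>u v\<in>z. swt (f u v) g)"
  by (rule lin_swt_out) (rule lin_swt_left)

lemma swt3_comp: "swt3 (swt z f) g = (\<Oplus>u v\<in>z. swt3 (f u v) g)"
  by (rule lin_swt_out) (intro lin_intros)

lemma swt_tens_left: "swt z f \<otimes> w = (\<Oplus>u v\<in>z. f u v \<otimes> w)"
  by (rule lin_swt_out) (intro lin_intros)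

lemma swt_tens_right: "w \<otimes> swt z f = (\<Oplus>u v\<in>z. w \<otimes> f u v)"
  by (rule lin_swt_out) (intro lin_intros)

subsection \<open>Subspaces and projections\<close>

text \<open>A linear retraction onto \<open>V\<close>, which exists because every subspace has a
  complement. All later arguments rest on the three properties proved next, not on the
  choice.\<close>

definition proj :: "('k::field, 'i) vec set \<Rightarrow> ('k, 'i) vec \<Rightarrow> ('k, 'i) vec"
  where "proj V = (SOME p. lin p \<and> (\<forall>x. p x \<in> V) \<and> (\<forall>v\<in>V. p v = v))"

lemma proj:
  assumes "ksubspace V"
  shows lin_proj': "lin (proj V)" and proj_in: "proj V x \<in> V" and proj_id: "v \<in> V \<Longrightarrow> proj V v = v"
proof -
  interpret kk: vector_space_pair "scale :: 'a \<Rightarrow> ('a, 'b) vec \<Rightarrow> _" scale by unfold_locales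
  obtain g where g: "\<forall>x. g x \<in> V" "Vector_Spaces.linear scale scale g" "\<forall>v\<in>V. g v = v"
    using kk.linear_exists_left_inverse_on[OF kv.linear_id assms] by auto
  interpret g: Vector_Spaces.linear scale scale g by fact
  have "lin g" by (simp add: lin_def g.add g.scale)
  then have "\<exists>p. lin p \<and> (\<forall>x. p x \<in> V) \<and> (\<forall>v\<in>V. p v = v)"
    using g by blast
  from someI_ex[OF this] have "lin (proj V) \<and> (\<forall>x. proj V x \<in> V) \<and> (\<forall>v\<in>V. proj V v = v)"
    unfolding proj_def .
  then show "lin (proj V)" "proj V x \<in> V" "v \<in> V \<Longrightarrow> proj V v = v" by auto
qed

lemma lin_proj: "ksubspace V \<Longrightarrow> lin f \<Longrightarrow> lin (\<lambda>x. proj V (f x))"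
  by (rule lin_comp[OF lin_proj'])

lemma proj_proj: "ksubspace V \<Longrightarrow> proj V (proj V x) = proj V x"
  by (simp add: proj_in proj_id)

lemma subspace_tensS: "ksubspace (V \<otimes>\<^sub>S W)"
  unfolding tensS_def by (rule kv.subspace_span)

lemma tens_in_tensS: "v \<in> V \<Longrightarrow> w \<in> W \<Longrightarrow> v \<otimes> w \<in> V \<otimes>\<^sub>S W"
  unfolding tensS_def by (intro kv.span_base) auto

text \<open>A tensor space is a span, so pure tensors suffice once the property cuts out a subspace.
  \<open>subspace_vimage\<close> and \<open>subspace_eq\<close> supply this for memberships and for
  equations between linear maps.\<close>

lemma tensS_induct:
  assumes "z \<in> V \<otimes>\<^sub>S W" "ksubspace {z. P z}" "\<And>v w. v \<in> V \<Longrightarrow> w \<in> W \<Longrightarrow> P (v \<otimes> w)"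
  shows "P z"
proof -
  have "V \<otimes>\<^sub>S W \<subseteq> {z. P z}" unfolding tensS_def
    by (rule kv.span_minimal) (use assms in auto)
  then show ?thesis using assms(1) by auto
qed

lemma subspace_vimage: "lin f \<Longrightarrow> ksubspace V \<Longrightarrow> ksubspace {z. f z \<in> V}"
  by (auto simp: kv.subspace_def lin_0 linD)

lemma subspace_eq: "lin f \<Longrightarrow> lin g \<Longrightarrow> ksubspace {z. f z = g z}"
  by (auto simp: kv.subspace_def lin_0 linD)

lemma swt_mem:
  assumes "z \<in> V \<otimes>\<^sub>S W" "ksubspace U" "bilin f" "\<And>v w. v \<in> V \<Longrightarrow> w \<in> W \<Longrightarrow> f v w \<in> U"
  shows "swt z f \<in> U"
  using assms(1)
  by (rule tensS_induct) (auto intro: subspace_vimage lin_swt_left simp: assms swt_tens)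

text \<open>Summands may be altered outside \<open>V\<close> and \<open>W\<close>. This is how
  projections, which are the identity there, are inserted and removed.\<close>

lemma swt_cong_on:
  assumes "z \<in> V \<otimes>\<^sub>S W" "bilin f" "bilin g" "\<And>v w. v \<in> V \<Longrightarrow> w \<in> W \<Longrightarrow> f v w = g v w"
  shows "swt z f = swt z g"
  using assms(1)
  by (rule tensS_induct) (auto intro: subspace_eq lin_swt_left simp: assms swt_tens)

text \<open>Membership matters: in general the sum on the left drops the components of
  \<open>z\<close> along basis vectors that are not of the form \<open>Join i j\<close>.\<close>

lemma swt_id: "z \<in> V \<otimes>\<^sub>S W \<Longrightarrow> (\<Oplus>u v\<in>z. u \<otimes> v) = z"
  by (erule tensS_induct) (auto intro!: subspace_eq lin_intros swt_tens bilinI)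

lemma swt_id3: "z \<in> U \<otimes>\<^sub>S V \<otimes>\<^sub>S W \<Longrightarrow> (\<Oplus>u v w\<in>z. u \<otimes> v \<otimes> w) = z"
proof (erule tensS_induct)
  show "ksubspace {z. (\<Oplus>u v w\<in>z. u \<otimes> v \<otimes> w) = z}"
    by (intro subspace_eq lin_intros)
  fix u y assume "u \<in> U" and y: "y \<in> V \<otimes>\<^sub>S W"
  have "(\<Oplus>u v w\<in>u \<otimes> y. u \<otimes> v \<otimes> w) = u \<otimes> (\<Oplus>v w\<in>y. v \<otimes> w)"
    by (simp add: swt3_tens1 trilinI lin_intros swt_tens_right)
  then show "(\<Oplus>u v w\<in>u \<otimes> y. u \<otimes> v \<otimes> w) = u \<otimes> y"
    by (simp add: swt_id[OF y])
qed

text \<open>The representation picked by \<open>sw\<close> sums to \<open>z\<close>, and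
  \<open>swt\<close> is linear in \<open>z\<close>, so its value is the sum over that
  representation. Every operation given by \<open>sw\<close> enters the linear calculus here;
  \<open>f\<close> has to agree with the total map \<open>g\<close> only on the two
  subspaces.\<close>

lemma sw_swt:
  assumes V: "ksubspace V" and z: "z \<in> V \<otimes>\<^sub>S W"
    and f: "\<And>v w. v \<in> V \<Longrightarrow> w \<in> W \<Longrightarrow> f v w = g v w" and g: "bilin g"
  shows "sw V W z f = swt z g"
proof -
  define ps where "ps = (SOME ps. tensor_rep V W z ps)"
  have "tensor_rep V W z ps"
    unfolding ps_def using tensor_rep_exists[OF V z] by (rule someI_ex)
  then have ps: "set ps \<subseteq> V \<times> W" "z = (\<Sum>(v, w)\<leftarrow>ps. v \<otimes> w)" by (auto simp: tensor_rep_def)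
  have "set qs \<subseteq> V \<times> W \<Longrightarrow> swt (\<Sum>(v, w)\<leftarrow>qs. v \<otimes> w) g = (\<Sum>(v, w)\<leftarrow>qs. f v w)" for qs
    by (induction qs) (auto simp: swt_add swt_tens g f)
  from this[OF ps(1)] show ?thesis
    unfolding sw_def ps_def[symmetric] by (simp add: ps(2)[symmetric])
qed

lemma sw3_swt3:
  assumes U: "ksubspace U" and V: "ksubspace V" and z: "z \<in> U \<otimes>\<^sub>S V \<otimes>\<^sub>S W"
    and f: "\<And>u v w. u \<in> U \<Longrightarrow> v \<in> V \<Longrightarrow> w \<in> W \<Longrightarrow> f u v w = g u v w" and g: "trilin g"
  shows "sw3 U V W z f = swt3 z g"
  unfolding sw3_def swt3_def
  using g by (intro sw_swt U V z f) (auto intro!: bilinI lin_intros simp: trilin_def)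

text \<open>Brings a scalar-valued sum, such as the counit of \<open>H\<close>, under the
  vector-valued operator by letting the scalar act on a vector.\<close>

lemma scale_sw: "scale (sw V W z f) x = sw V W z (\<lambda>u v. scale (f u v) x)"
proof -
  have "scale (\<Sum>(v, w)\<leftarrow>ps. f v w) x = (\<Sum>(v, w)\<leftarrow>ps. scale (f v w) x)" for ps
    by (induction ps) (auto simp: kv.scale_left_distrib)
  then show ?thesis by (simp add: sw_def)
qed

lemma scale_sw3: "scale (sw3 U V W z f) x = sw3 U V W z (\<lambda>u v w. scale (f u v w) x)"
  unfolding sw3_def by (simp add: scale_sw)

lemma swt_cong [cong]: "z = z' \<Longrightarrow> (\<And>u v. f u v = g u v) \<Longrightarrow> swt z f = swt z' g"
  by presburger

lemma swt3_cong [cong]: "z = z' \<Longrightarrow> (\<And>u v w. f u v w = g u v w) \<Longrightarrow> swt3 z f = swt3 z' g"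
  by presburger

lemma swt_fun_cong: "(\<And>u v. f u v = g u v) \<Longrightarrow> swt z f = swt z g"
  by presburger

lemma swt3_mem:
  assumes z: "z \<in> U \<otimes>\<^sub>S V \<otimes>\<^sub>S W" and S: "ksubspace S" and f: "trilin f"
    and "\<And>u v w. u \<in> U \<Longrightarrow> v \<in> V \<Longrightarrow> w \<in> W \<Longrightarrow> f u v w \<in> S"
  shows "swt3 z f \<in> S"
  unfolding swt3_def
  using f assms(4) by (intro swt_mem[OF z S] swt_mem[of _ V W, OF _ S]) (auto intro!: bilinI lin_intros simp: trilin_def)

lemma swt3_cong_on:
  assumes z: "z \<in> U \<otimes>\<^sub>S V \<otimes>\<^sub>S W" and f: "trilin f" and g: "trilin g"
    and "\<And>u v w. u \<in> U \<Longrightarrow> v \<in> V \<Longrightarrow> w \<in> W \<Longrightarrow> f u v w = g u v w"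
  shows "swt3 z f = swt3 z g"
  unfolding swt3_def
  using f g assms(4) by (intro swt_cong_on[OF z] swt_cong_on[of _ V W]) (auto intro!: bilinI lin_intros simp: trilin_def)

lemma swt_comp3: "swt (swt3 z f) g = (\<Oplus>a x b\<in>z. swt (f a x b) g)"
  by (rule lin_swt3_out) (rule lin_swt_left)

lemma swt3_comp3: "swt3 (swt3 z f) g = (\<Oplus>a x b\<in>z. swt3 (f a x b) g)"
  by (rule lin_swt3_out) (intro lin_intros)

lemma swt3_tens_left: "swt3 z f \<otimes> w = (\<Oplus>a x b\<in>z. f a x b \<otimes> w)"
  by (rule lin_swt3_out) (intro lin_intros)

lemma swt3_tens_right: "w \<otimes> swt3 z f = (\<Oplus>a x b\<in>z. w \<otimes> f a x b)"
  by (rule lin_swt3_out) (intro lin_intros)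

lemma swt_swap3: "(\<Oplus>u v\<in>z. \<Oplus>a x b\<in>w. f u v a x b) = (\<Oplus>a x b\<in>w. \<Oplus>u v\<in>z. f u v a x b)"
  unfolding swt3_def by (subst swt_swap) (simp add: swt_swap[of z])

lemma swt3_swap: "(\<Oplus>a x b\<in>z. \<Oplus>c y d\<in>w. f a x b c y d) = (\<Oplus>c y d\<in>w. \<Oplus>a x b\<in>z. f a x b c y d)"
  unfolding swt3_def[of z] swt_swap3 ..

text \<open>Normalizes nested terms: sums move outward, sums over pure tensors are evaluated, and
  the bilinearity side conditions split into linearity goals for the simplifier.\<close>

lemmas swt_simps = swt_comp swt3_comp swt_comp3 swt3_comp3 swt_tens swt3_tens swt_tens_left swt_tens_right swt3_tens_left swt3_tens_right
  bilinI trilinI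

lemma trilin_bilin: "trilin F \<Longrightarrow> bilin (F u)"
  by (simp add: trilin_def bilin_def)

section \<open>Comodules and their products\<close>

lemma lin_linear_on: "ksubspace V \<Longrightarrow> linear_on V W f \<Longrightarrow> lin (\<lambda>x. f (proj V x))"
  using lin_proj'[of V] proj_in[of V] by (simp add: lin_def linear_on_def)

lemma linf_functional_on: "ksubspace V \<Longrightarrow> functional_on V f \<Longrightarrow> linf (\<lambda>x. f (proj V x))"
  using lin_proj'[of V] proj_in[of V] by (simp add: lin_def linf_def functional_on_def)

lemma bilin_bilinear_on:
  assumes "ksubspace U" "ksubspace V" "bilinear_on U V W f"
  shows "bilin (\<lambda>x y. f (proj U x) (proj V y))"
  using assms lin_linear_on[of U W "\<lambda>x. f x (proj V _)"] lin_linear_on[of V W]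
  by (intro bilinI) (auto simp: bilinear_on_def proj_in)

text \<open>
  Composed with projections onto the underlying spaces, the operations of an algebra or comodule become
  linear on the whole ambient space; these versions carry the suffix \<open>T\<close>.
\<close>

definition mulT :: "('k::field, 'i, 'z) alg_scheme \<Rightarrow> ('k, 'i) vec \<Rightarrow> ('k, 'i) vec \<Rightarrow> ('k, 'i) vec"
  where "mulT A x y = mul A (proj (carr A) x) (proj (carr A) y)"

definition copT :: "('k::field, 'i, 'z) hopf_scheme \<Rightarrow> ('k, 'i) vec \<Rightarrow> ('k, 'i) vec"
  where "copT C x = cop C (proj (carr C) x)"

definition couT :: "('k::field, 'i, 'z) hopf_scheme \<Rightarrow> ('k, 'i) vec \<Rightarrow> 'k"
  where "couT C x = cou C (proj (carr C) x)"

definition rcoT :: "('k::field, 'i, 'z) comod_scheme \<Rightarrow> ('k, 'i) vec \<Rightarrow> ('k, 'i) vec"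
  where "rcoT X x = rco X (proj (sp X) x)"

definition lcoT :: "('k::field, 'i, 'z) bicomod_scheme \<Rightarrow> ('k, 'i) vec \<Rightarrow> ('k, 'i) vec"
  where "lcoT X x = lco X (proj (sp X) x)"

text \<open>
  No unit and no second counit law: this much holds both for \<open>L\<close> and for the weak Hopf algebra \<open>H\<close>.
\<close>

locale bialg =
  fixes C :: "('k::field, 'i) hopf"
  assumes sub: "ksubspace (carr C)"
    and mul_on: "bilinear_on (carr C) (carr C) (carr C) (mul C)"
    and mul_assoc: "\<And>x y z. mulT C (mulT C x y) z = mulT C x (mulT C y z)"
    and cop_on: "linear_on (carr C) (carr C \<otimes>\<^sub>S carr C) (cop C)"
    and cou_on: "functional_on (carr C) (cou C)"
    and counit_left: "\<And>x. (\<Oplus>x1 x2\<in>copT C x. scale (couT C x1) x2) = proj (carr C) x"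
    and cop_mul: "\<And>x y. copT C (mulT C x y) =
      (\<Oplus>x1 x2\<in>copT C x. \<Oplus>y1 y2\<in>copT C y. mulT C x1 y1 \<otimes> mulT C x2 y2)"
begin

abbreviation "D \<equiv> copT C"
abbreviation "ep \<equiv> couT C"
abbreviation "mu \<equiv> mulT C"

lemma bilin_mu: "bilin mu"
  unfolding mulT_def by (rule bilin_bilinear_on[OF sub sub mul_on])

lemma lin_D: "lin D"
  unfolding copT_def by (rule lin_linear_on[OF sub cop_on])

lemma linf_ep: "linf ep"
  unfolding couT_def by (rule linf_functional_on[OF sub cou_on])

lemma mu_in: "mu x y \<in> carr C"
  using mul_on by (auto simp: mulT_def bilinear_on_def linear_on_def proj_in[OF sub])

lemma D_in: "D x \<in> carr C \<otimes>\<^sub>S carr C"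
  using cop_on by (auto simp: copT_def linear_on_def proj_in[OF sub])

lemma mu_eq: "x \<in> carr C \<Longrightarrow> y \<in> carr C \<Longrightarrow> mul C x y = mu x y"
  by (simp add: mulT_def proj_id[OF sub])

lemma D_eq: "x \<in> carr C \<Longrightarrow> cop C x = D x"
  by (simp add: copT_def proj_id[OF sub])

lemma ep_eq: "x \<in> carr C \<Longrightarrow> cou C x = ep x"
  by (simp add: couT_def proj_id[OF sub])

lemmas lins [simp] = lin_intros bilin_comp1[OF bilin_mu] bilin_comp2[OF bilin_mu] lin_comp[OF lin_D]
  lin_scale_left[OF linf_ep] lin_proj[OF sub]

lemma F_D_mul:
  assumes "bilin F"
  shows "swt (D (mu x y)) F = (\<Oplus>x1 x2\<in>D x. \<Oplus>y1 y2\<in>D y. F (mu x1 y1) (mu x2 y2))"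
  by (simp add: cop_mul swt_comp swt_tens assms)

text \<open>Tested against every trilinear \<open>F\<close>, so that it rewrites directly inside
  longer Sweedler sums. No subspace and no counit law is attached: the coproduct, comodule coactions
  and diagonal coactions are all instances.\<close>

definition coass :: "(('k, 'i) vec \<Rightarrow> ('k, 'i) vec) \<Rightarrow> bool"
  where "coass r \<longleftrightarrow> lin r \<and> (\<forall>x F. trilin F \<longrightarrow>
    (\<Oplus>x0 x1\<in>r x. \<Oplus>u v\<in>r x0. F u v x1) = (\<Oplus>x0 x1\<in>r x. \<Oplus>u v\<in>D x1. F x0 u v))"

lemma coass_lin: "coass r \<Longrightarrow> lin f \<Longrightarrow> lin (\<lambda>x. r (f x))"
  by (rule lin_comp[of r]) (auto simp: coass_def)

lemma coassD: "coass r \<Longrightarrow> trilin F \<Longrightarrow>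
    (\<Oplus>x0 x1\<in>r x. \<Oplus>u v\<in>r x0. F u v x1) = (\<Oplus>x0 x1\<in>r x. \<Oplus>u v\<in>D x1. F x0 u v)"
  by (auto simp: coass_def)

text \<open>
  A coaction may be coassociative without being counital. In that case \<open>cpart r\<close> is idempotent, and its fixed
  points form a comodule. The product of comodules over a weak Hopf algebra is of this form.
\<close>

definition cpart :: "(('k, 'i) vec \<Rightarrow> ('k, 'i) vec) \<Rightarrow> ('k, 'i) vec \<Rightarrow> ('k, 'i) vec"
  where "cpart r z = (\<Oplus>x0 x1\<in>r z. scale (ep x1) x0)"

lemma lin_cpart: "lin r \<Longrightarrow> lin f \<Longrightarrow> lin (\<lambda>x. cpart r (f x))"
  unfolding cpart_def by (rule lin_swt_arg[OF lin_comp[of r f]])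

text \<open>Coassociativity turns the counit after a second coaction into the counit of the left leg
  of a coproduct, where the left counit law removes it. Thus the first leg of a coaction may be
  replaced by its counital part.\<close>

lemma cpart_coaction:
  assumes "coass r" "r z \<in> V \<otimes>\<^sub>S carr C"
  shows "(\<Oplus>x0 x1\<in>r z. cpart r x0 \<otimes> x1) = r z"
proof -
  have "(\<Oplus>x0 x1\<in>r z. cpart r x0 \<otimes> x1) = (\<Oplus>x0 x1\<in>r z. \<Oplus>u v\<in>r x0. scale (ep v) u \<otimes> x1)"
    by (simp add: cpart_def swt_tens_left)
  also have "\<dots> = (\<Oplus>x0 x1\<in>r z. \<Oplus>u v\<in>D x1. scale (ep u) x0 \<otimes> v)"
    by (rule coassD[OF assms(1)]) (auto intro!: trilinI simp: tens_scale_left)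
  also have "\<dots> = (\<Oplus>x0 x1\<in>r z. x0 \<otimes> proj (carr C) x1)"
    by (simp add: counit_left[symmetric] swt_tens_right tens_scale_left tens_scale_right)
  also have "\<dots> = (\<Oplus>x0 x1\<in>r z. x0 \<otimes> x1)"
    by (rule swt_cong_on[OF assms(2)]) (auto intro!: bilinI lin_proj sub simp: proj_id[OF sub])
  also have "\<dots> = r z" by (rule swt_id[OF assms(2)])
  finally show ?thesis .
qed

lemma comoduleI:
  assumes "ksubspace (sp M)" "lin r" "\<And>x. x \<in> sp M \<Longrightarrow> rco M x = r x"
    and "\<And>x. x \<in> sp M \<Longrightarrow> r x \<in> sp M \<otimes>\<^sub>S carr C"
    and "\<And>x. x \<in> sp M \<Longrightarrow> (\<Oplus>x0 x1\<in>r x. \<Oplus>u v\<in>r x0. u \<otimes> v \<otimes> x1) = (\<Oplus>x0 x1\<in>r x. x0 \<otimes> D x1)"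
    and "\<And>x. x \<in> sp M \<Longrightarrow> cpart r x = x"
  shows "is_right_comodule C M"
proof -
  note lin_comp[OF assms(2), simp]
  show ?thesis
    unfolding is_right_comodule_def
  proof (intro conjI ballI)
    show "linear_on (sp M) (sp M \<otimes>\<^sub>S carr C) (rco M)"
      using assms(1-4) by (auto simp: linear_on_def linD kv.subspace_def)
    fix x assume x: "x \<in> sp M"
    have "sw (sp M) (carr C) (rco M x) (\<lambda>x0 x1. sw (sp M) (carr C) (rco M x0) (\<lambda>x00 x01. x00 \<otimes> x01 \<otimes> x1))
        = (\<Oplus>x0 x1\<in>r x. \<Oplus>u v\<in>r x0. u \<otimes> v \<otimes> x1)"
      using x by (subst assms(3)[OF x], intro sw_swt) (auto intro!: sw_swt bilinI simp: assms)
    moreover have "sw (sp M) (carr C) (rco M x) (\<lambda>x0 x1. x0 \<otimes> cop C x1) = (\<Oplus>x0 x1\<in>r x. x0 \<otimes> D x1)"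
      using x by (subst assms(3)[OF x], intro sw_swt) (auto intro!: bilinI simp: assms D_eq)
    ultimately show "sw (sp M) (carr C) (rco M x) (\<lambda>x0 x1. sw (sp M) (carr C) (rco M x0) (\<lambda>x00 x01. x00 \<otimes> x01 \<otimes> x1))
      = sw (sp M) (carr C) (rco M x) (\<lambda>x0 x1. x0 \<otimes> cop C x1)"
      using assms(5)[OF x] by simp
    have "sw (sp M) (carr C) (rco M x) (\<lambda>x0 x1. scale (cou C x1) x0) = cpart r x"
      unfolding cpart_def
      using x by (subst assms(3)[OF x], intro sw_swt) (auto intro!: bilinI simp: assms ep_eq)
    then show "sw (sp M) (carr C) (rco M x) (\<lambda>x0 x1. scale (cou C x1) x0) = x"
      using assms(6)[OF x] by simp
  qed (use assms in auto)
qed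

lemma comodule_sub: "is_right_comodule C M \<Longrightarrow> ksubspace (sp M)"
  by (simp add: is_right_comodule_def)

lemma lin_rcoT: "is_right_comodule C M \<Longrightarrow> lin (rcoT M)"
  unfolding rcoT_def by (rule lin_linear_on) (auto simp: is_right_comodule_def)

lemma rcoT_in: "is_right_comodule C M \<Longrightarrow> rcoT M x \<in> sp M \<otimes>\<^sub>S carr C"
  by (simp add: is_right_comodule_def rcoT_def linear_on_def proj_in)

lemma rco_eq: "is_right_comodule C M \<Longrightarrow> x \<in> sp M \<Longrightarrow> rco M x = rcoT M x"
  by (simp add: is_right_comodule_def rcoT_def proj_id)

lemmas comodule_facts = lin_comp[OF lin_rcoT] rcoT_in rco_eq comodule_sub

lemma comodule_coass:
  assumes M: "is_right_comodule C M"
  shows "coass (rcoT M)"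
  unfolding coass_def
proof (intro conjI allI impI)
  show "lin (rcoT M)" by (rule lin_rcoT[OF M])
  fix x F assume F: "trilin (F :: ('k, 'i) vec \<Rightarrow> _)"
  \<comment> \<open>The comodule axiom concerns elements of \<open>sp M\<close>; the total coaction
    sees \<open>x\<close> only through its projection.\<close>
  define y where "y = proj (sp M) x"
  have y: "y \<in> sp M" "rcoT M x = rcoT M y" using comodule_sub[OF M] by (simp_all add: y_def proj_in rcoT_def proj_proj)
  note [simp] = comodule_facts[OF M]
  have "sw (sp M) (carr C) (rco M y) (\<lambda>x0 x1. sw (sp M) (carr C) (rco M x0) (\<lambda>x00 x01. x00 \<otimes> x01 \<otimes> x1))
      = (\<Oplus>x0 x1\<in>rcoT M y. \<Oplus>u v\<in>rcoT M x0. u \<otimes> v \<otimes> x1)"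
    using y by (subst rco_eq[OF M y(1)], intro sw_swt) (auto intro!: sw_swt bilinI)
  moreover have "sw (sp M) (carr C) (rco M y) (\<lambda>x0 x1. x0 \<otimes> cop C x1) = (\<Oplus>x0 x1\<in>rcoT M y. x0 \<otimes> D x1)"
    using y by (subst rco_eq[OF M y(1)], intro sw_swt) (auto intro!: bilinI simp: D_eq)
  ultimately have "(\<Oplus>x0 x1\<in>rcoT M y. \<Oplus>u v\<in>rcoT M x0. u \<otimes> v \<otimes> x1) = (\<Oplus>x0 x1\<in>rcoT M y. x0 \<otimes> D x1)"
    using M y by (simp add: is_right_comodule_def)
  \<comment> \<open>Evaluating \<open>F\<close> on both sides of this identity of triple tensors
    gives the version with a test map.\<close>
  from arg_cong[OF this, of "\<lambda>z. swt3 z F"]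
  show "(\<Oplus>x0 x1\<in>rcoT M x. \<Oplus>u v\<in>rcoT M x0. F u v x1) = (\<Oplus>x0 x1\<in>rcoT M x. \<Oplus>u v\<in>D x1. F x0 u v)"
    by (simp add: swt3_comp swt3_tens1[OF F] swt_tens[OF trilin_bilin[OF F]] y)
qed

lemma comodule_counit:
  assumes M: "is_right_comodule C M"
  shows "cpart (rcoT M) x = proj (sp M) x"
proof -
  note [simp] = comodule_facts[OF M]
  have "sw (sp M) (carr C) (rco M (proj (sp M) x)) (\<lambda>x0 x1. scale (cou C x1) x0) = cpart (rcoT M) (proj (sp M) x)"
    unfolding cpart_def
    by (subst rco_eq[OF M proj_in], simp, intro sw_swt) (auto intro!: bilinI simp: ep_eq proj_in)
  moreover have "cpart (rcoT M) (proj (sp M) x) = cpart (rcoT M) x"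
    by (simp add: cpart_def rcoT_def proj_proj comodule_sub[OF M] del: rco_eq[OF M])
  ultimately show ?thesis using M proj_in[of "sp M" x]
    by (simp add: is_right_comodule_def)
qed

text \<open>By \<open>cpart_coaction\<close> the first leg of \<open>r z\<close> can be taken in the
  image of \<open>cpart r\<close>. This yields at once that \<open>cpart r\<close> is idempotent on
  \<open>V\<close> and that the coaction has its first leg in the fixed points.\<close>

lemma cpart_comodule:
  assumes V: "ksubspace V" and r: "coass r" "\<And>z. z \<in> V \<Longrightarrow> r z \<in> V \<otimes>\<^sub>S carr C"
    and M: "sp M = {z \<in> V. cpart r z = z}" "\<And>x. x \<in> sp M \<Longrightarrow> rco M x = r x"
  shows "z \<in> V \<Longrightarrow> r z \<in> sp M \<otimes>\<^sub>S carr C" "is_right_comodule C M" "z \<in> V \<Longrightarrow> cpart r z \<in> sp M"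
proof -
  have lin_r: "lin r" using r(1) by (simp add: coass_def)
  note [simp] = coass_lin[OF r(1)] lin_cpart[OF lin_r]
  have cV: "cpart r z \<in> V" if "z \<in> V" for z
    unfolding cpart_def by (rule swt_mem[OF r(2)[OF that] V]) (auto intro!: bilinI simp: kv.subspace_scale[OF V])
  have idem: "cpart r (cpart r z) = cpart r z" if "z \<in> V" for z
  proof -
    have "cpart r (cpart r z) = (\<Oplus>x0 x1\<in>r z. scale (ep x1) (cpart r x0))"
      unfolding cpart_def[of r z] by (subst lin_swt_out[of "cpart r"]) (auto simp: linD[OF lin_cpart[OF lin_r lin_id]])
    also have "\<dots> = swt (\<Oplus>x0 x1\<in>r z. cpart r x0 \<otimes> x1) (\<lambda>x0 x1. scale (ep x1) x0)"
      by (simp add: swt_comp swt_tens bilinI)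
    also have "\<dots> = cpart r z" unfolding cpart_coaction[OF r(1) r(2)[OF that]] by (simp add: cpart_def)
    finally show ?thesis .
  qed
  show c: "cpart r z \<in> sp M" if "z \<in> V" for z using that cV idem by (simp add: M)
  have subM: "ksubspace (sp M)"
  proof -
    have "sp M = V \<inter> {z. cpart r z = z}" using M by auto
    then show ?thesis using V by (auto intro!: kv.subspace_inter subspace_eq)
  qed
  show rM: "r z \<in> sp M \<otimes>\<^sub>S carr C" if "z \<in> V" for z
  proof -
    have "(\<Oplus>x0 x1\<in>r z. cpart r x0 \<otimes> x1) \<in> sp M \<otimes>\<^sub>S carr C"
      by (rule swt_mem[OF r(2)[OF that] subspace_tensS]) (auto intro!: bilinI tens_in_tensS c)
    then show ?thesis using cpart_coaction[OF r(1) r(2)[OF that]] by simp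
  qed
  show "is_right_comodule C M"
  proof (rule comoduleI[OF subM lin_r])
    fix x assume x: "x \<in> sp M"
    then have xV: "x \<in> V" by (simp add: M)
    have "(\<Oplus>x0 x1\<in>r x. \<Oplus>u v\<in>r x0. u \<otimes> v \<otimes> x1) = (\<Oplus>x0 x1\<in>r x. \<Oplus>u v\<in>D x1. x0 \<otimes> u \<otimes> v)"
      by (rule coassD[OF r(1)]) (auto intro!: trilinI)
    also have "\<dots> = (\<Oplus>x0 x1\<in>r x. x0 \<otimes> D x1)"
      by (simp add: swt_tens_right[symmetric] swt_id[OF D_in])
    finally show "(\<Oplus>x0 x1\<in>r x. \<Oplus>u v\<in>r x0. u \<otimes> v \<otimes> x1) = (\<Oplus>x0 x1\<in>r x. x0 \<otimes> D x1)" .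
    show "rco M x = r x" "cpart r x = x" "r x \<in> sp M \<otimes>\<^sub>S carr C"
      using x xV rM by (auto simp: M)
  qed
qed

section \<open>Diagonal coactions and tensor products of comodules\<close>

lemma mu_proj [simp]: "mu (proj (carr C) x) y = mu x y" "mu x (proj (carr C) y) = mu x y"
  by (simp_all add: mulT_def proj_proj[OF sub])

lemma ep_scale: "ep (scale c x) = c * ep x"
  using linf_ep by (simp add: linf_def)

text \<open>The diagonal coaction on the whole tensor product. Its \<open>cpart\<close> is the map
  \<open>m \<otimes> n\<close> to \<open>scale (ep (mu m1 n1)) (m0 \<otimes> n0)\<close>, whose
  fixed points define the product of comodules.\<close>

definition tensR :: "(('k, 'i) vec \<Rightarrow> ('k, 'i) vec) \<Rightarrow> (('k, 'i) vec \<Rightarrow> ('k, 'i) vec) \<Rightarrow> ('k, 'i) vec \<Rightarrow> ('k, 'i) vec"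
  where "tensR r s z = (\<Oplus>m n\<in>z. \<Oplus>m0 m1\<in>r m. \<Oplus>n0 n1\<in>s n. (m0 \<otimes> n0) \<otimes> mu m1 n1)"

lemma lin_tensR: "lin (tensR r s)"
  unfolding tensR_def[abs_def] by simp

text \<open>After exchanging sums the two coassociativity laws apply one after the other;
  multiplicativity of the coproduct then reassembles \<open>D (mu m1 n1)\<close>.\<close>

lemma coass_tensR:
  assumes r: "coass r" and s: "coass s"
  shows "coass (tensR r s)"
  unfolding coass_def
proof (intro conjI allI impI)
  note [simp] = coass_lin[OF r] coass_lin[OF s]
  show "lin (tensR r s)" by (rule lin_tensR)
  fix z F assume F: "trilin (F :: ('k, 'i) vec \<Rightarrow> _)"
  note [simp] = trilin_comp1[OF F] trilin_comp2[OF F] trilin_comp3[OF F]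
  have "(\<Oplus>x0 x1\<in>tensR r s z. \<Oplus>u v\<in>tensR r s x0. F u v x1)
    = (\<Oplus>m n\<in>z. \<Oplus>m0 m1\<in>r m. \<Oplus>n0 n1\<in>s n. \<Oplus>u v\<in>r m0. \<Oplus>p q\<in>s n0. F (u \<otimes> p) (mu v q) (mu m1 n1))"
    by (simp add: tensR_def swt_comp swt_tens bilinI)
  also have "\<dots> = (\<Oplus>m n\<in>z. \<Oplus>m0 m1\<in>r m. \<Oplus>u v\<in>r m0. \<Oplus>n0 n1\<in>s n. \<Oplus>p q\<in>s n0. F (u \<otimes> p) (mu v q) (mu m1 n1))"
    by (subst swt_swap) (rule refl)
  also have "\<dots> = (\<Oplus>m n\<in>z. \<Oplus>m0 m1\<in>r m. \<Oplus>u v\<in>r m0. \<Oplus>n0 n1\<in>s n. \<Oplus>p q\<in>D n1. F (u \<otimes> n0) (mu v p) (mu m1 q))"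
    by (subst coassD[OF s]) (auto intro!: trilinI)
  also have "\<dots> = (\<Oplus>m n\<in>z. \<Oplus>m0 m1\<in>r m. \<Oplus>u v\<in>D m1. \<Oplus>n0 n1\<in>s n. \<Oplus>p q\<in>D n1. F (m0 \<otimes> n0) (mu u p) (mu v q))"
    by (subst coassD[OF r]) (auto intro!: trilinI)
  also have "\<dots> = (\<Oplus>m n\<in>z. \<Oplus>m0 m1\<in>r m. \<Oplus>n0 n1\<in>s n. \<Oplus>u v\<in>D m1. \<Oplus>p q\<in>D n1. F (m0 \<otimes> n0) (mu u p) (mu v q))"
    by (subst swt_swap) (rule refl)
  also have "\<dots> = (\<Oplus>x0 x1\<in>tensR r s z. \<Oplus>u v\<in>D x1. F x0 u v)"
    by (simp add: tensR_def swt_comp swt_tens bilinI F_D_mul)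
  finally show "(\<Oplus>x0 x1\<in>tensR r s z. \<Oplus>u v\<in>tensR r s x0. F u v x1) = (\<Oplus>x0 x1\<in>tensR r s z. \<Oplus>u v\<in>D x1. F x0 u v)" .
qed

lemma tensR_in:
  assumes "lin r" "lin s" "\<And>x. x \<in> V \<Longrightarrow> r x \<in> V \<otimes>\<^sub>S carr C" "\<And>y. y \<in> W \<Longrightarrow> s y \<in> W \<otimes>\<^sub>S carr C" "z \<in> V \<otimes>\<^sub>S W"
  shows "tensR r s z \<in> (V \<otimes>\<^sub>S W) \<otimes>\<^sub>S carr C"
proof -
  note [simp] = lin_comp[OF assms(1)] lin_comp[OF assms(2)]
  show ?thesis unfolding tensR_def
    by (intro swt_mem[OF assms(5)] swt_mem[OF assms(3)] swt_mem[OF assms(4)] subspace_tensS bilinI tens_in_tensS mu_in)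
      (auto intro!: bilinI)
qed

lemma tensR_cong:
  assumes "lin r" "lin s" "lin r'" "lin s'" "z \<in> V \<otimes>\<^sub>S W" "\<And>x. x \<in> V \<Longrightarrow> r x = r' x" "\<And>y. y \<in> W \<Longrightarrow> s y = s' y"
  shows "tensR r s z = tensR r' s' z"
proof -
  note [simp] = lin_comp[OF assms(1)] lin_comp[OF assms(2)] lin_comp[OF assms(3)] lin_comp[OF assms(4)]
  show ?thesis unfolding tensR_def
    by (rule swt_cong_on[OF assms(5)]) (auto intro!: bilinI simp: assms)
qed

text \<open>Lets colinear maps preserve fixed points of \<open>cpart\<close>; applied to
  reassociation and to tensor products of morphisms.\<close>

lemma cpart_map:
  assumes "lin F" "r' (F z) = (\<Oplus>w h\<in>r z. F w \<otimes> h)"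
  shows "cpart r' (F z) = F (cpart r z)"
proof -
  note [simp] = lin_comp[OF assms(1)]
  show ?thesis
    unfolding cpart_def assms(2)
    by (simp add: swt_comp swt_tens bilinI lin_swt_out[OF assms(1)] linD[OF assms(1)])
qed

text \<open>Coassociativity of \<open>s\<close> puts the extra counit on the left leg of
  \<open>D n1\<close>, where the left counit law absorbs it. When \<open>s\<close> is itself a
  diagonal coaction, this forces the right factor of a fixed vector into the inner product of
  comodules.\<close>

lemma cpart_tensR_right:
  assumes r: "coass r" and s: "coass s"
  shows "(\<Oplus>x y\<in>cpart (tensR r s) z. x \<otimes> cpart s y) = cpart (tensR r s) z"
proof -
  have [simp]: "lin s" using s by (simp add: coass_def)
  note [simp] = coass_lin[OF r] coass_lin[OF s] lin_cpart
  have "(\<Oplus>x y\<in>cpart (tensR r s) z. x \<otimes> cpart s y)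
    = (\<Oplus>m n\<in>z. \<Oplus>m0 m1\<in>r m. \<Oplus>n0 n1\<in>s n. \<Oplus>u v\<in>s n0. scale (ep (mu m1 n1)) (scale (ep v) (m0 \<otimes> u)))"
    unfolding cpart_def[of "tensR r s"]
    by (simp add: tensR_def swt_comp swt_tens swt_scale bilinI)
       (simp add: cpart_def swt_tens_right tens_scale_right flip: swt_scale_fun)
  also have "\<dots> = (\<Oplus>m n\<in>z. \<Oplus>m0 m1\<in>r m. \<Oplus>n0 n1\<in>s n. \<Oplus>u v\<in>D n1. scale (ep (mu m1 v)) (scale (ep u) (m0 \<otimes> n0)))"
    by (subst coassD[OF s]) (auto intro!: trilinI simp del: kv.scale_scale)
  also have "\<dots> = (\<Oplus>m n\<in>z. \<Oplus>m0 m1\<in>r m. \<Oplus>n0 n1\<in>s n. scale (ep (mu m1 (\<Oplus>u v\<in>D n1. scale (ep u) v))) (m0 \<otimes> n0))"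
  proof -
    have "scale (ep (mu x (\<Oplus>u v\<in>D y. scale (ep u) v))) w = (\<Oplus>u v\<in>D y. scale (ep (mu x v)) (scale (ep u) w))" for x y w
      by (subst lin_swt_out[of "\<lambda>t. scale (ep (mu x t)) w"])
        (auto simp: linD(2)[OF bilin_comp2[OF bilin_mu lin_id]] ep_scale mult.commute)
    then show ?thesis by simp
  qed
  also have "\<dots> = cpart (tensR r s) z"
    by (simp add: counit_left cpart_def tensR_def swt_comp swt_tens bilinI)
  finally show ?thesis .
qed

definition assocm :: "('k, 'i) vec \<Rightarrow> ('k, 'i) vec"
  where "assocm u = (\<Oplus>v z\<in>u. \<Oplus>x y\<in>v. x \<otimes> y \<otimes> z)"

lemma lin_assocm: "lin assocm"
  unfolding assocm_def[abs_def] by simp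

lemma tensR_assoc:
  assumes "lin r" "lin s" "lin t"
  shows "tensR r (tensR s t) (assocm u) = (\<Oplus>w h\<in>tensR (tensR r s) t u. assocm w \<otimes> h)"
proof -
  note [simp] = lin_comp[OF assms(1)] lin_comp[OF assms(2)] lin_comp[OF assms(3)]
  show ?thesis
    by (simp add: tensR_def assocm_def swt_comp swt_tens bilinI mul_assoc)
qed

lemma wtens_rco:
  assumes M: "is_right_comodule C M" and N: "is_right_comodule C N" and z: "z \<in> sp M \<otimes>\<^sub>S sp N"
  shows "rco (wtens C M N) z = tensR (rcoT M) (rcoT N) z"
proof -
  note [simp] = comodule_facts[OF M] comodule_facts[OF N]
  show ?thesis
    unfolding tensR_def wtens_def comod.simps using z
    by (auto intro!: sw_swt bilinI simp: mu_eq)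
qed

lemma wtens_sp:
  assumes M: "is_right_comodule C M" and N: "is_right_comodule C N"
  shows "sp (wtens C M N) = {z \<in> sp M \<otimes>\<^sub>S sp N. cpart (tensR (rcoT M) (rcoT N)) z = z}"
proof -
  note [simp] = comodule_facts[OF M] comodule_facts[OF N]
  have "sw (sp M) (sp N) z (\<lambda>m n. sw (sp M) (carr C) (rco M m) (\<lambda>m0 m1.
       sw (sp N) (carr C) (rco N n) (\<lambda>n0 n1. scale (cou C (mul C m1 n1)) (m0 \<otimes> n0))))
     = (\<Oplus>m n\<in>z. \<Oplus>m0 m1\<in>rcoT M m. \<Oplus>n0 n1\<in>rcoT N n. scale (ep (mu m1 n1)) (m0 \<otimes> n0))"
     if "z \<in> sp M \<otimes>\<^sub>S sp N" for z using that
     by (auto intro!: sw_swt bilinI simp: mu_eq ep_eq mu_in)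
  then show ?thesis
    by (auto simp: wtens_def cpart_def tensR_def swt_comp swt_tens bilinI)
qed

lemma
  assumes M: "is_right_comodule C M" and N: "is_right_comodule C N"
  shows wtens_comodule: "is_right_comodule C (wtens C M N)"
    and wtens_sub: "sp (wtens C M N) \<subseteq> sp M \<otimes>\<^sub>S sp N"
    and cpart_wtens: "z \<in> sp M \<otimes>\<^sub>S sp N \<Longrightarrow> cpart (tensR (rcoT M) (rcoT N)) z \<in> sp (wtens C M N)"
    and rcoT_wtens: "z \<in> sp (wtens C M N) \<Longrightarrow> rcoT (wtens C M N) z = tensR (rcoT M) (rcoT N) z"
proof -
  note c = cpart_comodule[OF subspace_tensS[of "sp M" "sp N"] coass_tensR[OF comodule_coass[OF M] comodule_coass[OF N]]
    tensR_in[OF lin_rcoT[OF M] lin_rcoT[OF N] rcoT_in[OF M] rcoT_in[OF N]] wtens_sp[OF M N]]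
  show s: "sp (wtens C M N) \<subseteq> sp M \<otimes>\<^sub>S sp N" by (auto simp: wtens_sp[OF M N])
  show cm: "is_right_comodule C (wtens C M N)" by (rule c(2)) (use s wtens_rco[OF M N] in auto)
  show "z \<in> sp M \<otimes>\<^sub>S sp N \<Longrightarrow> cpart (tensR (rcoT M) (rcoT N)) z \<in> sp (wtens C M N)" by (rule c(3)) (use s wtens_rco[OF M N] in auto)
  show "z \<in> sp (wtens C M N) \<Longrightarrow> rcoT (wtens C M N) z = tensR (rcoT M) (rcoT N) z"
    using s wtens_rco[OF M N] by (auto simp: rco_eq[OF cm, symmetric])
qed

lemma wtens_cpart_id:
  "is_right_comodule C M \<Longrightarrow> is_right_comodule C N \<Longrightarrow> z \<in> sp (wtens C M N) \<Longrightarrow> cpart (tensR (rcoT M) (rcoT N)) z = z"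
  by (simp add: wtens_sp)

text \<open>Membership in the iterated product means two things. Being fixed by the total diagonal
  coaction transfers along \<open>assocm\<close> by associativity of \<open>mu\<close>; having the
  right factor in the inner product is supplied by \<open>cpart_tensR_right\<close>.\<close>

lemma assocm_wtens:
  assumes X: "is_right_comodule C X" and Y: "is_right_comodule C Y" and Z: "is_right_comodule C Z"
    and u: "u \<in> sp (wtens C (wtens C X Y) Z)"
  shows "assocm u \<in> sp (wtens C X (wtens C Y Z))"
proof -
  let ?r = "rcoT X" and ?s = "rcoT Y" and ?t = "rcoT Z"
  note XY = wtens_comodule[OF X Y] and YZ = wtens_comodule[OF Y Z]
  note lr = lin_rcoT[OF X] lin_rcoT[OF Y] lin_rcoT[OF Z] lin_rcoT[OF XY] lin_rcoT[OF YZ] lin_tensR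
  have u1: "u \<in> sp (wtens C X Y) \<otimes>\<^sub>S sp Z" using wtens_sub[OF XY Z] u by auto
  \<comment> \<open>The first legs of \<open>u\<close> lie in the inner product, where its coaction
    is the diagonal one.\<close>
  have "tensR (rcoT (wtens C X Y)) ?t u = tensR (tensR ?r ?s) ?t u"
    by (rule tensR_cong[OF lr(4,3) lr(6,3) u1]) (auto simp: rcoT_wtens[OF X Y])
  then have "cpart (tensR (tensR ?r ?s) ?t) u = u"
    using wtens_cpart_id[OF XY Z u] by (simp add: cpart_def)
  moreover have "cpart (tensR ?r (tensR ?s ?t)) (assocm u) = assocm (cpart (tensR (tensR ?r ?s) ?t) u)"
    by (rule cpart_map[OF lin_assocm]) (rule tensR_assoc[OF lr(1,2,3)])
  ultimately have fixed: "cpart (tensR ?r (tensR ?s ?t)) (assocm u) = assocm u" by simp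
  have a1: "assocm u \<in> sp X \<otimes>\<^sub>S (sp Y \<otimes>\<^sub>S sp Z)"
    unfolding assocm_def
    by (rule swt_mem[OF u1 subspace_tensS], force intro: bilinI, rule swt_mem[of _ "sp X" "sp Y"])
      (use wtens_sub[OF X Y] in \<open>auto intro!: bilinI subspace_tensS tens_in_tensS\<close>)
  have "(\<Oplus>x y\<in>assocm u. x \<otimes> cpart (tensR ?s ?t) y) = assocm u"
    using cpart_tensR_right[OF comodule_coass[OF X] coass_tensR[OF comodule_coass[OF Y] comodule_coass[OF Z]], of "assocm u"]
    by (simp add: fixed)
  moreover have "(\<Oplus>x y\<in>assocm u. x \<otimes> cpart (tensR ?s ?t) y) \<in> sp X \<otimes>\<^sub>S sp (wtens C Y Z)"
    by (rule swt_mem[OF a1 subspace_tensS]) (auto intro!: bilinI tens_in_tensS cpart_wtens[OF Y Z] lin_tens lin_cpart[OF lr(6)] lin_id)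
  ultimately have a2: "assocm u \<in> sp X \<otimes>\<^sub>S sp (wtens C Y Z)" by simp
  have "tensR ?r (rcoT (wtens C Y Z)) (assocm u) = tensR ?r (tensR ?s ?t) (assocm u)"
    by (rule tensR_cong[OF lr(1,5) lr(1,6) a2]) (auto simp: rcoT_wtens[OF Y Z])
  then have "cpart (tensR ?r (rcoT (wtens C Y Z))) (assocm u) = assocm u"
    using fixed by (simp add: cpart_def)
  then show ?thesis using a2 by (simp add: wtens_sp[OF X YZ])
qed

end

section \<open>Morphisms of comodules\<close>

definition fnT :: "(('k::field, 'i, 'z) comod_scheme, 'k, 'i) arrow \<Rightarrow> ('k, 'i) vec \<Rightarrow> ('k, 'i) vec"
  where "fnT f x = fn f (proj (sp (src f)) x)"

definition tmap :: "(('k::field, 'i) vec \<Rightarrow> ('k, 'i) vec) \<Rightarrow> (('k, 'i) vec \<Rightarrow> ('k, 'i) vec) \<Rightarrow> ('k, 'i) vec \<Rightarrow> ('k, 'i) vec"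
  where "tmap F G z = (\<Oplus>x y\<in>z. F x \<otimes> G y)"

lemma fn_eqI:
  assumes "src f = src g" "trg f = trg g" "fn f \<in> extensional A" "fn g \<in> extensional A" "\<And>x. x \<in> A \<Longrightarrow> fn f x = fn g x"
  shows "f = (g :: ('o, 'k::zero, 'i) arrow)"
  using assms by (intro arrow.equality) (auto intro: extensionalityI)

lemma lin_tmap: "lin (tmap F G)"
  unfolding tmap_def[abs_def] by (rule lin_swt_left)

lemma arr_comp_simps [simp]:
  "src (arr_comp g f) = src f" "trg (arr_comp g f) = trg g"
  "x \<in> sp (src f) \<Longrightarrow> fn (arr_comp g f) x = fn g (fn f x)"
  "fn (arr_comp g f) \<in> extensional (sp (src f))"
  by (simp_all add: arr_comp_def compose_eq compose_extensional)

lemma arr_comp_ext: "sp (src f) = A \<Longrightarrow> fn (arr_comp g f) \<in> extensional A"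
  by auto

lemma arr_id_simps [simp]:
  "src (arr_id X) = X" "trg (arr_id X) = X" "x \<in> sp X \<Longrightarrow> fn (arr_id X) x = x"
  "fn (arr_id X) \<in> extensional (sp X)"
  by (simp_all add: arr_id_def)

lemma arr_tens_simps [simp]:
  "src (arr_tens T f g) = T (src f) (src g)" "trg (arr_tens T f g) = T (trg f) (trg g)"
  "fn (arr_tens T f g) \<in> extensional (sp (T (src f) (src g)))"
  by (simp_all add: arr_tens_def)

lemma arr_assoc_simps [simp]:
  "src (arr_assoc T X Y Z) = T (T X Y) Z" "trg (arr_assoc T X Y Z) = T X (T Y Z)"
  "fn (arr_assoc T X Y Z) \<in> extensional (sp (T (T X Y) Z))"
  by (simp_all add: arr_assoc_def)

lemma linear_on_fnT:
  assumes "ksubspace (sp (src f))" "linear_on (sp (src f)) (sp (trg f)) (fn f)"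
  shows lin_fnT: "lin (fnT f)" and fnT_in: "fnT f x \<in> sp (trg f)"
    and fn_fnT: "x \<in> sp (src f) \<Longrightarrow> fn f x = fnT f x"
  using assms lin_linear_on[OF assms]
  by (auto simp: fnT_def[abs_def] linear_on_def proj_in proj_id)

lemma arr_tens_fn:
  assumes "ksubspace (sp (src f))" "linear_on (sp (src f)) (sp (trg f)) (fn f)"
    "ksubspace (sp (src g))" "linear_on (sp (src g)) (sp (trg g)) (fn g)"
    and "z \<in> sp (T (src f) (src g))" "sp (T (src f) (src g)) \<subseteq> sp (src f) \<otimes>\<^sub>S sp (src g)"
  shows "fn (arr_tens T f g) z = tmap (fnT f) (fnT g) z"
proof -
  note [simp] = lin_comp[OF lin_fnT[OF assms(1,2)]] lin_comp[OF lin_fnT[OF assms(3,4)]]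
  show ?thesis using assms(5,6) unfolding arr_tens_def tmap_def
    by (auto intro!: sw_swt assms bilinI lin_tens simp: fn_fnT[OF assms(1,2)] fn_fnT[OF assms(3,4)] lin_id)
qed

lemma arr_assoc_fn:
  assumes "ksubspace (sp X)" "sp (T X Y) \<subseteq> sp X \<otimes>\<^sub>S sp Y" "sp (T (T X Y) Z) \<subseteq> (sp X \<otimes>\<^sub>S sp Y) \<otimes>\<^sub>S sp Z"
    "u \<in> sp (T (T X Y) Z)"
  shows "fn (arr_assoc T X Y Z) u = (\<Oplus>v z\<in>u. \<Oplus>x y\<in>v. x \<otimes> y \<otimes> z)"
  using assms unfolding arr_assoc_def
  by (auto intro!: sw_swt bilinI subspace_tensS lin_intros)

context bialg
begin

lemma comodule_mapI:
  assumes "is_right_comodule C (src f)" "is_right_comodule C (trg f)"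
    and F: "lin F" "\<And>x. x \<in> sp (src f) \<Longrightarrow> fn f x = F x" "fn f \<in> extensional (sp (src f))"
    and t: "\<And>x. x \<in> sp (src f) \<Longrightarrow> F x \<in> sp (trg f)"
    and r: "\<And>x. x \<in> sp (src f) \<Longrightarrow> rcoT (trg f) (F x) = (\<Oplus>x0 x1\<in>rcoT (src f) x. F x0 \<otimes> x1)"
  shows "is_right_comodule_map C f"
  unfolding is_right_comodule_map_def
proof (intro conjI ballI F(3))
  note s = comodule_sub[OF assms(1)]
  show "linear_on (sp (src f)) (sp (trg f)) (fn f)"
    using s by (auto simp: linear_on_def F(2) linD[OF F(1)] t kv.subspace_def)
  fix x assume x: "x \<in> sp (src f)"
  have "sw (sp (src f)) (carr C) (rco (src f) x) (\<lambda>x0 x1. fn f x0 \<otimes> x1) = (\<Oplus>x0 x1\<in>rcoT (src f) x. F x0 \<otimes> x1)"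
    by (subst rco_eq[OF assms(1) x], intro sw_swt s rcoT_in assms) (auto intro!: bilinI lin_comp[OF F(1)] lin_tens lin_id simp: F)
  then show "rco (trg f) (fn f x) = sw (sp (src f)) (carr C) (rco (src f) x) (\<lambda>x0 x1. fn f x0 \<otimes> x1)"
    using r[OF x] by (simp add: F(2)[OF x] rco_eq[OF assms(2) t[OF x]])
qed

lemma comodule_mapD:
  assumes "is_right_comodule C (src f)" "is_right_comodule C (trg f)" "is_right_comodule_map C f"
  shows comodule_map_fnT: "lin (fnT f)" "fnT f x \<in> sp (trg f)" "x \<in> sp (src f) \<Longrightarrow> fn f x = fnT f x"
    and comodule_map_rco: "rcoT (trg f) (fnT f x) = (\<Oplus>x0 x1\<in>rcoT (src f) x. fnT f x0 \<otimes> x1)"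
    and comodule_map_linear_on: "linear_on (sp (src f)) (sp (trg f)) (fn f)"
    and comodule_map_ext: "fn f \<in> extensional (sp (src f))"
proof -
  note s = comodule_sub[OF assms(1)]
  show l: "linear_on (sp (src f)) (sp (trg f)) (fn f)" and "fn f \<in> extensional (sp (src f))"
    using assms(3) by (auto simp: is_right_comodule_map_def)
  note * = lin_fnT[OF s l] fnT_in[OF s l] fn_fnT[OF s l]
  show "lin (fnT f)" "fnT f x \<in> sp (trg f)" "x \<in> sp (src f) \<Longrightarrow> fn f x = fnT f x" by (fact *)+
  define y where "y = proj (sp (src f)) x"
  have y: "y \<in> sp (src f)" "rcoT (src f) x = rcoT (src f) y" "fnT f x = fnT f y"
    using s by (simp_all add: y_def proj_in rcoT_def proj_proj fnT_def)
  have "sw (sp (src f)) (carr C) (rco (src f) y) (\<lambda>x0 x1. fn f x0 \<otimes> x1) = (\<Oplus>x0 x1\<in>rcoT (src f) y. fnT f x0 \<otimes> x1)"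
    by (subst rco_eq[OF assms(1) y(1)], intro sw_swt s rcoT_in assms) (auto intro!: bilinI lin_comp[OF *(1)] lin_tens lin_id simp: *)
  then show "rcoT (trg f) (fnT f x) = (\<Oplus>x0 x1\<in>rcoT (src f) x. fnT f x0 \<otimes> x1)"
    using assms(3) y rco_eq[OF assms(2) *(2), of y] by (simp add: is_right_comodule_map_def *(3))
qed

text \<open>Tensor products of colinear maps are colinear for the diagonal coactions, hence commute
  with \<open>cpart\<close> and respect its fixed points.\<close>

lemma tmap_wtens:
  assumes f: "is_right_comodule C (src f)" "is_right_comodule C (trg f)" "is_right_comodule_map C f"
    and g: "is_right_comodule C (src g)" "is_right_comodule C (trg g)" "is_right_comodule_map C g"
    and z: "z \<in> sp (wtens C (src f) (src g))"
  shows "tmap (fnT f) (fnT g) z \<in> sp (wtens C (trg f) (trg g))"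
    and "fn (arr_tens (wtens C) f g) z = tmap (fnT f) (fnT g) z"
proof -
  note [simp] = lin_comp[OF comodule_map_fnT(1)[OF f]] lin_comp[OF comodule_map_fnT(1)[OF g]]
    lin_comp[OF lin_rcoT[OF f(1)]] lin_comp[OF lin_rcoT[OF g(1)]]  lin_comp[OF lin_rcoT[OF f(2)]] lin_comp[OF lin_rcoT[OF g(2)]]
  have z1: "z \<in> sp (src f) \<otimes>\<^sub>S sp (src g)" using wtens_sub[OF f(1) g(1)] z by auto
  have 1: "tensR (rcoT (trg f)) (rcoT (trg g)) (tmap (fnT f) (fnT g) z)
    = (\<Oplus>w h\<in>tensR (rcoT (src f)) (rcoT (src g)) z. tmap (fnT f) (fnT g) w \<otimes> h)"
    by (simp add: tmap_def tensR_def swt_comp swt_tens bilinI comodule_map_rco[OF f] comodule_map_rco[OF g])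
  have 2: "tmap (fnT f) (fnT g) z \<in> sp (trg f) \<otimes>\<^sub>S sp (trg g)"
    unfolding tmap_def by (rule swt_mem[OF z1 subspace_tensS])
      (auto intro!: bilinI tens_in_tensS comodule_map_fnT(2)[OF f] comodule_map_fnT(2)[OF g])
  have "cpart (tensR (rcoT (trg f)) (rcoT (trg g))) (tmap (fnT f) (fnT g) z)
    = tmap (fnT f) (fnT g) (cpart (tensR (rcoT (src f)) (rcoT (src g))) z)"
    by (rule cpart_map[OF lin_tmap]) (rule 1)
  then show "tmap (fnT f) (fnT g) z \<in> sp (wtens C (trg f) (trg g))"
    unfolding wtens_sp[OF f(2) g(2)] using 2 by (simp add: wtens_cpart_id[OF f(1) g(1) z])
  show "fn (arr_tens (wtens C) f g) z = tmap (fnT f) (fnT g) z"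
    by (intro arr_tens_fn comodule_sub comodule_map_linear_on f g z wtens_sub)
qed

section \<open>Categories of comodules\<close>

lemma arr_id_map: "is_right_comodule C X \<Longrightarrow> is_right_comodule_map C (arr_id X)"
  by (rule comodule_mapI[of _ "\<lambda>x. x"]) (auto intro: lin_id simp: swt_id[OF rcoT_in])

lemma arr_comp_map:
  assumes f: "is_right_comodule C (src f)" "is_right_comodule C (trg f)" "is_right_comodule_map C f"
    and g: "is_right_comodule C (src g)" "is_right_comodule C (trg g)" "is_right_comodule_map C g"
    and fg: "src g = trg f"
  shows "is_right_comodule_map C (arr_comp g f)"
proof -
  note [simp] = lin_comp[OF comodule_map_fnT(1)[OF f]] lin_comp[OF comodule_map_fnT(1)[OF g]]
  show ?thesis
    by (rule comodule_mapI[of _ "\<lambda>x. fnT g (fnT f x)"])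
      (auto simp: f g comodule_map_fnT(2)[OF f] comodule_map_fnT(2)[OF g] comodule_map_fnT(3)[OF f] comodule_map_fnT(3)[OF g]
        comodule_map_rco[OF f] comodule_map_rco[OF g] fg[symmetric] comodule_map_rco[OF f, folded fg] comodule_map_fnT(2)[OF f, folded fg]
        swt_comp swt_tens bilinI)
qed

lemma category_laws:
  assumes f: "linear_on (sp (src f)) (sp (trg f)) (fn f)" "fn f \<in> extensional (sp (src f))"
  shows "arr_comp f (arr_id (src f)) = f" "arr_comp (arr_id (trg f)) f = f"
    "src g = trg f \<Longrightarrow> arr_comp h (arr_comp g f) = arr_comp (arr_comp h g) f"
  using f by (auto intro!: fn_eqI[where A = "sp (src f)"] arr_comp_ext simp: linear_on_def)

lemma category_comod_cat: "is_category (comod_cat C)"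
  unfolding is_category_def hom_def comod_cat_def cat.simps
  by (auto simp: arr_id_map arr_comp_map category_laws comodule_map_linear_on comodule_map_ext)

lemma category_wcomod_moncat: "is_category (wcomod_moncat C)"
  using category_comod_cat
  unfolding is_category_def hom_def wcomod_moncat_def comod_cat_def cat.simps moncat.simps .

section \<open>Bicomodules and their morphisms\<close>

lemma bicomoduleD:
  assumes X: "is_bicomodule C X"
  shows bicomodule_right: "is_right_comodule C X"
    and lin_lcoT: "lin (lcoT X)" and lcoT_in: "lcoT X x \<in> carr C \<otimes>\<^sub>S sp X"
    and lco_eq: "x \<in> sp X \<Longrightarrow> lco X x = lcoT X x"
proof -
  show r: "is_right_comodule C X" using X by (simp add: is_bicomodule_def)
  note s = comodule_sub[OF r]
  have "linear_on (sp X) (carr C \<otimes>\<^sub>S sp X) (lco X)" using X by (simp add: is_bicomodule_def)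
  then show "lin (lcoT X)" "lcoT X x \<in> carr C \<otimes>\<^sub>S sp X" "x \<in> sp X \<Longrightarrow> lco X x = lcoT X x"
    using lin_linear_on[OF s] by (auto simp: lcoT_def[abs_def] linear_on_def proj_in[OF s] proj_id[OF s])
qed

lemmas bicomodule_facts = lin_comp[OF lin_lcoT] lcoT_in lco_eq

lemma bicomodule_eqs:
  assumes X: "is_bicomodule C X"
  shows lco_coass: "trilin F \<Longrightarrow> (\<Oplus>y x0\<in>lcoT X x. \<Oplus>z x00\<in>lcoT X x0. F y z x00) = (\<Oplus>y x0\<in>lcoT X x. \<Oplus>y1 y2\<in>D y. F y1 y2 x0)"
    and lco_counit: "(\<Oplus>y x0\<in>lcoT X x. scale (ep y) x0) = proj (sp X) x"
    and lco_rco: "trilin F \<Longrightarrow> (\<Oplus>y x0\<in>lcoT X x. \<Oplus>x00 z\<in>rcoT X x0. F y x00 z) = (\<Oplus>x0 z\<in>rcoT X x. \<Oplus>y x00\<in>lcoT X x0. F y x00 z)"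
proof -
  note R = bicomodule_right[OF X]
  note s = comodule_sub[OF R]
  define y where "y = proj (sp X) x"
  have y: "y \<in> sp X" "rcoT X x = rcoT X y" "lcoT X x = lcoT X y"
    using s by (simp_all add: y_def proj_in rcoT_def proj_proj lcoT_def)
  note [simp] = lin_comp[OF lin_rcoT[OF R]] lin_comp[OF lin_lcoT[OF X]] rcoT_in[OF R] lcoT_in[OF X]
    s rco_eq[OF R] lco_eq[OF X] sub
  have a: "sw (carr C) (sp X) (lco X y) (\<lambda>w x0. w \<otimes> lco X x0) = (\<Oplus>w x0\<in>lcoT X y. w \<otimes> lcoT X x0)"
     "sw (carr C) (sp X) (lco X y) (\<lambda>w x0. sw (carr C) (carr C) (cop C w) (\<lambda>y1 y2. y1 \<otimes> y2 \<otimes> x0))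
        = (\<Oplus>w x0\<in>lcoT X y. \<Oplus>y1 y2\<in>D w. y1 \<otimes> y2 \<otimes> x0)"
     "sw (carr C) (sp X) (lco X y) (\<lambda>w x0. scale (cou C w) x0) = (\<Oplus>w x0\<in>lcoT X y. scale (ep w) x0)"
     "sw (carr C) (sp X) (lco X y) (\<lambda>w x0. sw (sp X) (carr C) (rco X x0) (\<lambda>x00 z. w \<otimes> x00 \<otimes> z))
        = (\<Oplus>w x0\<in>lcoT X y. \<Oplus>x00 z\<in>rcoT X x0. w \<otimes> x00 \<otimes> z)"
     "sw (sp X) (carr C) (rco X y) (\<lambda>x0 z. sw (carr C) (sp X) (lco X x0) (\<lambda>w x00. w \<otimes> x00 \<otimes> z))
        = (\<Oplus>x0 z\<in>rcoT X y. \<Oplus>w x00\<in>lcoT X x0. w \<otimes> x00 \<otimes> z)"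
    using y by (auto intro!: sw_swt bilinI simp: D_eq D_in ep_eq)
  have e: "(\<Oplus>w x0\<in>lcoT X y. w \<otimes> lcoT X x0) = (\<Oplus>w x0\<in>lcoT X y. \<Oplus>y1 y2\<in>D w. y1 \<otimes> y2 \<otimes> x0)"
    "(\<Oplus>w x0\<in>lcoT X y. scale (ep w) x0) = y"
    "(\<Oplus>w x0\<in>lcoT X y. \<Oplus>x00 z\<in>rcoT X x0. w \<otimes> x00 \<otimes> z) = (\<Oplus>x0 z\<in>rcoT X y. \<Oplus>w x00\<in>lcoT X x0. w \<otimes> x00 \<otimes> z)"
    unfolding a[symmetric] using X y(1) by (auto simp only: is_bicomodule_def)
  show "(\<Oplus>y x0\<in>lcoT X x. scale (ep y) x0) = proj (sp X) x"
    using e(2) by (simp add: y y_def[symmetric])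
  assume F: "trilin F"
  show "(\<Oplus>y x0\<in>lcoT X x. \<Oplus>z x00\<in>lcoT X x0. F y z x00) = (\<Oplus>y x0\<in>lcoT X x. \<Oplus>y1 y2\<in>D y. F y1 y2 x0)"
    using arg_cong[OF e(1), of "\<lambda>z. swt3 z F"]
    by (simp add: swt3_comp swt3_tens1[OF F] swt_tens[OF trilin_bilin[OF F]] y)
  show "(\<Oplus>y x0\<in>lcoT X x. \<Oplus>x00 z\<in>rcoT X x0. F y x00 z) = (\<Oplus>x0 z\<in>rcoT X x. \<Oplus>y x00\<in>lcoT X x0. F y x00 z)"
    using arg_cong[OF e(3), of "\<lambda>z. swt3 z F"]
    by (simp add: swt3_comp swt3_tens1[OF F] swt_tens[OF trilin_bilin[OF F]] y)
qed

lemma bicomoduleI: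
  assumes R: "is_right_comodule C X" and r: "lin r" "\<And>x. x \<in> sp X \<Longrightarrow> rco X x = r x" "\<And>x. x \<in> sp X \<Longrightarrow> r x \<in> sp X \<otimes>\<^sub>S carr C"
    and l: "lin l" "\<And>x. x \<in> sp X \<Longrightarrow> lco X x = l x" "\<And>x. x \<in> sp X \<Longrightarrow> l x \<in> carr C \<otimes>\<^sub>S sp X"
    and coass: "\<And>x. x \<in> sp X \<Longrightarrow> (\<Oplus>y x0\<in>l x. y \<otimes> l x0) = (\<Oplus>y x0\<in>l x. \<Oplus>y1 y2\<in>D y. y1 \<otimes> y2 \<otimes> x0)"
    and counit: "\<And>x. x \<in> sp X \<Longrightarrow> (\<Oplus>y x0\<in>l x. scale (ep y) x0) = x"
    and compat: "\<And>x. x \<in> sp X \<Longrightarrow> (\<Oplus>y x0\<in>l x. \<Oplus>x00 z\<in>r x0. y \<otimes> x00 \<otimes> z) = (\<Oplus>x0 z\<in>r x. \<Oplus>y x00\<in>l x0. y \<otimes> x00 \<otimes> z)"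
  shows "is_bicomodule C X"
  unfolding is_bicomodule_def
proof (intro conjI ballI R)
  note s = comodule_sub[OF R]
  note [simp] = lin_comp[OF r(1)] lin_comp[OF l(1)] s sub
  show "linear_on (sp X) (carr C \<otimes>\<^sub>S sp X) (lco X)"
    using s by (auto simp: linear_on_def l(2,3) linD[OF l(1)] kv.subspace_def)
  fix x assume x: "x \<in> sp X"
  have "sw (carr C) (sp X) (lco X x) (\<lambda>w x0. w \<otimes> lco X x0) = (\<Oplus>w x0\<in>l x. w \<otimes> l x0)"
     "sw (carr C) (sp X) (lco X x) (\<lambda>w x0. sw (carr C) (carr C) (cop C w) (\<lambda>y1 y2. y1 \<otimes> y2 \<otimes> x0))
        = (\<Oplus>w x0\<in>l x. \<Oplus>y1 y2\<in>D w. y1 \<otimes> y2 \<otimes> x0)"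
     "sw (carr C) (sp X) (lco X x) (\<lambda>w x0. scale (cou C w) x0) = (\<Oplus>w x0\<in>l x. scale (ep w) x0)"
     "sw (carr C) (sp X) (lco X x) (\<lambda>w x0. sw (sp X) (carr C) (rco X x0) (\<lambda>x00 z. w \<otimes> x00 \<otimes> z))
        = (\<Oplus>w x0\<in>l x. \<Oplus>x00 z\<in>r x0. w \<otimes> x00 \<otimes> z)"
     "sw (sp X) (carr C) (rco X x) (\<lambda>x0 z. sw (carr C) (sp X) (lco X x0) (\<lambda>w x00. w \<otimes> x00 \<otimes> z))
        = (\<Oplus>x0 z\<in>r x. \<Oplus>w x00\<in>l x0. w \<otimes> x00 \<otimes> z)"
    using x by (auto intro!: sw_swt bilinI simp: r(2,3) l(2,3) D_eq D_in ep_eq)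
  then show "sw (carr C) (sp X) (lco X x) (\<lambda>w x0. w \<otimes> lco X x0) = sw (carr C) (sp X) (lco X x) (\<lambda>w x0. sw (carr C) (carr C) (cop C w) (\<lambda>y1 y2. y1 \<otimes> y2 \<otimes> x0))"
    "sw (carr C) (sp X) (lco X x) (\<lambda>w x0. scale (cou C w) x0) = x"
    "sw (carr C) (sp X) (lco X x) (\<lambda>w x0. sw (sp X) (carr C) (rco X x0) (\<lambda>x00 z. w \<otimes> x00 \<otimes> z))
      = sw (sp X) (carr C) (rco X x) (\<lambda>x0 z. sw (carr C) (sp X) (lco X x0) (\<lambda>w x00. w \<otimes> x00 \<otimes> z))"
    using coass[OF x] counit[OF x] compat[OF x] by simp_all
qed

lemma bicomodule_mapI:
  assumes "is_bicomodule C (src f)" "is_bicomodule C (trg f)" "is_right_comodule_map C f"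
    and l: "\<And>x. x \<in> sp (src f) \<Longrightarrow> lcoT (trg f) (fnT f x) = (\<Oplus>y x0\<in>lcoT (src f) x. y \<otimes> fnT f x0)"
  shows "is_bicomodule_map C f"
  unfolding is_bicomodule_map_def
proof (intro conjI ballI assms)
  note R = bicomodule_right[OF assms(1)] bicomodule_right[OF assms(2)]
  note * = comodule_map_fnT[OF R assms(3)]
  fix x assume x: "x \<in> sp (src f)"
  have "sw (carr C) (sp (src f)) (lco (src f) x) (\<lambda>y x0. y \<otimes> fn f x0) = (\<Oplus>y x0\<in>lcoT (src f) x. y \<otimes> fnT f x0)"
    by (subst lco_eq[OF assms(1) x], intro sw_swt sub lcoT_in assms) (auto intro!: bilinI lin_comp[OF *(1)] lin_tens lin_id simp: *)
  then show "lco (trg f) (fn f x) = sw (carr C) (sp (src f)) (lco (src f) x) (\<lambda>y x0. y \<otimes> fn f x0)"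
    using l[OF x] by (simp add: *(3)[OF x] lco_eq[OF assms(2) *(2)])
qed

lemma bicomodule_map_lco:
  assumes "is_bicomodule C (src f)" "is_bicomodule C (trg f)" "is_bicomodule_map C f"
  shows "lcoT (trg f) (fnT f x) = (\<Oplus>y x0\<in>lcoT (src f) x. y \<otimes> fnT f x0)"
    and bicomodule_map_right: "is_right_comodule_map C f"
proof -
  note R = bicomodule_right[OF assms(1)] bicomodule_right[OF assms(2)]
  note s = comodule_sub[OF R(1)]
  show r: "is_right_comodule_map C f" using assms(3) by (simp add: is_bicomodule_map_def)
  note * = comodule_map_fnT[OF R r]
  define y where "y = proj (sp (src f)) x"
  have y: "y \<in> sp (src f)" "lcoT (src f) x = lcoT (src f) y" "fnT f x = fnT f y"
    using s by (simp_all add: y_def proj_in lcoT_def proj_proj fnT_def)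
  have "sw (carr C) (sp (src f)) (lco (src f) y) (\<lambda>y x0. y \<otimes> fn f x0) = (\<Oplus>y x0\<in>lcoT (src f) y. y \<otimes> fnT f x0)"
    by (subst lco_eq[OF assms(1) y(1)], intro sw_swt sub lcoT_in assms) (auto intro!: bilinI lin_comp[OF *(1)] lin_tens lin_id simp: *)
  then show "lcoT (trg f) (fnT f x) = (\<Oplus>y x0\<in>lcoT (src f) x. y \<otimes> fnT f x0)"
    using assms(3) y lco_eq[OF assms(2) *(2), of y] by (simp add: is_bicomodule_map_def *(3))
qed

lemma fnT_arr_id: "ksubspace (sp X) \<Longrightarrow> fnT (arr_id X) x = proj (sp X) x"
  by (simp add: fnT_def proj_in)

lemma fnT_arr_comp:
  assumes "is_right_comodule C (src f)" "is_right_comodule C (trg f)" "is_right_comodule_map C f" "src g = trg f"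
  shows "fnT (arr_comp g f) x = fnT g (fnT f x)"
proof -
  have "fnT f x \<in> sp (trg f)" by (rule comodule_map_fnT(2)[OF assms(1-3)])
  then show ?thesis using assms(4) comodule_sub[OF assms(1)] comodule_sub[OF assms(2)]
    by (simp add: fnT_def proj_in proj_id)
qed

lemma bicomodule_arr_id: "is_bicomodule C X \<Longrightarrow> is_bicomodule_map C (arr_id X)"
  by (rule bicomodule_mapI) (auto simp: arr_id_map bicomodule_right fnT_arr_id comodule_sub proj_id
      intro!: swt_cong_on[OF lcoT_in, THEN trans[OF _ swt_id[OF lcoT_in]], symmetric] bilinI lin_tens lin_id lin_proj)

lemma bicomodule_arr_comp:
  assumes f: "is_bicomodule C (src f)" "is_bicomodule C (trg f)" "is_bicomodule_map C f"
    and g: "is_bicomodule C (src g)" "is_bicomodule C (trg g)" "is_bicomodule_map C g"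
    and fg: "src g = trg f"
  shows "is_bicomodule_map C (arr_comp g f)"
proof -
  note F = bicomodule_right[OF f(1)] bicomodule_right[OF f(2)] bicomodule_map_right[OF f]
  note G = bicomodule_right[OF g(1)] bicomodule_right[OF g(2)] bicomodule_map_right[OF g]
  note [simp] = lin_comp[OF comodule_map_fnT(1)[OF F]] lin_comp[OF comodule_map_fnT(1)[OF G]]
  show ?thesis
    by (rule bicomodule_mapI) (auto simp: f g arr_comp_map[OF F G fg] fnT_arr_comp[OF F fg]
      bicomodule_map_lco[OF f] bicomodule_map_lco[OF g] bicomodule_map_lco[OF f, folded fg] swt_comp swt_tens bilinI)
qed

lemma category_bicomod_moncat: "is_category (bicomod_moncat C)"
  unfolding is_category_def hom_def bicomod_moncat_def cat.simps moncat.simps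
  by (auto simp: bicomodule_arr_id bicomodule_arr_comp category_laws comodule_map_linear_on comodule_map_ext bicomodule_right bicomodule_map_right)

end

lemma tmap_cong:
  assumes z: "z \<in> V \<otimes>\<^sub>S W" and "lin F" "lin F'" "lin G" "lin G'" "\<And>x. x \<in> V \<Longrightarrow> F x = F' x" "\<And>y. y \<in> W \<Longrightarrow> G y = G' y"
  shows "tmap F G z = tmap F' G' z"
  unfolding tmap_def
  by (rule swt_cong_on[OF z]) (auto intro!: bilinI lin_intros lin_comp[of F] lin_comp[of F'] lin_comp[of G] lin_comp[of G'] assms simp: assms(6,7))

lemma truncate_simps [simp]:
  "sp (comod.truncate X) = sp X" "rco (comod.truncate X) = rco X" "rcoT (comod.truncate X) = rcoT X"
  "is_right_comodule C (comod.truncate X) = is_right_comodule C X"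
  by (simp_all add: comod.truncate_def rcoT_def[abs_def] is_right_comodule_def)

lemma forget_left_simps [simp]:
  "FO forget_left X = comod.truncate X"
  "src (FA forget_left f) = comod.truncate (src f)" "trg (FA forget_left f) = comod.truncate (trg f)"
  "fn (FA forget_left f) = fn f" "fnT (FA forget_left f) = fnT f"
  "is_right_comodule_map C (FA forget_left f) = is_right_comodule_map C f"
  by (simp_all add: forget_left_def fnT_def[abs_def] is_right_comodule_map_def)

lemma forget_left_arr [simp]:
  "FA forget_left (arr_id X) = arr_id (comod.truncate X)"
  "FA forget_left (arr_comp g f) = arr_comp (FA forget_left g) (FA forget_left f)"
  by (simp_all add: forget_left_def arr_id_def arr_comp_def)

lemma is_functor_comp:
  assumes "is_functor C D F" "is_functor D E G"
  shows "is_functor C E (func_comp G F)"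
  using assms unfolding is_functor_def func_comp_def hom_def by auto

section \<open>Quantum transformation groupoids\<close>

definition gmap :: "(('k::field, 'i) vec \<Rightarrow> ('k, 'i) vec) \<Rightarrow> ('k, 'i) vec \<Rightarrow> ('k, 'i) vec"
  where "gmap F z = (\<Oplus>a x b\<in>z. a \<otimes> F x \<otimes> b)"

lemma lin_gmap: "lin (gmap F)"
  unfolding gmap_def[abs_def] by (intro lin_intros)

lemma gmap_cong:
  assumes z: "z \<in> U \<otimes>\<^sub>S V \<otimes>\<^sub>S W" and F: "lin F" "lin G" "\<And>x. x \<in> V \<Longrightarrow> F x = G x"
  shows "gmap F z = gmap G z"
  unfolding gmap_def
  using F by (intro swt3_cong_on[OF z]) (auto intro!: trilinI lin_intros lin_comp[of F] lin_comp[of G])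

lemma gmap_gmap: "lin F \<Longrightarrow> lin G \<Longrightarrow> gmap F (gmap G z) = gmap (\<lambda>x. F (G x)) z"
  unfolding gmap_def by (simp add: swt_simps lin_intros lin_comp[of F] lin_comp[of G])

lemma gmap_id: "z \<in> U \<otimes>\<^sub>S V \<otimes>\<^sub>S W \<Longrightarrow> gmap (\<lambda>x. x) z = z"
  unfolding gmap_def by (rule swt_id3)

lemma gmap_mem:
  assumes z: "z \<in> U \<otimes>\<^sub>S V \<otimes>\<^sub>S W" and F: "lin F" "\<And>x. x \<in> V \<Longrightarrow> F x \<in> V'"
  shows "gmap F z \<in> U \<otimes>\<^sub>S V' \<otimes>\<^sub>S W"
  unfolding gmap_def
  by (rule swt3_mem[OF z subspace_tensS]) (auto intro!: trilinI lin_intros lin_comp[of F] tens_in_tensS F)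

lemma unitv_nonzero: "(unitv :: ('k::field, 'i) vec) \<noteq> 0"
proof
  assume "(unitv :: ('k, 'i) vec) = 0"
  then have "Poly_Mapping.lookup (unitv :: ('k, 'i) vec) Triv = 0" by simp
  then show False by (simp add: unitv_def)
qed

text \<open>Allows scalar identities to be proved as vector identities along \<open>unitv\<close>,
  within the reach of the Sweedler calculus.\<close>

lemma scale_unitv_eq: "scale a (unitv :: ('k::field, 'i) vec) = scale b unitv \<longleftrightarrow> a = b"
  by (simp add: unitv_nonzero)

locale quantum_transformation_groupoid =
  fixes L :: "('k::field, 'i) hopf"
    and B :: "('k, 'i) alg"
    and act :: "('k, 'i) vec \<Rightarrow> ('k, 'i) vec \<Rightarrow> ('k, 'i) vec"
    and e :: "('k, 'i) vec"
    and \<omega> :: "('k, 'i) vec \<Rightarrow> 'k"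
  assumes data: "qtg_data L B act e \<omega>"
begin

section \<open>The data as total maps and their laws\<close>

abbreviation "pB \<equiv> proj (carr B)"
abbreviation "pL \<equiv> proj (carr L)"
abbreviation "mB \<equiv> mulT B"
abbreviation "mL \<equiv> mulT L"
abbreviation "D \<equiv> copT L"
abbreviation "ep \<equiv> couT L"

definition "A b h = act (pB b) (pL h)"
definition "SL h = antp L (pL h)"
definition "La h a = A a (SL h)"
definition "w b = \<omega> (pB b)"

lemma L_alg: "is_algebra L" and L_coalg: "is_coalgebra L" and B_alg: "is_algebra B"
  using data by (auto simp: qtg_data_def is_hopf_algebra_def)

lemma subL: "ksubspace (carr L)" and subB: "ksubspace (carr B)"
  using L_alg B_alg by (auto simp: is_algebra_def)

lemma pB_pB [simp]: "pB (pB x) = pB x" and pL_pL [simp]: "pL (pL x) = pL x"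
  by (auto simp: proj_proj subB subL)

lemma pB_in [simp]: "pB x \<in> carr B" and pL_in [simp]: "pL x \<in> carr L"
  by (auto simp: proj_in subB subL)

lemma mB_eq: "x \<in> carr B \<Longrightarrow> y \<in> carr B \<Longrightarrow> mul B x y = mB x y"
  and mL_eq: "x \<in> carr L \<Longrightarrow> y \<in> carr L \<Longrightarrow> mul L x y = mL x y"
  and D_eq: "x \<in> carr L \<Longrightarrow> cop L x = D x"
  and ep_eq: "x \<in> carr L \<Longrightarrow> cou L x = ep x"
  and A_eq: "b \<in> carr B \<Longrightarrow> x \<in> carr L \<Longrightarrow> act b x = A b x"
  and SL_eq: "x \<in> carr L \<Longrightarrow> antp L x = SL x"
  and w_eq: "b \<in> carr B \<Longrightarrow> \<omega> b = w b"
  by (auto simp: mulT_def copT_def couT_def A_def SL_def w_def proj_id[OF subB] proj_id[OF subL])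

lemma bilin_mB: "bilin mB"
  using B_alg unfolding mulT_def by (intro bilin_bilinear_on[OF subB subB]) (auto simp: is_algebra_def)

lemma bilin_mL: "bilin mL"
  using L_alg unfolding mulT_def by (intro bilin_bilinear_on[OF subL subL]) (auto simp: is_algebra_def)

lemma bilin_A: "bilin A"
  using data unfolding A_def by (intro bilin_bilinear_on[OF subB subL]) (auto simp: qtg_data_def is_right_module_algebra_def)

lemma lin_D: "lin D"
  using L_coalg unfolding copT_def by (intro lin_linear_on[OF subL]) (auto simp: is_coalgebra_def)

lemma linf_ep: "linf ep"
  using L_coalg unfolding couT_def by (intro linf_functional_on[OF subL]) (auto simp: is_coalgebra_def)

lemma lin_SL: "lin SL"
  using data unfolding SL_def by (intro lin_linear_on[OF subL]) (auto simp: qtg_data_def is_hopf_algebra_def)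

lemma linf_w: "linf w"
  using data unfolding w_def by (intro linf_functional_on[OF subB]) (auto simp: qtg_data_def)

lemma bilin_La: "bilin La"
  unfolding La_def by (intro bilinI bilin_comp1[OF bilin_A] bilin_comp2[OF bilin_A] lin_comp[OF lin_SL] lin_id)

lemmas lins [simp] = lin_intros bilin_comp1[OF bilin_mB] bilin_comp2[OF bilin_mB] bilin_comp1[OF bilin_mL] bilin_comp2[OF bilin_mL]
  bilin_comp1[OF bilin_A] bilin_comp2[OF bilin_A] bilin_comp1[OF bilin_La] bilin_comp2[OF bilin_La]
  lin_comp[OF lin_D] lin_scale_left[OF linf_ep] lin_comp[OF lin_SL] lin_scale_left[OF linf_w] lin_proj[OF subB] lin_proj[OF subL]

lemma mB_in [simp]: "mB x y \<in> carr B" and mL_in [simp]: "mL x y \<in> carr L"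
  and one_in [simp]: "one B \<in> carr B" "one L \<in> carr L"
  using L_alg B_alg by (auto simp: is_algebra_def mulT_def bilinear_on_def linear_on_def)

lemma SL_in [simp]: "SL h \<in> carr L" and A_in [simp]: "A b h \<in> carr B"
  using data by (auto simp: qtg_data_def is_hopf_algebra_def is_right_module_algebra_def SL_def A_def bilinear_on_def linear_on_def)

lemma La_in [simp]: "La h a \<in> carr B"
  by (simp add: La_def)

lemma D_in: "D x \<in> carr L \<otimes>\<^sub>S carr L"
  using L_coalg by (auto simp: is_coalgebra_def copT_def linear_on_def)

lemma pB_id [simp]: "x \<in> carr B \<Longrightarrow> pB x = x" and pL_id [simp]: "x \<in> carr L \<Longrightarrow> pL x = x"
  by (auto simp: proj_id subB subL)

lemma proj_absorb [simp]:
  "mB (pB x) y = mB x y" "mB x (pB y) = mB x y" "mL (pL h) k = mL h k" "mL h (pL k) = mL h k"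
  "A (pB x) h = A x h" "A x (pL h) = A x h" "SL (pL h) = SL h" "La (pL h) x = La h x" "La h (pB x) = La h x"
  "D (pL h) = D h" "ep (pL h) = ep h" "w (pB x) = w x"
  by (auto simp: mulT_def A_def SL_def La_def copT_def couT_def w_def)

lemma mB_assoc: "mB (mB x y) z = mB x (mB y z)"
  and mL_assoc: "mL (mL h k) l = mL h (mL k l)"
  using B_alg L_alg by (auto simp: is_algebra_def mB_eq[symmetric] mL_eq[symmetric] mulT_def bilinear_on_def linear_on_def)

lemma mB_one [simp]: "mB (one B) x = pB x" "mB x (one B) = pB x"
  and mL_one [simp]: "mL (one L) h = pL h" "mL h (one L) = pL h"
  using B_alg L_alg by (auto simp: is_algebra_def mulT_def)

lemma scale_ops [simp]:
  "mB (scale c x) y = scale c (mB x y)" "mB x (scale c y) = scale c (mB x y)"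
  "mL (scale c h) k = scale c (mL h k)" "mL h (scale c k) = scale c (mL h k)"
  "A (scale c x) h = scale c (A x h)" "A x (scale c h) = scale c (A x h)"
  "La (scale c h) x = scale c (La h x)" "La h (scale c x) = scale c (La h x)"
  "w (scale c x) = c * w x" "ep (scale c h) = c * ep h" "D (scale c h) = scale c (D h)" "pB (scale c x) = scale c (pB x)" "pL (scale c h) = scale c (pL h)"
  "SL (scale c h) = scale c (SL h)"
  using bilin_mB bilin_mL bilin_A bilin_La linf_w linf_ep lin_D lin_proj'[OF subB] lin_proj'[OF subL] lin_SL
  by (auto simp: bilin_def lin_def linf_def)

lemma coass_D: "trilin F \<Longrightarrow>
    (\<Oplus>x0 x1\<in>D x. \<Oplus>u v\<in>D x0. F u v x1) = (\<Oplus>x0 x1\<in>D x. \<Oplus>u v\<in>D x1. F x0 u v)"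
  and counit_D1: "(\<Oplus>x1 x2\<in>D x. scale (ep x1) x2) = pL x"
  and counit_D2: "(\<Oplus>x1 x2\<in>D x. scale (ep x2) x1) = pL x"
proof -
  define y where "y = pL x"
  have y: "y \<in> carr L" "D x = D y" by (auto simp: y_def)
  have a: "sw (carr L) (carr L) (D y) (\<lambda>x1 x2. sw (carr L) (carr L) (cop L x1) (\<lambda>x11 x12. x11 \<otimes> x12 \<otimes> x2))
      = (\<Oplus>x0 x1\<in>D y. \<Oplus>u v\<in>D x0. u \<otimes> v \<otimes> x1)"
    "sw (carr L) (carr L) (D y) (\<lambda>x1 x2. x1 \<otimes> cop L x2) = (\<Oplus>x0 x1\<in>D y. x0 \<otimes> D x1)"
    "sw (carr L) (carr L) (D y) (\<lambda>x1 x2. scale (cou L x1) x2) = (\<Oplus>x1 x2\<in>D y. scale (ep x1) x2)"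
    "sw (carr L) (carr L) (D y) (\<lambda>x1 x2. scale (cou L x2) x1) = (\<Oplus>x1 x2\<in>D y. scale (ep x2) x1)"
    by (auto intro!: sw_swt bilinI subL D_in simp: D_eq ep_eq)
  have *: "(\<Oplus>x0 x1\<in>D y. \<Oplus>u v\<in>D x0. u \<otimes> v \<otimes> x1) = (\<Oplus>x0 x1\<in>D y. x0 \<otimes> D x1)"
    "(\<Oplus>x1 x2\<in>D y. scale (ep x1) x2) = y" "(\<Oplus>x1 x2\<in>D y. scale (ep x2) x1) = y"
    unfolding a[symmetric] using L_coalg y(1) by (simp_all add: is_coalgebra_def D_eq)
  show "(\<Oplus>x1 x2\<in>D x. scale (ep x1) x2) = pL x" "(\<Oplus>x1 x2\<in>D x. scale (ep x2) x1) = pL x"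
    using *(2,3) by (simp_all add: y_def)
  assume F: "trilin F"
  show "(\<Oplus>x0 x1\<in>D x. \<Oplus>u v\<in>D x0. F u v x1) = (\<Oplus>x0 x1\<in>D x. \<Oplus>u v\<in>D x1. F x0 u v)"
    using arg_cong[OF *(1), of "\<lambda>z. swt3 z F"]
    by (simp add: swt3_comp swt3_tens1[OF F] swt_tens[OF trilin_bilin[OF F]] y)
qed

lemma D_one: "D (one L) = one L \<otimes> one L" and ep_one [simp]: "ep (one L) = 1"
  using data by (auto simp: qtg_data_def is_hopf_algebra_def D_eq[symmetric] ep_eq[symmetric])

lemma ep_mul [simp]: "ep (mL h k) = ep h * ep k"
proof -
  have "cou L (mul L (pL h) (pL k)) = cou L (pL h) * cou L (pL k)"
    using data by (simp add: qtg_data_def is_hopf_algebra_def)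
  then show ?thesis by (simp add: mL_eq ep_eq)
qed

lemma D_mul: "D (mL h k) = (\<Oplus>h1 h2\<in>D h. \<Oplus>k1 k2\<in>D k. mL h1 k1 \<otimes> mL h2 k2)"
proof -
  have "sw (carr L) (carr L) (D h) (\<lambda>x1 x2. sw (carr L) (carr L) (D k) (\<lambda>y1 y2. mul L x1 y1 \<otimes> mul L x2 y2))
    = (\<Oplus>h1 h2\<in>D h. \<Oplus>k1 k2\<in>D k. mL h1 k1 \<otimes> mL h2 k2)"
    by (auto intro!: sw_swt bilinI subL D_in simp: mL_eq)
  moreover have "cop L (mul L (pL h) (pL k)) = sw (carr L) (carr L) (cop L (pL h)) (\<lambda>x1 x2. sw (carr L) (carr L) (cop L (pL k)) (\<lambda>y1 y2. mul L x1 y1 \<otimes> mul L x2 y2))"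
    using data by (auto simp: qtg_data_def is_hopf_algebra_def)
  ultimately show ?thesis by (simp add: mL_eq D_eq)
qed

sublocale L: bialg L
proof
  show "mulT L (mulT L x y) z = mulT L x (mulT L y z)" for x y z by (rule mL_assoc)
  show "(\<Oplus>x1 x2\<in>D x. scale (ep x1) x2) = pL x" for x by (rule counit_D1)
  show "D (mL h k) = (\<Oplus>h1 h2\<in>D h. \<Oplus>k1 k2\<in>D k. mL h1 k1 \<otimes> mL h2 k2)" for h k by (rule D_mul)
qed (use subL L_alg L_coalg in \<open>auto simp: is_algebra_def is_coalgebra_def\<close>)

lemma antipode: "(\<Oplus>x1 x2\<in>D x. mL (SL x1) x2) = scale (ep x) (one L)" "(\<Oplus>x1 x2\<in>D x. mL x1 (SL x2)) = scale (ep x) (one L)"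
proof -
  have "sw (carr L) (carr L) (D (pL x)) (\<lambda>x1 x2. mul L (antp L x1) x2) = (\<Oplus>x1 x2\<in>D (pL x). mL (SL x1) x2)"
    "sw (carr L) (carr L) (D (pL x)) (\<lambda>x1 x2. mul L x1 (antp L x2)) = (\<Oplus>x1 x2\<in>D (pL x). mL x1 (SL x2))"
    by (auto intro!: sw_swt bilinI subL D_in simp: mL_eq SL_eq simp del: proj_absorb)
  moreover have "sw (carr L) (carr L) (cop L (pL x)) (\<lambda>x1 x2. mul L (antp L x1) x2) = scale (cou L (pL x)) (one L) \<and>
      sw (carr L) (carr L) (cop L (pL x)) (\<lambda>x1 x2. mul L x1 (antp L x2)) = scale (cou L (pL x)) (one L)"
    using data by (auto simp: qtg_data_def is_hopf_algebra_def)
  ultimately show "(\<Oplus>x1 x2\<in>D x. mL (SL x1) x2) = scale (ep x) (one L)" "(\<Oplus>x1 x2\<in>D x. mL x1 (SL x2)) = scale (ep x) (one L)"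
    by (simp_all add: D_eq ep_eq)
qed

lemma A_one [simp]: "A b (one L) = pB b" and A_mul: "A (A b h) k = A b (mL h k)"
  and A_1 [simp]: "A (one B) h = scale (ep h) (one B)"
proof -
  have "act (pB b) (one L) = pB b" "act (act (pB b) (pL h)) (pL k) = act (pB b) (mul L (pL h) (pL k))"
    "act (one B) (pL h) = scale (cou L (pL h)) (one B)"
    using data by (simp_all add: qtg_data_def is_right_module_algebra_def)
  then show "A b (one L) = pB b" "A (A b h) k = A b (mL h k)" "A (one B) h = scale (ep h) (one B)"
    by (simp_all add: A_eq mL_eq ep_eq)
qed

lemma A_mB: "A (mB b b') h = (\<Oplus>h1 h2\<in>D h. mB (A b h1) (A b' h2))"
proof -
  have "sw (carr L) (carr L) (D (pL h)) (\<lambda>h1 h2. mul B (act (pB b) h1) (act (pB b') h2)) = (\<Oplus>h1 h2\<in>D (pL h). mB (A (pB b) h1) (A (pB b') h2))"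
    by (auto intro!: sw_swt bilinI subL D_in simp: mB_eq A_eq simp del: proj_absorb)
  moreover have "act (mul B (pB b) (pB b')) (pL h) = sw (carr L) (carr L) (cop L (pL h)) (\<lambda>h1 h2. mul B (act (pB b) h1) (act (pB b') h2))"
    using data by (auto simp: qtg_data_def is_right_module_algebra_def)
  ultimately show ?thesis by (simp add: mB_eq A_eq D_eq)
qed

lemma w_adj: "w (mB (La h a) b) = w (mB a (A b h))"
proof -
  have "\<omega> (mul B (lact L act (pL h) (pB a)) (pB b)) = \<omega> (mul B (pB a) (act (pB b) (pL h)))" using data by (auto simp: qtg_data_def)
  then show ?thesis by (simp add: mB_eq w_eq lact_def A_eq SL_eq La_def)
qed

text \<open>The difference \<open>a - a'\<close> pairs to zero with all of \<open>B\<close>. The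
  hypothesis is written with multiples of \<open>unitv\<close> so that it can be discharged by
  computing with Sweedler sums.\<close>

lemma nondeg:
  assumes "\<And>b. scale (w (mB a b)) (unitv :: ('k, 'i) vec) = scale (w (mB a' b)) unitv"
  shows "pB a = pB a'"
proof -
  have "w (mB a b) = w (mB a' b)" for b using assms[of b] unfolding scale_unitv_eq .
  moreover have "w (mB a b) = w (mB (a - a') b) + w (mB a' b)" for b
  proof -
    have "mB (a - a' + a') b = mB (a - a') b + mB a' b"
      by (rule linD(1)[OF bilin_comp1[OF bilin_mB lin_id]])
    then show ?thesis using linf_w by (simp add: linf_def)
  qed
  ultimately have "w (mB (a - a') b) = 0" for b by simp
  then have "\<forall>b\<in>carr B. \<omega> (mul B (pB (a - a')) b) = 0" by (simp add: mB_eq w_eq)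
  then have "pB (a - a') = 0" using data by (auto simp: qtg_data_def)
  then show ?thesis using linD(1)[OF lin_proj'[OF subB], of "a - a'" a'] by simp
qed

section \<open>The separability idempotent and the trace form\<close>

lemma e_in: "e \<in> carr B \<otimes>\<^sub>S carr B"
  using data by (simp add: qtg_data_def is_symmetric_separability_idempotent_def)

text \<open>The axioms for \<open>e\<close> are identities of tensors; evaluating an arbitrary
  bilinear \<open>F\<close> on both sides makes them usable inside any sum.\<close>

lemma
  assumes F: "bilin F"
  shows e_idem: "(\<Oplus>e1 e2\<in>e. \<Oplus>f1 f2\<in>e. F (mB e1 f1) (mB f2 e2)) = swt e F"
    and e_mB: "(\<Oplus>e1 e2\<in>e. F (mB b e1) e2) = (\<Oplus>e1 e2\<in>e. F e1 (mB e2 b))"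
    and e_La: "(\<Oplus>e1 e2\<in>e. F e1 (La h e2)) = (\<Oplus>e1 e2\<in>e. F (A e1 h) e2)"
proof -
  have a: "sw (carr B) (carr B) e (\<lambda>e1 e2. sw (carr B) (carr B) e (\<lambda>f1 f2. mul B e1 f1 \<otimes> mul B f2 e2)) = (\<Oplus>e1 e2\<in>e. \<Oplus>f1 f2\<in>e. mB e1 f1 \<otimes> mB f2 e2)"
    "sw (carr B) (carr B) e (\<lambda>e1 e2. mul B (pB b) e1 \<otimes> e2) = (\<Oplus>e1 e2\<in>e. mB b e1 \<otimes> e2)"
    "sw (carr B) (carr B) e (\<lambda>e1 e2. e1 \<otimes> mul B e2 (pB b)) = (\<Oplus>e1 e2\<in>e. e1 \<otimes> mB e2 b)"
    "sw (carr B) (carr B) e (\<lambda>e1 e2. e1 \<otimes> lact L act (pL h) e2) = (\<Oplus>e1 e2\<in>e. e1 \<otimes> La h e2)"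
    "sw (carr B) (carr B) e (\<lambda>e1 e2. act e1 (pL h) \<otimes> e2) = (\<Oplus>e1 e2\<in>e. A e1 h \<otimes> e2)"
    by (auto intro!: sw_swt bilinI subB e_in simp: mB_eq lact_def A_eq SL_eq La_def)
  have *: "(\<Oplus>e1 e2\<in>e. \<Oplus>f1 f2\<in>e. mB e1 f1 \<otimes> mB f2 e2) = e"
    "(\<Oplus>e1 e2\<in>e. mB b e1 \<otimes> e2) = (\<Oplus>e1 e2\<in>e. e1 \<otimes> mB e2 b)"
    "(\<Oplus>e1 e2\<in>e. e1 \<otimes> La h e2) = (\<Oplus>e1 e2\<in>e. A e1 h \<otimes> e2)"
    unfolding a[symmetric] using data by (auto simp: qtg_data_def is_symmetric_separability_idempotent_def)
  show "(\<Oplus>e1 e2\<in>e. \<Oplus>f1 f2\<in>e. F (mB e1 f1) (mB f2 e2)) = swt e F"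
    using arg_cong[OF *(1), of "\<lambda>z. swt z F"] by (simp add: swt_comp swt_tens[OF F])
  show "(\<Oplus>e1 e2\<in>e. F (mB b e1) e2) = (\<Oplus>e1 e2\<in>e. F e1 (mB e2 b))"
    using arg_cong[OF *(2), of "\<lambda>z. swt z F"] by (simp add: swt_comp swt_tens[OF F])
  show "(\<Oplus>e1 e2\<in>e. F e1 (La h e2)) = (\<Oplus>e1 e2\<in>e. F (A e1 h) e2)"
    using arg_cong[OF *(3), of "\<lambda>z. swt z F"] by (simp add: swt_comp swt_tens[OF F])
qed

lemma e_w: "(\<Oplus>e1 e2\<in>e. scale (w e1) e2) = one B" "(\<Oplus>e1 e2\<in>e. scale (w e2) e1) = one B"
proof -
  have a: "sw (carr B) (carr B) e (\<lambda>e1 e2. scale (\<omega> e1) e2) = (\<Oplus>e1 e2\<in>e. scale (w e1) e2)"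
    "sw (carr B) (carr B) e (\<lambda>e1 e2. scale (\<omega> e2) e1) = (\<Oplus>e1 e2\<in>e. scale (w e2) e1)"
    by (auto intro!: sw_swt bilinI subB e_in simp: w_eq)
  show "(\<Oplus>e1 e2\<in>e. scale (w e1) e2) = one B" "(\<Oplus>e1 e2\<in>e. scale (w e2) e1) = one B"
    unfolding a[symmetric] using data by (auto simp: qtg_data_def)
qed

text \<open>The legs of \<open>e\<close> are dual bases for the trace form: \<open>c\<close> crosses
  \<open>e\<close> by \<open>e_mB\<close>, and what remains is the normalization of \<omega>. All
  counit computations for \<open>H\<close> rest on this reconstruction and its mirror image
  \<open>e_w_right\<close>.\<close>

lemma e_w_left: "(\<Oplus>e1 e2\<in>e. scale (w (mB c e1)) e2) = pB c"
proof -
  have "(\<Oplus>e1 e2\<in>e. scale (w (mB c e1)) e2) = (\<Oplus>e1 e2\<in>e. scale (w e1) (mB e2 c))"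
    by (rule e_mB) (auto intro: bilinI)
  also have "\<dots> = mB (\<Oplus>e1 e2\<in>e. scale (w e1) e2) c"
    by (subst lin_swt_out[of "\<lambda>x. mB x c"]) auto
  finally show ?thesis by (simp add: e_w)
qed

lemma e_w_right: "(\<Oplus>e1 e2\<in>e. scale (w (mB e2 c)) e1) = pB c"
proof -
  have "(\<Oplus>e1 e2\<in>e. scale (w (mB e2 c)) e1) = (\<Oplus>e1 e2\<in>e. scale (w e2) (mB c e1))"
    by (rule e_mB[symmetric]) (auto intro: bilinI)
  also have "\<dots> = mB c (\<Oplus>e1 e2\<in>e. scale (w e2) e1)"
    by (subst lin_swt_out[of "\<lambda>x. mB c x"]) auto
  finally show ?thesis by (simp add: e_w)
qed

text \<open>The antipode axiom for \<open>S(h1) h2\<close> seen through the module \<open>B\<close>: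
  acting by \<open>h2\<close> undoes the left action of \<open>h1\<close>. The companion
  \<open>La_A\<close> comes from \<open>h1 S(h2)\<close>.\<close>

lemma A_La: "(\<Oplus>h1 h2\<in>D h. A (La h1 a) h2) = scale (ep h) (pB a)"
proof -
  have "(\<Oplus>h1 h2\<in>D h. A (La h1 a) h2) = A a (\<Oplus>h1 h2\<in>D h. mL (SL h1) h2)"
    by (subst lin_swt_out[of "\<lambda>x. A a x"]) (auto simp: La_def A_mul)
  then show ?thesis by (simp add: antipode)
qed

lemma La_A: "(\<Oplus>h1 h2\<in>D h. La h2 (A a h1)) = scale (ep h) (pB a)"
proof -
  have "(\<Oplus>h1 h2\<in>D h. La h2 (A a h1)) = A a (\<Oplus>h1 h2\<in>D h. mL h1 (SL h2))"
    by (subst lin_swt_out[of "\<lambda>x. A a x"]) (auto simp: La_def A_mul)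
  then show ?thesis by (simp add: antipode)
qed

text \<open>Read off from \<open>A_La\<close> at the grouplike element \<open>one L\<close>, so that
  the value of the antipode at the unit is never computed.\<close>

lemma La_one [simp]: "La (one L) a = pB a"
  using A_La[of "one L" a] by (simp add: D_one swt_tens bilinI)

text \<open>
  By nondegeneracy of \<open>\<omega>\<close> the left action is the adjoint of the right one, so its laws follow without
  showing that the antipode is an antihomomorphism.
\<close>

lemma La_mul: "La h (La k a) = La (mL h k) a"
proof -
  have "pB (La h (La k a)) = pB (La (mL h k) a)"
    by (rule nondeg) (simp add: w_adj A_mul)
  then show ?thesis by simp
qed

text \<open>Amounts to invariance of the counit under the antipode, which follows by inserting a
  counit and applying \<epsilon> to the antipode axiom. Scalars are carried as multiples of
  \<open>one L\<close>.\<close>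

lemma La_1 [simp]: "La h (one B) = scale (ep h) (one B)"
proof -
  have "scale (ep (SL h)) (one L) = scale (ep h) (one L)"
  proof -
    have "scale (ep (SL h)) (one L) = scale (ep (SL (\<Oplus>x1 x2\<in>D h. scale (ep x2) x1))) (one L)"
      by (simp add: counit_D2)
    also have "\<dots> = (\<Oplus>x1 x2\<in>D h. scale (ep (mL (SL x1) x2)) (one L))"
      by (subst lin_swt_out[of "\<lambda>x. scale (ep (SL x)) (one L)"]) (auto simp: mult.commute)
    also have "\<dots> = scale (ep (\<Oplus>x1 x2\<in>D h. mL (SL x1) x2)) (one L)"
      by (subst lin_swt_out[of "\<lambda>x. scale (ep x) (one L)"]) auto
    also have "\<dots> = scale (ep h) (one L)" by (simp add: antipode)
    finally show ?thesis .
  qed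
  then have "ep (scale (ep (SL h)) (one L)) = ep (scale (ep h) (one L))" by (rule arg_cong)
  then show ?thesis by (simp add: La_def)
qed

text \<open>The legs of \<open>h\<close> come in reverse order because the left action is one on the
  opposite algebra. Tested against \<omega>, the outer action becomes a right action on a product;
  its leg on \<open>La h1 q\<close> cancels by \<open>A_La\<close>.\<close>

lemma La_mB: "La h (mB p q) = (\<Oplus>h1 h2\<in>D h. mB (La h2 p) (La h1 q))"
proof -
  let ?u = "unitv :: ('k, 'i) vec"
  have "pB (\<Oplus>h1 h2\<in>D h. mB (La h2 p) (La h1 q)) = pB (La h (mB p q))"
  proof (rule nondeg)
    fix b
    have "scale (w (mB (\<Oplus>h1 h2\<in>D h. mB (La h2 p) (La h1 q)) b)) ?u
       = (\<Oplus>h1 h2\<in>D h. scale (w (mB p (A (mB (La h1 q) b) h2))) ?u)"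
      by (subst lin_swt_out[of "\<lambda>x. scale (w (mB x b)) ?u"]) (auto simp: mB_assoc w_adj)
    also have "\<dots> = (\<Oplus>h1 h2\<in>D h. \<Oplus>x y\<in>D h2. scale (w (mB p (mB (A (La h1 q) x) (A b y)))) ?u)"
      by (subst A_mB, subst lin_swt_out[of "\<lambda>x. scale (w (mB p x)) ?u"]) auto
    \<comment> \<open>Coassociativity puts the two elements acting on \<open>q\<close> under one
      coproduct, as \<open>A_La\<close> requires.\<close>
    also have "\<dots> = (\<Oplus>h1 h2\<in>D h. \<Oplus>x y\<in>D h1. scale (w (mB p (mB (A (La x q) y) (A b h2)))) ?u)"
      by (rule coass_D[symmetric]) (auto intro!: trilinI)
    also have "\<dots> = (\<Oplus>h1 h2\<in>D h. scale (w (mB p (mB (\<Oplus>x y\<in>D h1. A (La x q) y) (A b h2)))) ?u)"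
      by (subst lin_swt_out[of "\<lambda>x. scale (w (mB p (mB x (A b _)))) ?u"]) auto
    also have "\<dots> = scale (w (mB p (mB q (A b (\<Oplus>h1 h2\<in>D h. scale (ep h1) h2))))) ?u"
      by (subst lin_swt_out[of "\<lambda>x. scale (w (mB p (mB q (A b x)))) ?u"]) (auto simp: A_La)
    also have "\<dots> = scale (w (mB (La h (mB p q)) b)) ?u"
      by (simp add: counit_D1 w_adj mB_assoc)
    finally show "scale (w (mB (\<Oplus>h1 h2\<in>D h. mB (La h2 p) (La h1 q)) b)) ?u = scale (w (mB (La h (mB p q)) b)) ?u" .
  qed
  moreover have "(\<Oplus>h1 h2\<in>D h. mB (La h2 p) (La h1 q)) \<in> carr B"
    by (rule swt_mem[OF D_in subB]) (auto intro!: bilinI)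
  ultimately show ?thesis by simp
qed

subsection \<open>Coactions and products on triple tensors\<close>

lemma L_coass_D: "L.coass D"
  by (auto simp: L.coass_def coass_D lin_D)

text \<open>With \<open>rcoT X\<close> for \<open>r\<close> this is the coaction of \<Gamma>(X);
  with \<open>D\<close> it is the coproduct of \<open>H\<close>.\<close>

definition rho :: "(('k, 'i) vec \<Rightarrow> ('k, 'i) vec) \<Rightarrow> ('k, 'i) vec \<Rightarrow> ('k, 'i) vec"
  where "rho r z = (\<Oplus>a x b\<in>z. \<Oplus>x0 x1\<in>r x. \<Oplus>x11 x12\<in>D x1. \<Oplus>e1 e2\<in>e. (a \<otimes> x0 \<otimes> e1) \<otimes> (La x11 e2 \<otimes> x12 \<otimes> b))"

text \<open>The counit of \<open>H\<close> as an operator scaling \<open>v\<close>. The formula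
  avoids the inverse antipode; its agreement with the original counit is
  \<open>counit_form\<close>.\<close>

definition epH :: "('k, 'i) vec \<Rightarrow> ('k, 'i) vec \<Rightarrow> ('k, 'i) vec"
  where "epH u v = (\<Oplus>a h b\<in>u. scale (w (mB (A a h) b)) v)"

text \<open>Only the left coaction \<open>l\<close> of the first factor and the right coaction
  \<open>s\<close> of the second one enter. Taking \<open>D\<close> for both gives the product of
  \<open>H\<close> before multiplying out in \<open>L\<close>.\<close>

definition phi2 :: "(('k, 'i) vec \<Rightarrow> ('k, 'i) vec) \<Rightarrow> (('k, 'i) vec \<Rightarrow> ('k, 'i) vec) \<Rightarrow> ('k, 'i) vec \<Rightarrow> ('k, 'i) vec \<Rightarrow> ('k, 'i) vec"
  where "phi2 l s u v = (\<Oplus>a x b\<in>u. \<Oplus>a' x' b'\<in>v. \<Oplus>xm x0\<in>l x. \<Oplus>y0 y1\<in>s x'.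
    mB (La xm a') a \<otimes> (x0 \<otimes> y0) \<otimes> mB (A b y1) b')"

definition muH :: "('k, 'i) vec \<Rightarrow> ('k, 'i) vec \<Rightarrow> ('k, 'i) vec"
  where "muH u v = (\<Oplus>a h b\<in>u. \<Oplus>a' h' b'\<in>v. \<Oplus>h1 h2\<in>D h. \<Oplus>k1 k2\<in>D h'.
    mB (La h1 a') a \<otimes> mL h2 k1 \<otimes> mB (A b k2) b')"

definition muT :: "('k, 'i) vec \<Rightarrow> ('k, 'i) vec"
  where "muT z = (\<Oplus>h k\<in>z. mL h k)"

definition tensL :: "(('k, 'i) vec \<Rightarrow> ('k, 'i) vec) \<Rightarrow> (('k, 'i) vec \<Rightarrow> ('k, 'i) vec) \<Rightarrow> ('k, 'i) vec \<Rightarrow> ('k, 'i) vec"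
  where "tensL l l' z = (\<Oplus>x y\<in>z. \<Oplus>xm x0\<in>l x. \<Oplus>ym y0\<in>l' y. mL xm ym \<otimes> (x0 \<otimes> y0))"

lemma lin_rho [simp]: "lin f \<Longrightarrow> lin (\<lambda>x. rho r (f x))"
  unfolding rho_def by simp

lemma bilin_epH: "bilin epH"
  unfolding epH_def by (rule bilinI) simp_all

lemma bilin_phi2: "bilin (phi2 l s)"
  unfolding phi2_def by (rule bilinI) simp_all

lemma bilin_muH: "bilin muH"
  unfolding muH_def by (rule bilinI) simp_all

lemma lin_muT: "lin muT"
  unfolding muT_def[abs_def] by simp

lemma lin_tensL: "lin (tensL l l')"
  unfolding tensL_def[abs_def] by simp

lemmas linHs [simp] = bilin_comp1[OF bilin_epH] bilin_comp2[OF bilin_epH] bilin_comp1[OF bilin_muH] bilin_comp2[OF bilin_muH]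
  bilin_comp1[OF bilin_phi2] bilin_comp2[OF bilin_phi2] lin_comp[OF lin_muT] lin_comp[OF lin_tensL] lin_comp[OF lin_gmap]
  lin_comp[OF L.lin_tensR]

text \<open>A one-way instance of the exchange law, moving sums over \<open>e\<close> inside sums
  over \<open>D\<close>; as a rewrite rule the general law could undo its own steps.\<close>

lemma push_e: "(\<Oplus>e1 e2\<in>e. \<Oplus>s t\<in>D x. f e1 e2 s t) = (\<Oplus>s t\<in>D x. \<Oplus>e1 e2\<in>e. f e1 e2 s t)"
  by (rule swt_swap)

lemma rho_tens:
  assumes "lin r"
  shows "rho r (a \<otimes> x \<otimes> b) = (\<Oplus>x0 x1\<in>r x. \<Oplus>x11 x12\<in>D x1. \<Oplus>e1 e2\<in>e. (a \<otimes> x0 \<otimes> e1) \<otimes> (La x11 e2 \<otimes> x12 \<otimes> b))"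
  unfolding rho_def by (simp add: swt_simps lin_comp[OF assms])

lemma rho_expand:
  assumes "lin r"
  shows "rho r z = (\<Oplus>a x b\<in>z. rho r (a \<otimes> x \<otimes> b))"
  by (simp add: rho_tens[OF assms]) (simp add: rho_def)

lemma phi2_tens:
  assumes "lin l" "lin s"
  shows "phi2 l s (a \<otimes> x \<otimes> b) (a' \<otimes> x' \<otimes> b') = (\<Oplus>xm x0\<in>l x. \<Oplus>y0 y1\<in>s x'.
    mB (La xm a') a \<otimes> (x0 \<otimes> y0) \<otimes> mB (A b y1) b')"
  unfolding phi2_def by (simp add: swt_simps lin_comp[OF assms(1)] lin_comp[OF assms(2)])

lemma phi2_expand:
  assumes "lin l" "lin s"
  shows "phi2 l s u v = (\<Oplus>a x b\<in>u. \<Oplus>a' x' b'\<in>v. phi2 l s (a \<otimes> x \<otimes> b) (a' \<otimes> x' \<otimes> b'))"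
  by (simp add: phi2_tens[OF assms]) (simp add: phi2_def)

lemma muH_tens: "muH (a \<otimes> h \<otimes> b) (a' \<otimes> h' \<otimes> b') = (\<Oplus>h1 h2\<in>D h. \<Oplus>k1 k2\<in>D h'.
    mB (La h1 a') a \<otimes> mL h2 k1 \<otimes> mB (A b k2) b')"
  unfolding muH_def by (simp add: swt_simps)

lemma muH_phi2: "muH u v = gmap muT (phi2 D D u v)"
  unfolding muH_def gmap_def phi2_def by (simp add: swt_simps muT_def)

lemma epH_tens: "epH (a \<otimes> h \<otimes> b) v = scale (w (mB (A a h) b)) v"
  unfolding epH_def by (simp add: swt_simps)

text \<open>Two copies of \<open>e\<close> arise on each side and are merely carried along, in
  \<open>G\<close>. What remains is coassociativity of \<open>r\<close>, followed by that of
  \<open>D\<close>.\<close>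

lemma rho_coass:
  assumes r: "L.coass r" and F: "trilin F"
  shows "(\<Oplus>z0 z1\<in>rho r z. \<Oplus>u v\<in>rho r z0. F u v z1) = (\<Oplus>z0 z1\<in>rho r z. \<Oplus>u v\<in>rho D z1. F z0 u v)"
proof -
  note [simp] = L.coass_lin[OF r] trilin_comp1[OF F] trilin_comp2[OF F] trilin_comp3[OF F]
  define G where "G a b x p q s t = (\<Oplus>f1 f2\<in>e. \<Oplus>e1 e2\<in>e. F (a \<otimes> x \<otimes> f1) (La p f2 \<otimes> q \<otimes> e1) (La s e2 \<otimes> t \<otimes> b))" for a b x p q s t
  have [simp]: "lin f \<Longrightarrow> lin (\<lambda>u. G a b (f u) p q s t)" "lin f \<Longrightarrow> lin (\<lambda>u. G a b x (f u) q s t)"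
    "lin f \<Longrightarrow> lin (\<lambda>u. G a b x p (f u) s t)" "lin f \<Longrightarrow> lin (\<lambda>u. G a b x p q (f u) t)" "lin f \<Longrightarrow> lin (\<lambda>u. G a b x p q s (f u))"
    for f a b x p q s t by (simp_all add: G_def)
  have "(\<Oplus>z0 z1\<in>rho r z. \<Oplus>u v\<in>rho r z0. F u v z1)
    = (\<Oplus>a x b\<in>z. \<Oplus>x0 x1\<in>r x. \<Oplus>s t\<in>D x1. \<Oplus>x00 x01\<in>r x0. \<Oplus>p q\<in>D x01. G a b x00 p q s t)"
    by (simp add: rho_def swt_simps G_def swt_swap[of e "r _"] push_e) (subst (3) swt_swap, rule refl)
  also have "\<dots> = (\<Oplus>a x b\<in>z. \<Oplus>x0 x1\<in>r x. \<Oplus>x00 x01\<in>r x0. \<Oplus>s t\<in>D x1. \<Oplus>p q\<in>D x01. G a b x00 p q s t)"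
    by (subst swt_swap) (rule refl)
  also have "\<dots> = (\<Oplus>a x b\<in>z. \<Oplus>x0 x1\<in>r x. \<Oplus>x01 x1\<in>D x1. \<Oplus>s t\<in>D x1. \<Oplus>p q\<in>D x01. G a b x0 p q s t)"
    by (subst L.coassD[OF r]) (simp_all add: trilinI)
  also have "\<dots> = (\<Oplus>a x b\<in>z. \<Oplus>x0 x1\<in>r x. \<Oplus>x01 x1\<in>D x1. \<Oplus>p q\<in>D x01. \<Oplus>s t\<in>D x1. G a b x0 p q s t)"
    by (subst swt_swap) (rule refl)
  also have "\<dots> = (\<Oplus>a x b\<in>z. \<Oplus>x0 x1\<in>r x. \<Oplus>p x1\<in>D x1. \<Oplus>q x1\<in>D x1. \<Oplus>s t\<in>D x1. G a b x0 p q s t)"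
    by (subst coass_D) (simp_all add: trilinI)
  also have "\<dots> = (\<Oplus>z0 z1\<in>rho r z. \<Oplus>u v\<in>rho D z1. F z0 u v)"
    by (simp add: rho_def swt_simps G_def push_e)
  finally show ?thesis .
qed

text \<open>The two actions on the second leg of \<open>e\<close> cancel by \<open>A_La\<close>,
  leaving a counit of \<open>L\<close>; the dual basis property then returns
  \<open>b\<close>.\<close>

lemma rho_counit:
  assumes r: "lin r"
  shows "(\<Oplus>z0 z1\<in>rho r z. epH z1 z0) = (\<Oplus>a x b\<in>z. a \<otimes> L.cpart r x \<otimes> pB b)"
proof -
  have *: "(\<Oplus>x11 x12\<in>D x1. \<Oplus>e1 e2\<in>e. scale (w (mB (A (La x11 e2) x12) b)) (a \<otimes> x0 \<otimes> e1)) = a \<otimes> scale (ep x1) x0 \<otimes> pB b" for x1 x0 a b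
  proof -
    have "(\<Oplus>x11 x12\<in>D x1. \<Oplus>e1 e2\<in>e. scale (w (mB (A (La x11 e2) x12) b)) (a \<otimes> x0 \<otimes> e1))
      = (\<Oplus>e1 e2\<in>e. \<Oplus>x11 x12\<in>D x1. scale (w (mB (A (La x11 e2) x12) b)) (a \<otimes> x0 \<otimes> e1))"
      by (rule swt_swap)
    also have "\<dots> = (\<Oplus>e1 e2\<in>e. scale (w (mB (\<Oplus>x11 x12\<in>D x1. A (La x11 e2) x12) b)) (a \<otimes> x0 \<otimes> e1))"
      by (subst lin_swt_out[of "\<lambda>t. scale (w (mB t b)) (_ :: ('k, 'i) vec)"]) auto
    also have "\<dots> = a \<otimes> scale (ep x1) x0 \<otimes> (\<Oplus>e1 e2\<in>e. scale (w (mB e2 b)) e1)"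
      by (simp add: A_La swt_tens_right tens_scale_left tens_scale_right mult.commute flip: swt_scale_fun)
    finally show ?thesis by (simp add: e_w_right)
  qed
  show ?thesis
    by (simp add: rho_def swt_simps epH_tens * L.cpart_def)
qed

text \<open>Mirror image of the other counit law: the dual basis property first moves
  \<open>A a h1\<close> into the remaining leg of \<open>e\<close>, and \<open>La_A\<close> cancels
  the two actions.\<close>

lemma rho_counit_left: "(\<Oplus>z0 z1\<in>rho D z. epH z0 z1) = (\<Oplus>a h b\<in>z. pB a \<otimes> pL h \<otimes> b)"
proof -
  have 1: "(\<Oplus>e1 e2\<in>e. scale (w (mB (A a h1) e1)) (La h2 e2 \<otimes> h3 \<otimes> b)) = La h2 (A a h1) \<otimes> h3 \<otimes> b" for a b h1 h2 h3
  proof -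
    have "(\<Oplus>e1 e2\<in>e. scale (w (mB (A a h1) e1)) (La h2 e2 \<otimes> h3 \<otimes> b)) = La h2 (\<Oplus>e1 e2\<in>e. scale (w (mB (A a h1) e1)) e2) \<otimes> h3 \<otimes> b"
      by (subst lin_swt_out[of "\<lambda>t. La h2 t \<otimes> h3 \<otimes> b"]) (auto simp: tens_scale_left)
    then show ?thesis by (simp add: e_w_left)
  qed
  have 2: "(\<Oplus>h1 h'\<in>D h. \<Oplus>h2 h3\<in>D h'. La h2 (A a h1) \<otimes> h3 \<otimes> b) = pB a \<otimes> pL h \<otimes> b" for a h b
  proof -
    have "(\<Oplus>h1 h'\<in>D h. \<Oplus>h2 h3\<in>D h'. La h2 (A a h1) \<otimes> h3 \<otimes> b) = (\<Oplus>h1 h3\<in>D h. \<Oplus>h1 h2\<in>D h1. La h2 (A a h1) \<otimes> h3 \<otimes> b)"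
      by (rule coass_D[symmetric]) (simp add: trilinI)
    also have "\<dots> = (\<Oplus>h1 h3\<in>D h. (\<Oplus>h1 h2\<in>D h1. La h2 (A a h1)) \<otimes> h3 \<otimes> b)"
      by (simp add: swt_tens_left)
    also have "\<dots> = pB a \<otimes> (\<Oplus>h1 h3\<in>D h. scale (ep h1) h3) \<otimes> b"
      by (simp add: La_A swt_tens_left swt_tens_right tens_scale_left tens_scale_right)
    finally show ?thesis by (simp add: counit_D1)
  qed
  show ?thesis by (simp add: rho_def swt_simps epH_tens 1 2)
qed

text \<open>Serves twice, like \<open>phi2_natural\<close> below: for morphisms of (bi)comodules,
  and for the product of \<open>L\<close>, which turns facts about \<Gamma>(L) into facts about
  \<open>H\<close>.\<close>

lemma rho_natural:
  assumes "lin r" "lin r'" "lin F" "\<And>x. r' (F x) = (\<Oplus>x0 x1\<in>r x. F x0 \<otimes> x1)"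
  shows "rho r' (gmap F z) = (\<Oplus>w h\<in>rho r z. gmap F w \<otimes> h)"
proof -
  note [simp] = lin_comp[OF assms(1)] lin_comp[OF assms(2)] lin_comp[OF assms(3)]
  show ?thesis by (simp add: rho_def gmap_def swt_simps assms(4))
qed

lemma phi2_natural:
  assumes "lin l" "lin s" "lin l'" "lin s'" "lin F" "lin G" "\<And>x. l' (F x) = (\<Oplus>y x0\<in>l x. y \<otimes> F x0)" "\<And>x. s' (G x) = (\<Oplus>x0 x1\<in>s x. G x0 \<otimes> x1)"
  shows "phi2 l' s' (gmap F u) (gmap G v) = gmap (tmap F G) (phi2 l s u v)"
proof -
  note [simp] = lin_comp[OF assms(1)] lin_comp[OF assms(2)] lin_comp[OF assms(3)] lin_comp[OF assms(4)] lin_comp[OF assms(5)] lin_comp[OF assms(6)] lin_comp[OF lin_tmap]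
  show ?thesis by (simp add: phi2_def gmap_def tmap_def swt_simps assms(7,8))
qed

text \<open>Both sides are brought to the form \<open>?M\<close> with a single copy of
  \<open>e\<close>. Commutation of \<open>l\<close> with \<open>r\<close> separates the leg acting
  on \<open>a'\<close> from the coaction of \<open>x\<close>; coassociativity of \<open>s\<close>
  does the same for the leg acting on \<open>b\<close>.\<close>

lemma phi2_comodule_pure:
  assumes r: "L.coass r" and s: "L.coass s" and l: "lin l"
    and lr: "\<And>x F. trilin F \<Longrightarrow> (\<Oplus>y x0\<in>l x. \<Oplus>x00 z\<in>r x0. F y x00 z) = (\<Oplus>x0 z\<in>r x. \<Oplus>y x00\<in>l x0. F y x00 z)"
  shows "rho (L.tensR r s) (phi2 l s (a \<otimes> x \<otimes> b) (a' \<otimes> x' \<otimes> b')) =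
    (\<Oplus>u0 u1\<in>rho r (a \<otimes> x \<otimes> b). \<Oplus>v0 v1\<in>rho s (a' \<otimes> x' \<otimes> b'). phi2 l s u0 v0 \<otimes> muH u1 v1)"
proof -
  have lrs: "lin r" "lin s" using r s by (auto simp: L.coass_def)
  note [simp] = L.coass_lin[OF r] L.coass_lin[OF s] lin_comp[OF l]
  \<comment> \<open>Freezes the summand with its varying slots, so that only linearity in each slot
    is needed while sums are rearranged.\<close>
  define K where "K xm x0 y0 t g m k = (mB (La xm a') a \<otimes> (x0 \<otimes> y0) \<otimes> t) \<otimes> (g \<otimes> m \<otimes> mB (A b k) b')" for xm x0 y0 t g m k
  have [simp]: "lin f \<Longrightarrow> lin (\<lambda>u. K (f u) x0 y0 t g m k)" "lin f \<Longrightarrow> lin (\<lambda>u. K xm (f u) y0 t g m k)"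
    "lin f \<Longrightarrow> lin (\<lambda>u. K xm x0 (f u) t g m k)" "lin f \<Longrightarrow> lin (\<lambda>u. K xm x0 y0 (f u) g m k)" "lin f \<Longrightarrow> lin (\<lambda>u. K xm x0 y0 t (f u) m k)"
    "lin f \<Longrightarrow> lin (\<lambda>u. K xm x0 y0 t g (f u) k)" "lin f \<Longrightarrow> lin (\<lambda>u. K xm x0 y0 t g m (f u))"
    for f xm x0 y0 t g m k by (simp_all add: K_def)
  have "rho (L.tensR r s) (phi2 l s (a \<otimes> x \<otimes> b) (a' \<otimes> x' \<otimes> b'))
    = (\<Oplus>xm x0\<in>l x. \<Oplus>y0 y1\<in>s x'. \<Oplus>x00 x01\<in>r x0. \<Oplus>y00 y01\<in>s y0. \<Oplus>p1 p2\<in>D x01. \<Oplus>q1 q2\<in>D y01. \<Oplus>e1 e2\<in>e.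
        K xm x00 y00 e1 (La (mL p1 q1) e2) (mL p2 q2) y1)"
    by (simp add: phi2_tens[OF l lrs(2)] lin_swt_out[of "rho _"] rho_tens[OF L.lin_tensR] L.tensR_def swt_simps L.F_D_mul K_def)
  also have "\<dots> = (\<Oplus>xm x0\<in>l x. \<Oplus>x00 x01\<in>r x0. \<Oplus>y0 y1\<in>s x'. \<Oplus>y00 y01\<in>s y0. \<Oplus>p1 p2\<in>D x01. \<Oplus>q1 q2\<in>D y01. \<Oplus>e1 e2\<in>e.
        K xm x00 y00 e1 (La (mL p1 q1) e2) (mL p2 q2) y1)"
    by (subst swt_swap) (rule refl)
  also have "\<dots> = (\<Oplus>x0 x1\<in>r x. \<Oplus>xm x00\<in>l x0. \<Oplus>y0 y1\<in>s x'. \<Oplus>y00 y01\<in>s y0. \<Oplus>p1 p2\<in>D x1. \<Oplus>q1 q2\<in>D y01. \<Oplus>e1 e2\<in>e.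
        K xm x00 y00 e1 (La (mL p1 q1) e2) (mL p2 q2) y1)"
    by (rule lr) (simp add: trilinI)
  also have "\<dots> = (\<Oplus>x0 x1\<in>r x. \<Oplus>xm x00\<in>l x0. \<Oplus>y0 y1\<in>s x'. \<Oplus>y01 y02\<in>D y1. \<Oplus>p1 p2\<in>D x1. \<Oplus>q1 q2\<in>D y01. \<Oplus>e1 e2\<in>e.
        K xm x00 y0 e1 (La (mL p1 q1) e2) (mL p2 q2) y02)"
    by (subst L.coassD[OF s]) (simp_all add: trilinI)
  also have "\<dots> = (\<Oplus>x0 x1\<in>r x. \<Oplus>xm x00\<in>l x0. \<Oplus>y0 y1\<in>s x'. \<Oplus>p1 p2\<in>D x1. \<Oplus>y01 y02\<in>D y1. \<Oplus>q1 q2\<in>D y01. \<Oplus>e1 e2\<in>e.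
        K xm x00 y0 e1 (La (mL p1 q1) e2) (mL p2 q2) y02)"
    by (intro swt_cong refl swt_swap)
  also have "\<dots> = (\<Oplus>x0 x1\<in>r x. \<Oplus>xm x00\<in>l x0. \<Oplus>y0 y1\<in>s x'. \<Oplus>p1 p2\<in>D x1. \<Oplus>q1 y02\<in>D y1. \<Oplus>q2 y02\<in>D y02. \<Oplus>e1 e2\<in>e.
        K xm x00 y0 e1 (La (mL p1 q1) e2) (mL p2 q2) y02)" (is "_ = ?M")
    by (subst coass_D) (simp_all add: trilinI)
  finally have left: "rho (L.tensR r s) (phi2 l s (a \<otimes> x \<otimes> b) (a' \<otimes> x' \<otimes> b')) = ?M" .
  \<comment> \<open>\<open>La_mB\<close> read backwards: the actions of both legs of
    \<open>p\<close> combine into one action on the product.\<close>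
  have X: "(\<Oplus>p1 h1\<in>D p. K xm x00 y0 t (mB (La h1 Y) (La p1 e2)) m k) = K xm x00 y0 t (La p (mB Y e2)) m k" for xm x00 y0 t p Y e2 m k
    by (subst La_mB) (rule lin_swt_out[symmetric], simp)
  \<comment> \<open>Invariance moves the action of \<open>c\<close> from \<open>e1\<close> to
    \<open>e2\<close>, \<open>La_mB\<close> gathers both second legs under \<open>g\<close>, and
    idempotency merges the two copies of \<open>e\<close>.\<close>
  have Y: "(\<Oplus>c y11\<in>D g. \<Oplus>e1 e2\<in>e. \<Oplus>f1 f2\<in>e. K xm x00 y0 (mB (A e1 c) f1) (La p (mB (La y11 f2) e2)) m k)
     = (\<Oplus>e1 e2\<in>e. K xm x00 y0 e1 (La (mL p g) e2) m k)" for xm x00 y0 p g m k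
  proof -
    have "(\<Oplus>c y11\<in>D g. \<Oplus>e1 e2\<in>e. \<Oplus>f1 f2\<in>e. K xm x00 y0 (mB (A e1 c) f1) (La p (mB (La y11 f2) e2)) m k)
      = (\<Oplus>c y11\<in>D g. \<Oplus>e1 e2\<in>e. \<Oplus>f1 f2\<in>e. K xm x00 y0 (mB e1 f1) (La p (mB (La y11 f2) (La c e2))) m k)"
      by (intro swt_cong refl e_La[symmetric]) (simp add: bilinI)
    also have "\<dots> = (\<Oplus>e1 e2\<in>e. \<Oplus>f1 f2\<in>e. \<Oplus>c y11\<in>D g. K xm x00 y0 (mB e1 f1) (La p (mB (La y11 f2) (La c e2))) m k)"
      by (subst swt_swap) (intro swt_cong refl swt_swap)
    also have "\<dots> = (\<Oplus>e1 e2\<in>e. \<Oplus>f1 f2\<in>e. K xm x00 y0 (mB e1 f1) (La p (La g (mB f2 e2))) m k)"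
    proof (intro swt_cong refl)
      fix e1 e2 f1 f2
      show "(\<Oplus>c y11\<in>D g. K xm x00 y0 (mB e1 f1) (La p (mB (La y11 f2) (La c e2))) m k) = K xm x00 y0 (mB e1 f1) (La p (La g (mB f2 e2))) m k"
        by (subst La_mB[of g]) (rule lin_swt_out[of "\<lambda>z. K xm x00 y0 (mB e1 f1) (La p z) m k", symmetric], simp)
    qed
    also have "\<dots> = (\<Oplus>e1 e2\<in>e. K xm x00 y0 e1 (La p (La g e2)) m k)"
      by (rule e_idem) (simp add: bilinI)
    finally show ?thesis by (simp add: La_mul)
  qed
  have "(\<Oplus>u0 u1\<in>rho r (a \<otimes> x \<otimes> b). \<Oplus>v0 v1\<in>rho s (a' \<otimes> x' \<otimes> b'). phi2 l s u0 v0 \<otimes> muH u1 v1)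
    = (\<Oplus>x0 x1\<in>r x. \<Oplus>x11 x12\<in>D x1. \<Oplus>e1 e2\<in>e. \<Oplus>y0 y1\<in>s x'. \<Oplus>y11 y12\<in>D y1. \<Oplus>f1 f2\<in>e.
       \<Oplus>xm x00\<in>l x0. \<Oplus>y00 y01\<in>s y0. \<Oplus>h1 h2\<in>D x12. \<Oplus>k1 k2\<in>D y12.
       K xm x00 y00 (mB (A e1 y01) f1) (mB (La h1 (La y11 f2)) (La x11 e2)) (mL h2 k1) k2)"
    by (simp add: rho_tens[OF lrs(1)] rho_tens[OF lrs(2)] swt_simps phi2_tens[OF l lrs(2)] muH_tens K_def)
  \<comment> \<open>The following exchanges only bring together the sums on which a coassociativity
    law is to act.\<close>
  also have "\<dots> = (\<Oplus>x0 x1\<in>r x. \<Oplus>xm x00\<in>l x0. \<Oplus>x11 x12\<in>D x1. \<Oplus>y0 y1\<in>s x'. \<Oplus>y11 y12\<in>D y1. \<Oplus>h1 h2\<in>D x12. \<Oplus>k1 k2\<in>D y12. \<Oplus>y00 y01\<in>s y0. \<Oplus>e1 e2\<in>e. \<Oplus>f1 f2\<in>e. K xm x00 y00 (mB (A e1 y01) f1) (mB (La h1 (La y11 f2)) (La x11 e2)) (mL h2 k1) k2)"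
    by (simp add: swt_swap[of e "s _"] swt_swap[of e "l _"] push_e swt_swap[of "s _" "l _"] swt_swap[of "D _" "l _"])
       (simp add: swt_swap[of "s _" "D (x :: ('k, 'i) vec)" for x])
  also have "\<dots> = (\<Oplus>x0 x1\<in>r x. \<Oplus>xm x00\<in>l x0. \<Oplus>x11 x12\<in>D x1. \<Oplus>y0 y1\<in>s x'. \<Oplus>h1 h2\<in>D x12. \<Oplus>y11 y12\<in>D y1. \<Oplus>k1 k2\<in>D y12. \<Oplus>y00 y01\<in>s y0. \<Oplus>e1 e2\<in>e. \<Oplus>f1 f2\<in>e. K xm x00 y00 (mB (A e1 y01) f1) (mB (La h1 (La y11 f2)) (La x11 e2)) (mL h2 k1) k2)"
    by (intro swt_swap swt_fun_cong)
  also have "\<dots> = (\<Oplus>x0 x1\<in>r x. \<Oplus>xm x00\<in>l x0. \<Oplus>x11 x12\<in>D x1. \<Oplus>h1 h2\<in>D x12. \<Oplus>y0 y1\<in>s x'. \<Oplus>y11 y12\<in>D y1. \<Oplus>k1 k2\<in>D y12. \<Oplus>y00 y01\<in>s y0. \<Oplus>e1 e2\<in>e. \<Oplus>f1 f2\<in>e. K xm x00 y00 (mB (A e1 y01) f1) (mB (La h1 (La y11 f2)) (La x11 e2)) (mL h2 k1) k2)"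
    by (intro swt_swap swt_fun_cong)
  also have "\<dots> = (\<Oplus>x0 x1\<in>r x. \<Oplus>xm x00\<in>l x0. \<Oplus>x11 x12\<in>D x1. \<Oplus>h1 h2\<in>D x12. \<Oplus>y0 y1\<in>s x'. \<Oplus>y11 y12\<in>D y1. \<Oplus>y00 y01\<in>s y0. \<Oplus>k1 k2\<in>D y12. \<Oplus>e1 e2\<in>e. \<Oplus>f1 f2\<in>e. K xm x00 y00 (mB (A e1 y01) f1) (mB (La h1 (La y11 f2)) (La x11 e2)) (mL h2 k1) k2)"
    by (intro swt_swap swt_fun_cong)
  also have "\<dots> = (\<Oplus>x0 x1\<in>r x. \<Oplus>xm x00\<in>l x0. \<Oplus>x11 x12\<in>D x1. \<Oplus>h1 h2\<in>D x12. \<Oplus>y0 y1\<in>s x'. \<Oplus>y00 y01\<in>s y0. \<Oplus>y11 y12\<in>D y1. \<Oplus>k1 k2\<in>D y12. \<Oplus>e1 e2\<in>e. \<Oplus>f1 f2\<in>e. K xm x00 y00 (mB (A e1 y01) f1) (mB (La h1 (La y11 f2)) (La x11 e2)) (mL h2 k1) k2)"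
    by (intro swt_swap swt_fun_cong)
  \<comment> \<open>Coassociativity of \<open>s\<close>, then of \<open>D\<close>, lets the elements
    acting on \<open>e1\<close> and on \<open>f2\<close> be the two legs of one element
    \<open>g\<close>, as in \<open>Y\<close>.\<close>
  also have "\<dots> = (\<Oplus>x0 x1\<in>r x. \<Oplus>xm x00\<in>l x0. \<Oplus>x11 x12\<in>D x1. \<Oplus>h1 h2\<in>D x12. \<Oplus>y0 y1\<in>s x'. \<Oplus>y01 y1\<in>D y1. \<Oplus>y11 y12\<in>D y1. \<Oplus>k1 k2\<in>D y12. \<Oplus>e1 e2\<in>e. \<Oplus>f1 f2\<in>e. K xm x00 y0 (mB (A e1 y01) f1) (mB (La h1 (La y11 f2)) (La x11 e2)) (mL h2 k1) k2)"
    by (intro swt_fun_cong L.coassD[OF s]) (simp add: trilinI)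
  also have "\<dots> = (\<Oplus>x0 x1\<in>r x. \<Oplus>xm x00\<in>l x0. \<Oplus>x11 x12\<in>D x1. \<Oplus>h1 h2\<in>D x12. \<Oplus>y0 y1\<in>s x'. \<Oplus>g y12\<in>D y1. \<Oplus>y01 y11\<in>D g. \<Oplus>k1 k2\<in>D y12. \<Oplus>e1 e2\<in>e. \<Oplus>f1 f2\<in>e. K xm x00 y0 (mB (A e1 y01) f1) (mB (La h1 (La y11 f2)) (La x11 e2)) (mL h2 k1) k2)"
    by (intro swt_fun_cong coass_D[symmetric]) (simp add: trilinI)
  also have "\<dots> = (\<Oplus>x0 x1\<in>r x. \<Oplus>xm x00\<in>l x0. \<Oplus>p h2\<in>D x1. \<Oplus>x11 h1\<in>D p. \<Oplus>y0 y1\<in>s x'. \<Oplus>g y12\<in>D y1. \<Oplus>y01 y11\<in>D g. \<Oplus>k1 k2\<in>D y12. \<Oplus>e1 e2\<in>e. \<Oplus>f1 f2\<in>e. K xm x00 y0 (mB (A e1 y01) f1) (mB (La h1 (La y11 f2)) (La x11 e2)) (mL h2 k1) k2)"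
    by (intro swt_fun_cong coass_D[symmetric]) (simp add: trilinI)
  \<comment> \<open>The sum over \<open>D p\<close> is carried innermost, where \<open>X\<close>
    absorbs it.\<close>
  also have "\<dots> = (\<Oplus>x0 x1\<in>r x. \<Oplus>xm x00\<in>l x0. \<Oplus>p h2\<in>D x1. \<Oplus>y0 y1\<in>s x'. \<Oplus>g y12\<in>D y1. \<Oplus>y01 y11\<in>D g. \<Oplus>k1 k2\<in>D y12. \<Oplus>e1 e2\<in>e. \<Oplus>f1 f2\<in>e. \<Oplus>x11 h1\<in>D p. K xm x00 y0 (mB (A e1 y01) f1) (mB (La h1 (La y11 f2)) (La x11 e2)) (mL h2 k1) k2)"
    by (rule swt_fun_cong)+ ((rule trans[OF swt_swap], rule swt_fun_cong)+, rule refl)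
  also have "\<dots> = (\<Oplus>x0 x1\<in>r x. \<Oplus>xm x00\<in>l x0. \<Oplus>p h2\<in>D x1. \<Oplus>y0 y1\<in>s x'. \<Oplus>g y12\<in>D y1. \<Oplus>y01 y11\<in>D g. \<Oplus>k1 k2\<in>D y12. \<Oplus>e1 e2\<in>e. \<Oplus>f1 f2\<in>e. K xm x00 y0 (mB (A e1 y01) f1) (La p (mB (La y11 f2) e2)) (mL h2 k1) k2)"
    by (simp only: X)
  also have "\<dots> = (\<Oplus>x0 x1\<in>r x. \<Oplus>xm x00\<in>l x0. \<Oplus>p h2\<in>D x1. \<Oplus>y0 y1\<in>s x'. \<Oplus>g y12\<in>D y1. \<Oplus>k1 k2\<in>D y12. \<Oplus>y01 y11\<in>D g. \<Oplus>e1 e2\<in>e. \<Oplus>f1 f2\<in>e. K xm x00 y0 (mB (A e1 y01) f1) (La p (mB (La y11 f2) e2)) (mL h2 k1) k2)"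
    by (intro swt_swap swt_fun_cong)
  also have "\<dots> = (\<Oplus>x0 x1\<in>r x. \<Oplus>xm x00\<in>l x0. \<Oplus>p1 p2\<in>D x1. \<Oplus>y0 y1\<in>s x'. \<Oplus>q1 y02\<in>D y1. \<Oplus>q2 y02\<in>D y02. \<Oplus>e1 e2\<in>e.
        K xm x00 y0 e1 (La (mL p1 q1) e2) (mL p2 q2) y02)"
    by (simp only: Y)
  also have "\<dots> = ?M"
    by (intro swt_swap swt_fun_cong)
  finally show ?thesis using left by simp
qed

lemma phi2_comodule:
  assumes r: "L.coass r" and s: "L.coass s" and l: "lin l"
    and lr: "\<And>x F. trilin F \<Longrightarrow> (\<Oplus>y x0\<in>l x. \<Oplus>x00 z\<in>r x0. F y x00 z) = (\<Oplus>x0 z\<in>r x. \<Oplus>y x00\<in>l x0. F y x00 z)"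
  shows "rho (L.tensR r s) (phi2 l s u v) = (\<Oplus>u0 u1\<in>rho r u. \<Oplus>v0 v1\<in>rho s v. phi2 l s u0 v0 \<otimes> muH u1 v1)"
proof -
  have lrs: "lin r" "lin s" using r s by (auto simp: L.coass_def)
  have "rho (L.tensR r s) (phi2 l s u v) = (\<Oplus>a x b\<in>u. \<Oplus>a' x' b'\<in>v. rho (L.tensR r s) (phi2 l s (a \<otimes> x \<otimes> b) (a' \<otimes> x' \<otimes> b')))"
    by (subst phi2_expand[OF l lrs(2)]) (simp only: lin_swt3_out[OF lin_rho[OF lin_id]])
  also have "\<dots> = (\<Oplus>a x b\<in>u. \<Oplus>a' x' b'\<in>v. \<Oplus>u0 u1\<in>rho r (a \<otimes> x \<otimes> b). \<Oplus>v0 v1\<in>rho s (a' \<otimes> x' \<otimes> b'). phi2 l s u0 v0 \<otimes> muH u1 v1)"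
    by (simp only: phi2_comodule_pure[OF assms])
  also have "\<dots> = (\<Oplus>u0 u1\<in>rho r u. \<Oplus>v0 v1\<in>rho s v. phi2 l s u0 v0 \<otimes> muH u1 v1)"
    unfolding rho_expand[OF lrs(1), of u] rho_expand[OF lrs(2), of v] swt_comp3 swt_swap3 by (rule swt3_swap)
  finally show ?thesis .
qed

text \<open>Multiplicativity of the coproduct of \<open>L\<close>, read as right colinearity of its
  multiplication. \<open>D_muT_left\<close> is the left version; together they admit
  \<open>muT\<close> in the naturality lemmas.\<close>

lemma D_muT: "D (muT z) = (\<Oplus>w h\<in>L.tensR D D z. muT w \<otimes> h)"
  by (simp add: muT_def L.tensR_def lin_swt_out[OF lin_D] D_mul swt_simps)

lemma D_muT_left: "D (muT z) = (\<Oplus>h w\<in>tensL D D z. h \<otimes> muT w)"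
  by (simp add: muT_def tensL_def lin_swt_out[OF lin_D] D_mul swt_simps)

lemma rho_muH: "rho D (muH u v) = (\<Oplus>u1 u2\<in>rho D u. \<Oplus>v1 v2\<in>rho D v. muH u1 v1 \<otimes> muH u2 v2)"
proof -
  have "rho D (muH u v) = (\<Oplus>w h\<in>rho (L.tensR D D) (phi2 D D u v). gmap muT w \<otimes> h)"
    unfolding muH_phi2 by (rule rho_natural) (auto simp: lin_D L.lin_tensR lin_muT D_muT)
  also have "rho (L.tensR D D) (phi2 D D u v) = (\<Oplus>u0 u1\<in>rho D u. \<Oplus>v0 v1\<in>rho D v. phi2 D D u0 v0 \<otimes> muH u1 v1)"
    by (rule phi2_comodule) (simp_all add: L_coass_D lin_D coass_D)
  finally show ?thesis by (simp add: swt_simps) (simp add: muH_phi2)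
qed

text \<open>On the left leg, coassociativity of \<open>l\<close> matches \<open>La_mB\<close>; on
  the right leg, coassociativity of \<open>t\<close> matches \<open>A_mB\<close>. The middle factor
  is coacted on from both sides, and there the two coactions have to commute.\<close>

lemma phi2_assoc:
  assumes l: "lin l" and l': "lin l'" and s: "lin s" and t: "L.coass t"
    and ll: "\<And>x F. trilin F \<Longrightarrow> (\<Oplus>y x0\<in>l x. \<Oplus>z x00\<in>l x0. F y z x00) = (\<Oplus>y x0\<in>l x. \<Oplus>y1 y2\<in>D y. F y1 y2 x0)"
    and ls: "\<And>x F. trilin F \<Longrightarrow> (\<Oplus>y x0\<in>l' x. \<Oplus>x00 z\<in>s x0. F y x00 z) = (\<Oplus>x0 z\<in>s x. \<Oplus>y x00\<in>l' x0. F y x00 z)"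
  shows "gmap L.assocm (phi2 (tensL l l') t (phi2 l s u v) v3) = phi2 l (L.tensR s t) u (phi2 l' t v v3)"
proof -
  note [simp] = lin_comp[OF l] lin_comp[OF l'] lin_comp[OF s] L.coass_lin[OF t] lin_comp[OF L.lin_assocm]
  have lt: "lin t" using t by (simp add: L.coass_def)
  have pure: "gmap L.assocm (phi2 (tensL l l') t (phi2 l s (a \<otimes> x \<otimes> b) (a' \<otimes> y \<otimes> b')) (a'' \<otimes> z \<otimes> b''))
      = phi2 l (L.tensR s t) (a \<otimes> x \<otimes> b) (phi2 l' t (a' \<otimes> y \<otimes> b') (a'' \<otimes> z \<otimes> b''))" for a x b a' y b' a'' z b''
  proof -
    define K where "K x0 y0 z0 p q = p \<otimes> (x0 \<otimes> (y0 \<otimes> z0)) \<otimes> q" for x0 y0 z0 p q :: "('k, 'i) vec"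
    have [simp]: "lin f \<Longrightarrow> lin (\<lambda>u. K (f u) y0 z0 p q)" "lin f \<Longrightarrow> lin (\<lambda>u. K x0 (f u) z0 p q)" "lin f \<Longrightarrow> lin (\<lambda>u. K x0 y0 (f u) p q)"
      "lin f \<Longrightarrow> lin (\<lambda>u. K x0 y0 z0 (f u) q)" "lin f \<Longrightarrow> lin (\<lambda>u. K x0 y0 z0 p (f u))" for f x0 y0 z0 p q
      by (simp_all add: K_def)
    \<comment> \<open>Combines the successive left actions: the anti-multiplicative order of legs in
      \<open>La_mB\<close> is the one that \<phi> produces.\<close>
    have X: "(\<Oplus>p1 p2\<in>D g. K x0 y0 z0 (mB (La (mL p2 ym) a'') (mB (La p1 a') a)) q) = K x0 y0 z0 (mB (La g (mB (La ym a'') a')) a) q" for g x0 y0 z0 ym q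
      by (subst La_mB) (subst lin_swt_out[of "\<lambda>p. K x0 y0 z0 (mB p a) q"], simp, simp add: La_mul mB_assoc)
    \<comment> \<open>The corresponding expansion of a right action on a product in
      \<open>B\<close>.\<close>
    have Z: "(\<Oplus>c d\<in>D g. K x0 y0 z0 p (mB (A b (mL y1 c)) (mB (A b' d) b''))) = K x0 y0 z0 p (mB (A (mB (A b y1) b') g) b'')" for g x0 y0 z0 p y1
      by (subst A_mB) (subst lin_swt_out[of "\<lambda>q. K x0 y0 z0 p (mB q b'')"], simp, simp add: A_mul mB_assoc)
    have "gmap L.assocm (phi2 (tensL l l') t (phi2 l s (a \<otimes> x \<otimes> b) (a' \<otimes> y \<otimes> b')) (a'' \<otimes> z \<otimes> b''))
      = (\<Oplus>xm x0\<in>l x. \<Oplus>y0 y1\<in>s y. \<Oplus>xm' x00\<in>l x0. \<Oplus>ym y00\<in>l' y0. \<Oplus>z0 z1\<in>t z.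
          K x00 y00 z0 (mB (La (mL xm' ym) a'') (mB (La xm a') a)) (mB (A (mB (A b y1) b') z1) b''))"
      by (simp add: phi2_def gmap_def tensL_def L.assocm_def swt_simps K_def)
    also have "\<dots> = (\<Oplus>xm x0\<in>l x. \<Oplus>xm' x00\<in>l x0. \<Oplus>y0 y1\<in>s y. \<Oplus>ym y00\<in>l' y0. \<Oplus>z0 z1\<in>t z.
          K x00 y00 z0 (mB (La (mL xm' ym) a'') (mB (La xm a') a)) (mB (A (mB (A b y1) b') z1) b''))"
      by (intro swt_swap swt_fun_cong)
    also have "\<dots> = (\<Oplus>g x0\<in>l x. \<Oplus>p1 p2\<in>D g. \<Oplus>y0 y1\<in>s y. \<Oplus>ym y00\<in>l' y0. \<Oplus>z0 z1\<in>t z.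
          K x0 y00 z0 (mB (La (mL p2 ym) a'') (mB (La p1 a') a)) (mB (A (mB (A b y1) b') z1) b''))"
      by (rule ll) (simp add: trilinI)
    also have "\<dots> = (\<Oplus>g x0\<in>l x. \<Oplus>y0 y1\<in>s y. \<Oplus>ym y00\<in>l' y0. \<Oplus>z0 z1\<in>t z. \<Oplus>p1 p2\<in>D g.
          K x0 y00 z0 (mB (La (mL p2 ym) a'') (mB (La p1 a') a)) (mB (A (mB (A b y1) b') z1) b''))"
      by (rule swt_fun_cong) ((rule trans[OF swt_swap], rule swt_fun_cong)+, rule refl)
    also have "\<dots> = (\<Oplus>g x0\<in>l x. \<Oplus>y0 y1\<in>s y. \<Oplus>ym y00\<in>l' y0. \<Oplus>z0 z1\<in>t z. \<Oplus>c d\<in>D z1.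
          K x0 y00 z0 (mB (La g (mB (La ym a'') a')) a) (mB (A b (mL y1 c)) (mB (A b' d) b'')))"
      by (simp only: X Z)
    also have "\<dots> = (\<Oplus>g x0\<in>l x. \<Oplus>y0 y1\<in>s y. \<Oplus>ym y00\<in>l' y0. \<Oplus>z0 z1\<in>t z. \<Oplus>z00 z01\<in>t z0.
          K x0 y00 z00 (mB (La g (mB (La ym a'') a')) a) (mB (A b (mL y1 z01)) (mB (A b' z1) b'')))"
      by (intro swt_fun_cong L.coassD[OF t, symmetric]) (simp add: trilinI)
    also have "\<dots> = (\<Oplus>g x0\<in>l x. \<Oplus>ym y0\<in>l' y. \<Oplus>y00 y1\<in>s y0. \<Oplus>z0 z1\<in>t z. \<Oplus>z00 z01\<in>t z0.
          K x0 y00 z00 (mB (La g (mB (La ym a'') a')) a) (mB (A b (mL y1 z01)) (mB (A b' z1) b'')))"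
      by (intro swt_fun_cong ls[symmetric]) (simp add: trilinI)
    also have "\<dots> = (\<Oplus>ym y0\<in>l' y. \<Oplus>g x0\<in>l x. \<Oplus>y00 y1\<in>s y0. \<Oplus>z0 z1\<in>t z. \<Oplus>z00 z01\<in>t z0.
          K x0 y00 z00 (mB (La g (mB (La ym a'') a')) a) (mB (A b (mL y1 z01)) (mB (A b' z1) b'')))"
      by (rule swt_swap)
    also have "\<dots> = (\<Oplus>ym y0\<in>l' y. \<Oplus>g x0\<in>l x. \<Oplus>z0 z1\<in>t z. \<Oplus>y00 y1\<in>s y0. \<Oplus>z00 z01\<in>t z0.
          K x0 y00 z00 (mB (La g (mB (La ym a'') a')) a) (mB (A b (mL y1 z01)) (mB (A b' z1) b'')))"
      by (intro swt_swap swt_fun_cong)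
    also have "\<dots> = (\<Oplus>ym y0\<in>l' y. \<Oplus>z0 z1\<in>t z. \<Oplus>g x0\<in>l x. \<Oplus>y00 y1\<in>s y0. \<Oplus>z00 z01\<in>t z0.
          K x0 y00 z00 (mB (La g (mB (La ym a'') a')) a) (mB (A b (mL y1 z01)) (mB (A b' z1) b'')))"
      by (intro swt_swap swt_fun_cong)
    also have "\<dots> = phi2 l (L.tensR s t) (a \<otimes> x \<otimes> b) (phi2 l' t (a' \<otimes> y \<otimes> b') (a'' \<otimes> z \<otimes> b''))"
      by (simp add: phi2_def L.tensR_def swt_simps K_def)
    finally show ?thesis .
  qed
  \<comment> \<open>Both sides are trilinear in \<open>u\<close>, \<open>v\<close>,
    \<open>v3\<close>; these expansions reduce them to the pure tensors treated above.\<close>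
  have 1: "phi2 (tensL l l') t u' v3 = (\<Oplus>a x b\<in>v3. phi2 (tensL l l') t u' (a \<otimes> x \<otimes> b))" for u'
    unfolding phi2_def by (subst swt3_swap) (simp add: swt_simps)
  have 2: "phi2 l (L.tensR s t) u v' = (\<Oplus>a x b\<in>u. phi2 l (L.tensR s t) (a \<otimes> x \<otimes> b) v')" for v'
    by (simp add: phi2_def swt_simps)
  have p: "phi2 l s u v = (\<Oplus>a x b\<in>u. \<Oplus>a' y b'\<in>v. phi2 l s (a \<otimes> x \<otimes> b) (a' \<otimes> y \<otimes> b'))"
    "phi2 l' t v v3 = (\<Oplus>a' y b'\<in>v. \<Oplus>a'' z b''\<in>v3. phi2 l' t (a' \<otimes> y \<otimes> b') (a'' \<otimes> z \<otimes> b''))"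
    by (rule phi2_expand[OF l s], rule phi2_expand[OF l' lt])
  have "gmap L.assocm (phi2 (tensL l l') t (phi2 l s u v) v3) = (\<Oplus>a x b\<in>u. \<Oplus>a' y b'\<in>v. \<Oplus>a'' z b''\<in>v3.
      gmap L.assocm (phi2 (tensL l l') t (phi2 l s (a \<otimes> x \<otimes> b) (a' \<otimes> y \<otimes> b')) (a'' \<otimes> z \<otimes> b'')))"
    by (subst p(1)) (simp only: lin_swt3_out[OF bilin_comp1[OF bilin_phi2 lin_id]] lin_swt3_out[OF lin_gmap] 1[of "phi2 _ _ _ _"])
  also have "\<dots> = (\<Oplus>a x b\<in>u. phi2 l (L.tensR s t) (a \<otimes> x \<otimes> b) (phi2 l' t v v3))"
    by (subst p(2)) (simp only: pure lin_swt3_out[OF bilin_comp2[OF bilin_phi2 lin_id]])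
  finally show ?thesis by (simp only: 2[symmetric])
qed

subsection \<open>The weak bialgebra structure\<close>

abbreviation "H \<equiv> qtg L B act e \<omega>"

lemma carr_H: "carr H = carr B \<otimes>\<^sub>S carr L \<otimes>\<^sub>S carr B"
  by (simp add: qtg_def)

lemma subH: "ksubspace (carr H)"
  by (simp add: carr_H subspace_tensS)

lemma lact_eq: "h \<in> carr L \<Longrightarrow> a \<in> carr B \<Longrightarrow> lact L act h a = La h a"
  by (simp add: lact_def A_eq SL_eq La_def)

lemma mul_H: "u \<in> carr H \<Longrightarrow> v \<in> carr H \<Longrightarrow> mul H u v = muH u v"
  unfolding carr_H unfolding qtg_def hopf.simps alg.simps muH_def
  by (auto intro!: sw3_swt3 sw_swt trilinI bilinI simp: subB subL D_in lact_eq mB_eq mL_eq A_eq D_eq)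

lemma cop_H: "u \<in> carr H \<Longrightarrow> cop H u = rho D u"
  unfolding carr_H unfolding qtg_def hopf.simps alg.simps rho_def
  by (auto intro!: sw3_swt3 sw_swt trilinI bilinI simp: subB subL D_in e_in lact_eq D_eq)

text \<open>
  Since \<open>\<omega>\<close> intertwines the two actions, the inverse of the antipode disappears from the counit of \<open>H\<close>.
\<close>

lemma counit_form:
  assumes "a \<in> carr B" "b \<in> carr B" "h \<in> carr L"
  shows "\<omega> (mul B a (act b (antp_inv L h))) = w (mB (A a h) b)"
proof -
  have bij: "inj_on (antp L) (carr L)" "h \<in> antp L ` carr L" using data assms(3) by (auto simp: qtg_data_def bij_betw_def)
  define k where "k = antp_inv L h"
  have k: "k \<in> carr L" "antp L k = h"
    using the_inv_into_into[OF bij subset_refl] f_the_inv_into_f[OF bij] by (auto simp: k_def)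
  have "\<omega> (mul B a (act b k)) = w (mB a (A b k))" using k assms by (simp add: A_eq mB_eq w_eq)
  also have "\<dots> = w (mB (La k a) b)" by (rule w_adj[symmetric])
  also have "\<dots> = w (mB (A a h) b)" using k by (simp add: La_def SL_eq[symmetric])
  finally show ?thesis by (simp add: k_def)
qed

lemma cou_H: "u \<in> carr H \<Longrightarrow> scale (cou H u) v = epH u v"
  unfolding carr_H unfolding qtg_def hopf.simps alg.simps epH_def scale_sw3
  by (rule sw3_swt3) (auto intro!: trilinI simp: subB subL counit_form)

lemma muH_in: "u \<in> carr H \<Longrightarrow> v \<in> carr H \<Longrightarrow> muH u v \<in> carr H"
  unfolding carr_H muH_def
  by (intro swt3_mem[of u "carr B" "carr L" "carr B"] swt3_mem[of v "carr B" "carr L" "carr B"] swt_mem[OF D_in] subspace_tensS trilinI bilinI tens_in_tensS)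
    simp_all

lemma rho_in:
  assumes z: "z \<in> carr B \<otimes>\<^sub>S X \<otimes>\<^sub>S carr B" and r: "lin r" "\<And>x. x \<in> X \<Longrightarrow> r x \<in> X \<otimes>\<^sub>S carr L"
  shows "rho r z \<in> (carr B \<otimes>\<^sub>S X \<otimes>\<^sub>S carr B) \<otimes>\<^sub>S carr H"
  unfolding carr_H rho_def
proof (rule swt3_mem[OF z subspace_tensS])
  note [simp] = lin_comp[OF r(1)]
  fix a x b assume "a \<in> carr B" "x \<in> X" "b \<in> carr B"
  then show "(\<Oplus>x0 x1\<in>r x. \<Oplus>x11 x12\<in>D x1. \<Oplus>e1 e2\<in>e. (a \<otimes> x0 \<otimes> e1) \<otimes> La x11 e2 \<otimes> x12 \<otimes> b)
    \<in> (carr B \<otimes>\<^sub>S X \<otimes>\<^sub>S carr B) \<otimes>\<^sub>S carr B \<otimes>\<^sub>S carr L \<otimes>\<^sub>S carr B"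
    by (intro swt_mem[OF r(2)] swt_mem[OF D_in] swt_mem[OF e_in] subspace_tensS bilinI tens_in_tensS) simp_all
qed (simp add: trilinI lin_comp[OF r(1)])

lemma rho_D_in: "z \<in> carr H \<Longrightarrow> rho D z \<in> carr H \<otimes>\<^sub>S carr H"
  using rho_in[of z "carr L" D] by (simp add: carr_H lin_D D_in)

lemma muH_assoc:
  assumes "u \<in> carr H" "v \<in> carr H" "x \<in> carr H"
  shows "muH (muH u v) x = muH u (muH v x)"
proof -
  note [simp] = lin_comp[OF lin_tmap] lin_comp[OF L.lin_assocm]
  \<comment> \<open>The identity map is inserted on \<open>x\<close> so that naturality of \<phi>
    applies to the pair \<open>muT\<close> and identity.\<close>
  have "muH (muH u v) x = gmap muT (phi2 D D (gmap muT (phi2 D D u v)) (gmap (\<lambda>x. x) x))"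
    using assms(3) by (simp add: muH_phi2 gmap_id carr_H)
  also have "phi2 D D (gmap muT (phi2 D D u v)) (gmap (\<lambda>x. x) x) = gmap (tmap muT (\<lambda>x. x)) (phi2 (tensL D D) D (phi2 D D u v) x)"
    by (rule phi2_natural) (auto simp: lin_D lin_tensL lin_muT lin_id D_muT_left swt_id[OF D_in])
  \<comment> \<open>Associativity of the product of \<open>L\<close> enters here.\<close>
  also have "gmap muT \<dots> = gmap (\<lambda>z. muT (tmap (\<lambda>x. x) muT (L.assocm z))) (phi2 (tensL D D) D (phi2 D D u v) x)"
    by (subst gmap_gmap) (auto simp: lin_muT lin_tmap tmap_def muT_def L.assocm_def swt_simps mL_assoc lin_swt_out[of "mL _"] lin_swt_out[of "\<lambda>x. mL x _"]
        simp del: L.mul_assoc)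
  also have "\<dots> = gmap muT (gmap (tmap (\<lambda>x. x) muT) (gmap L.assocm (phi2 (tensL D D) D (phi2 D D u v) x)))"
    by (simp add: gmap_gmap lin_muT lin_tmap L.lin_assocm)
  also have "gmap L.assocm (phi2 (tensL D D) D (phi2 D D u v) x) = phi2 D (L.tensR D D) u (phi2 D D v x)"
    by (rule phi2_assoc) (auto simp: lin_D L_coass_D coass_D)
  also have "gmap (tmap (\<lambda>x. x) muT) \<dots> = phi2 D D (gmap (\<lambda>x. x) u) (gmap muT (phi2 D D v x))"
    by (rule phi2_natural[symmetric]) (auto simp: lin_D L.lin_tensR lin_muT lin_id D_muT swt_id[OF D_in])
  also have "gmap muT \<dots> = muH u (muH v x)"
    using assms(1) by (simp add: muH_phi2 gmap_id carr_H)
  finally show ?thesis .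
qed

lemma pH_in [simp]: "proj (carr H) x \<in> carr H"
  by (rule proj_in[OF subH])

lemma mulT_H: "mulT H u v = muH (proj (carr H) u) (proj (carr H) v)"
  by (simp add: mulT_def mul_H)

lemma copT_H: "copT H u = rho D (proj (carr H) u)"
  by (simp add: copT_def cop_H)

lemma couT_H: "scale (couT H u) v = epH (proj (carr H) u) v"
  by (simp add: couT_def cou_H)

lemma swt_cou_H: "z \<in> V \<otimes>\<^sub>S carr H \<Longrightarrow> (\<Oplus>x0 x1\<in>z. scale (couT H x1) x0) = (\<Oplus>x0 x1\<in>z. epH x1 x0)"
  unfolding couT_H by (rule swt_cong_on) (auto intro!: bilinI simp: lin_proj[OF subH] proj_id[OF subH])

text \<open>Makes the comodule theory above available for the weak Hopf algebra, in particular the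
  products of comodules over \<open>H\<close>.\<close>

sublocale H: bialg H
proof
  show "ksubspace (carr H)" by (rule subH)
  show "bilinear_on (carr H) (carr H) (carr H) (mul H)"
    using subH bilin_muH by (auto simp: bilinear_on_def linear_on_def mul_H muH_in kv.subspace_def bilin_def lin_def)
  show "mulT H (mulT H x y) z = mulT H x (mulT H y z)" for x y z
    by (simp add: mulT_H proj_id[OF subH muH_in] muH_assoc)
  show "linear_on (carr H) (carr H \<otimes>\<^sub>S carr H) (cop H)"
    using subH lin_rho[OF lin_id, of D] by (auto simp: linear_on_def cop_H rho_D_in kv.subspace_def lin_def)
  show "functional_on (carr H) (cou H)"
    unfolding functional_on_def
  proof (intro conjI ballI allI)
    note b = bilin_comp1[OF bilin_epH lin_id]
    fix u v c assume u: "u \<in> carr H"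
    \<comment> \<open>The counit is known only through its multiples \<open>epH u v\<close>, so its
      values are compared along \<open>unitv\<close>.\<close>
    have "scale (cou H (scale c u)) unitv = scale (c * cou H u) (unitv :: ('k, 'i) vec)"
      using u subH by (simp add: cou_H linD[OF b] kv.subspace_def flip: kv.scale_scale)
    then show "cou H (scale c u) = c * cou H u" unfolding scale_unitv_eq .
    assume v: "v \<in> carr H"
    have "scale (cou H (u + v)) unitv = scale (cou H u + cou H v) (unitv :: ('k, 'i) vec)"
      using u v subH by (simp add: cou_H linD[OF b] kv.subspace_def kv.scale_left_distrib)
    then show "cou H (u + v) = cou H u + cou H v" unfolding scale_unitv_eq .
  qed
  show "(\<Oplus>x1 x2\<in>copT H x. scale (couT H x1) x2) = proj (carr H) x" for x
  proof -
    have "(\<Oplus>x1 x2\<in>copT H x. scale (couT H x1) x2) = (\<Oplus>x1 x2\<in>copT H x. epH x1 x2)"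
      unfolding couT_H copT_H by (rule swt_cong_on[OF rho_D_in]) (auto intro!: bilinI simp: lin_proj[OF subH] proj_id[OF subH])
    also have "\<dots> = (\<Oplus>a h b\<in>proj (carr H) x. pB a \<otimes> pL h \<otimes> b)" unfolding copT_H by (rule rho_counit_left)
    also have "\<dots> = (\<Oplus>a h b\<in>proj (carr H) x. a \<otimes> h \<otimes> b)"
      by (rule swt3_cong_on[of _ "carr B" "carr L" "carr B"]) (auto simp: trilinI simp flip: carr_H)
    also have "\<dots> = proj (carr H) x" by (rule swt_id3[of _ "carr B" "carr L" "carr B"]) (simp flip: carr_H)
    finally show ?thesis .
  qed
  show "copT H (mulT H x y) = (\<Oplus>x1 x2\<in>copT H x. \<Oplus>y1 y2\<in>copT H y. mulT H x1 y1 \<otimes> mulT H x2 y2)" for x y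
  proof -
    have "copT H (mulT H x y) = (\<Oplus>u1 u2\<in>copT H x. \<Oplus>v1 v2\<in>copT H y. muH u1 v1 \<otimes> muH u2 v2)"
      by (simp add: copT_H mulT_H proj_id[OF subH muH_in] rho_muH)
    also have "\<dots> = (\<Oplus>x1 x2\<in>copT H x. \<Oplus>y1 y2\<in>copT H y. mulT H x1 y1 \<otimes> mulT H x2 y2)"
      unfolding copT_H mulT_H
      by (rule swt_cong_on[OF rho_D_in]; (rule pH_in | rule swt_cong_on[OF rho_D_in] | rule bilinI)?)
        (auto intro!: bilinI swt_cong_on[OF rho_D_in] simp: lin_proj[OF subH] proj_id[OF subH])
    finally show ?thesis .
  qed
qed

subsection \<open>The functor and its monoidal structure\<close>

abbreviation "\<Gamma> \<equiv> Gamma_obj L B act e"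
abbreviation "\<Gamma>A \<equiv> FA (Gamma L B act e)"

lemma Gamma_sp: "sp (\<Gamma> X) = carr B \<otimes>\<^sub>S sp X \<otimes>\<^sub>S carr B"
  by (simp add: Gamma_obj_def)

lemma rho_cong:
  assumes z: "z \<in> carr B \<otimes>\<^sub>S V \<otimes>\<^sub>S carr B" and r: "lin r" "lin s" "\<And>x. x \<in> V \<Longrightarrow> r x = s x"
  shows "rho r z = rho s z"
proof -
  note [simp] = lin_comp[OF r(1)] lin_comp[OF r(2)]
  show ?thesis unfolding rho_def by (rule swt3_cong_on[OF z]) (auto intro!: trilinI simp: r(3))
qed

lemma phi2_cong:
  assumes u: "u \<in> carr B \<otimes>\<^sub>S V \<otimes>\<^sub>S carr B" and v: "v \<in> carr B \<otimes>\<^sub>S W \<otimes>\<^sub>S carr B"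
    and l: "lin l" "lin l'" "\<And>x. x \<in> V \<Longrightarrow> l x = l' x" and r: "lin r" "lin s" "\<And>x. x \<in> W \<Longrightarrow> r x = s x"
  shows "phi2 l r u v = phi2 l' s u v"
proof -
  note [simp] = lin_comp[OF r(1)] lin_comp[OF r(2)] lin_comp[OF l(1)] lin_comp[OF l(2)]
  show ?thesis unfolding phi2_def
    by (rule swt3_cong_on[OF u]; (rule trilinI)?) (auto intro!: swt3_cong_on[OF v] trilinI simp: r(3) l(3))
qed

lemma phi2_in:
  assumes u: "u \<in> carr B \<otimes>\<^sub>S V \<otimes>\<^sub>S carr B" and v: "v \<in> carr B \<otimes>\<^sub>S W \<otimes>\<^sub>S carr B"
    and l: "lin l" "\<And>x. x \<in> V \<Longrightarrow> l x \<in> carr L \<otimes>\<^sub>S V" and r: "lin r" "\<And>x. x \<in> W \<Longrightarrow> r x \<in> W \<otimes>\<^sub>S carr L"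
  shows "phi2 l r u v \<in> carr B \<otimes>\<^sub>S (V \<otimes>\<^sub>S W) \<otimes>\<^sub>S carr B"
proof -
  note [simp] = lin_comp[OF r(1)] lin_comp[OF l(1)]
  show ?thesis unfolding phi2_def
    by (intro swt3_mem[OF u] swt3_mem[OF v] swt_mem[OF l(2)] swt_mem[OF r(2)] subspace_tensS trilinI bilinI tens_in_tensS) simp_all
qed

lemma
  assumes X: "is_right_comodule L X"
  shows Gamma_comodule: "is_right_comodule H (\<Gamma> X)"
    and rcoT_Gamma: "z \<in> sp (\<Gamma> X) \<Longrightarrow> rcoT (\<Gamma> X) z = rho (rcoT X) z"
proof -
  note s = L.comodule_sub[OF X] and r = L.lin_rcoT[OF X] and rin = L.rcoT_in[OF X]
  note [simp] = lin_comp[OF r]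
  have rc: "rco (\<Gamma> X) z = rho (rcoT X) z" if "z \<in> sp (\<Gamma> X)" for z
    using that unfolding Gamma_sp unfolding Gamma_obj_def comod.simps rho_def
    by (auto intro!: sw3_swt3 sw_swt trilinI bilinI simp: subB subL s rin L.rco_eq[OF X] D_eq D_in e_in lact_eq)
  have Gin: "rho (rcoT X) z \<in> sp (\<Gamma> X) \<otimes>\<^sub>S carr H" if "z \<in> sp (\<Gamma> X)" for z
    using that unfolding Gamma_sp by (intro rho_in r rin)
  show c: "is_right_comodule H (\<Gamma> X)"
  proof (rule H.comoduleI[where r = "rho (rcoT X)"])
    show "ksubspace (sp (\<Gamma> X))" unfolding Gamma_sp by (rule subspace_tensS)
    show "lin (rho (rcoT X))" by (rule lin_rho[OF lin_id])
    fix z assume z: "z \<in> sp (\<Gamma> X)"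
    show "rco (\<Gamma> X) z = rho (rcoT X) z" "rho (rcoT X) z \<in> sp (\<Gamma> X) \<otimes>\<^sub>S carr H"
      by (rule rc[OF z], rule Gin[OF z])
    have "(\<Oplus>x0 x1\<in>rho (rcoT X) z. \<Oplus>u v\<in>rho (rcoT X) x0. u \<otimes> v \<otimes> x1) = (\<Oplus>x0 x1\<in>rho (rcoT X) z. \<Oplus>u v\<in>rho D x1. x0 \<otimes> u \<otimes> v)"
      by (rule rho_coass[OF L.comodule_coass[OF X]]) (simp add: trilinI)
    also have "\<dots> = (\<Oplus>x0 x1\<in>rho (rcoT X) z. x0 \<otimes> copT H x1)"
      by (rule swt_cong_on[OF Gin[OF z]]) (auto intro!: bilinI simp: lin_proj[OF subH] proj_id[OF subH] copT_H swt_id[OF rho_D_in] simp flip: swt_tens_right)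
    finally show "(\<Oplus>x0 x1\<in>rho (rcoT X) z. \<Oplus>u v\<in>rho (rcoT X) x0. u \<otimes> v \<otimes> x1) = (\<Oplus>x0 x1\<in>rho (rcoT X) z. x0 \<otimes> copT H x1)" .
    have "H.cpart (rho (rcoT X)) z = (\<Oplus>a x b\<in>z. a \<otimes> L.cpart (rcoT X) x \<otimes> pB b)"
      unfolding H.cpart_def swt_cou_H[OF Gin[OF z]] by (rule rho_counit[OF r])
    also have "\<dots> = (\<Oplus>a x b\<in>z. a \<otimes> x \<otimes> b)"
      by (rule swt3_cong_on[OF z[unfolded Gamma_sp]]) (auto intro!: trilinI simp: L.comodule_counit[OF X] lin_proj[OF s] proj_id[OF s])
    also have "\<dots> = z" by (rule swt_id3[OF z[unfolded Gamma_sp]])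
    finally show "H.cpart (rho (rcoT X)) z = z" .
  qed
  show "z \<in> sp (\<Gamma> X) \<Longrightarrow> rcoT (\<Gamma> X) z = rho (rcoT X) z"
    using rc by (simp add: H.rco_eq[OF c, symmetric])
qed

lemma Gamma_arr_fn:
  assumes "ksubspace (sp (src f))" "lin F" "\<And>x. x \<in> sp (src f) \<Longrightarrow> fn f x = F x" "z \<in> sp (\<Gamma> (src f))"
  shows "fn (\<Gamma>A f) z = gmap F z"
  using assms(4) unfolding Gamma_def func.simps arrow.simps gmap_def restrict_apply
  by (auto intro!: sw3_swt3 trilinI simp: Gamma_sp subB assms(1,3) lin_comp[OF assms(2)])

lemma Gamma_arr_simps [simp]:
  "src (\<Gamma>A f) = \<Gamma> (src f)" "trg (\<Gamma>A f) = \<Gamma> (trg f)"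
  "fn (\<Gamma>A f) \<in> extensional (sp (\<Gamma> (src f)))" "FO (Gamma L B act e) X = \<Gamma> X"
  by (simp_all add: Gamma_def)

lemma Gamma_arr:
  assumes f: "is_right_comodule L (src f)" "is_right_comodule L (trg f)" "is_right_comodule_map L f"
  shows "is_right_comodule_map H (\<Gamma>A f)"
    and "z \<in> sp (\<Gamma> (src f)) \<Longrightarrow> fn (\<Gamma>A f) z = gmap (fnT f) z"
    and "z \<in> sp (\<Gamma> (src f)) \<Longrightarrow> gmap (fnT f) z \<in> sp (\<Gamma> (trg f))"
proof -
  note F = L.comodule_map_fnT[OF f]
  show fnF: "fn (\<Gamma>A f) z = gmap (fnT f) z" if "z \<in> sp (\<Gamma> (src f))" for z
    using that by (intro Gamma_arr_fn L.comodule_sub f F)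
  show m: "gmap (fnT f) z \<in> sp (\<Gamma> (trg f))" if "z \<in> sp (\<Gamma> (src f))" for z
    using that unfolding Gamma_sp by (rule gmap_mem) (rule F)+
  show "is_right_comodule_map H (\<Gamma>A f)"
  proof (rule H.comodule_mapI[where F = "gmap (fnT f)"])
    fix z assume z: "z \<in> sp (src (\<Gamma>A f))"
    then have z: "z \<in> sp (\<Gamma> (src f))" by simp
    show "rcoT (trg (\<Gamma>A f)) (gmap (fnT f) z) = (\<Oplus>x0 x1\<in>rcoT (src (\<Gamma>A f)) z. gmap (fnT f) x0 \<otimes> x1)"
      using rho_natural[OF L.lin_rcoT[OF f(1)] L.lin_rcoT[OF f(2)] F(1) L.comodule_map_rco[OF f]]
      by (simp add: rcoT_Gamma[OF f(1) z] rcoT_Gamma[OF f(2) m[OF z]])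
  qed (auto simp: Gamma_comodule f lin_gmap fnF m)
qed

lemma functor_Gamma: "is_functor (comod_cat L) (wcomod_moncat H) (Gamma L B act e)"
  unfolding is_functor_def
proof (intro conjI ballI impI L.category_comod_cat H.category_wcomod_moncat)
  note defs [simp] = comod_cat_def wcomod_moncat_def hom_def
  show "X \<in> Obj (comod_cat L) \<Longrightarrow> FO (Gamma L B act e) X \<in> Obj (wcomod_moncat H)" for X
    by (simp add: Gamma_comodule)
  show "f \<in> Arr (comod_cat L) \<Longrightarrow> \<Gamma>A f \<in> hom (wcomod_moncat H) (FO (Gamma L B act e) (Dom (comod_cat L) f)) (FO (Gamma L B act e) (Cod (comod_cat L) f))" for f
    by (simp add: Gamma_comodule Gamma_arr(1))
  fix X assume "X \<in> Obj (comod_cat L)"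
  then have X: "is_right_comodule L X" by simp
  have "\<Gamma>A (arr_id X) = arr_id (\<Gamma> X)"
  proof (rule fn_eqI[where A = "sp (\<Gamma> X)"])
    fix z assume z: "z \<in> sp (\<Gamma> X)"
    then have "fn (\<Gamma>A (arr_id X)) z = gmap (\<lambda>x. x) z"
      by (intro Gamma_arr_fn) (auto simp: L.comodule_sub[OF X] lin_id)
    also have "\<dots> = z" using z unfolding Gamma_sp by (rule gmap_id)
    finally show "fn (\<Gamma>A (arr_id X)) z = fn (arr_id (\<Gamma> X)) z" using z by simp
  qed (use Gamma_arr_simps(3)[of "arr_id X"] in simp_all)
  then show "\<Gamma>A (Id (comod_cat L) X) = Id (wcomod_moncat H) (FO (Gamma L B act e) X)" by simp
next
  fix f g assume f: "f \<in> Arr (comod_cat L)" and g: "g \<in> Arr (comod_cat L)" and fg: "Dom (comod_cat L) g = Cod (comod_cat L) f"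
  from f have f: "is_right_comodule L (src f)" "is_right_comodule L (trg f)" "is_right_comodule_map L f" by (simp_all add: comod_cat_def)
  from g have g: "is_right_comodule L (src g)" "is_right_comodule L (trg g)" "is_right_comodule_map L g" by (simp_all add: comod_cat_def)
  from fg have fg: "src g = trg f" by (simp add: comod_cat_def)
  have "\<Gamma>A (arr_comp g f) = arr_comp (\<Gamma>A g) (\<Gamma>A f)"
  proof (rule fn_eqI[where A = "sp (\<Gamma> (src f))"])
    fix z assume z: "z \<in> sp (\<Gamma> (src f))"
    note F = L.comodule_map_fnT[OF f] and G = L.comodule_map_fnT[OF g]
    have "fn (\<Gamma>A (arr_comp g f)) z = gmap (\<lambda>x. fnT g (fnT f x)) z"
      using z F(2) by (intro Gamma_arr_fn) (auto simp: L.comodule_sub[OF f(1)] lin_comp[OF G(1) F(1)] F(3) G(3) fg)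
    also have "\<dots> = gmap (fnT g) (gmap (fnT f) z)" by (simp add: gmap_gmap F G)
    also have "\<dots> = fn (\<Gamma>A g) (fn (\<Gamma>A f) z)"
      using z Gamma_arr(3)[OF f z] by (simp add: Gamma_arr(2)[OF f] Gamma_arr(2)[OF g] fg)
    finally show "fn (\<Gamma>A (arr_comp g f)) z = fn (arr_comp (\<Gamma>A g) (\<Gamma>A f)) z"
      using z by simp
  qed (use Gamma_arr_simps(3)[of "arr_comp g f"] in \<open>auto intro: arr_comp_ext\<close>)
  then show "\<Gamma>A (Cmp (comod_cat L) g f) = Cmp (wcomod_moncat H) (\<Gamma>A g) (\<Gamma>A f)"
    by (simp add: comod_cat_def wcomod_moncat_def)
qed

lemma functor_forget_left: "is_functor (bicomod_moncat L) (comod_cat L) forget_left"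
  unfolding is_functor_def
  by (intro conjI L.category_bicomod_moncat L.category_comod_cat)
    (auto simp: bicomod_moncat_def comod_cat_def hom_def L.bicomodule_right L.bicomodule_map_right)

lemma functor_Gamma_hat: "is_functor (bicomod_moncat L) (wcomod_moncat H) (Gamma_hat L B act e)"
  unfolding Gamma_hat_def by (rule is_functor_comp[OF functor_forget_left functor_Gamma])

section \<open>The functor on bicomodules, and their tensor product and unit\<close>

abbreviation "G' \<equiv> Gamma_hat L B act e"
abbreviation "\<Gamma>A' \<equiv> FA G'"
abbreviation "\<Gamma>' X \<equiv> \<Gamma> (comod.truncate X)"

lemma Gamma_hat_simps [simp]:
  "FO G' X = \<Gamma>' X"
  "src (\<Gamma>A' f) = \<Gamma>' (src f)" "trg (\<Gamma>A' f) = \<Gamma>' (trg f)"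
  "fn (\<Gamma>A' f) \<in> extensional (sp (\<Gamma>' (src f)))"
  using Gamma_arr_simps(3)[of "FA forget_left f"] by (simp_all add: Gamma_hat_def func_comp_def)

lemma Gamma'_sp: "sp (\<Gamma>' X) = carr B \<otimes>\<^sub>S sp X \<otimes>\<^sub>S carr B"
  by (simp add: Gamma_sp)

lemma Gamma'_comodule: "is_bicomodule L X \<Longrightarrow> is_right_comodule H (\<Gamma>' X)"
  by (simp add: Gamma_comodule L.bicomodule_right)

text \<open>Any total linear map agreeing with the arrow on its source will do. Thus \<Gamma> can be
  evaluated on associators and unit maps without first proving these to be bicomodule maps.\<close>

lemma Gamma_hat_fn:
  assumes "ksubspace (sp (src f))" "lin F" "\<And>x. x \<in> sp (src f) \<Longrightarrow> fn f x = F x" "z \<in> sp (\<Gamma>' (src f))"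
  shows "fn (\<Gamma>A' f) z = gmap F z"
  using Gamma_arr_fn[of "FA forget_left f" F z] assms by (simp add: Gamma_hat_def func_comp_def)

lemma btens_rco:
  assumes X: "is_bicomodule L X" and Y: "is_bicomodule L Y" and z: "z \<in> sp X \<otimes>\<^sub>S sp Y"
  shows "rco (btens L X Y) z = L.tensR (rcoT X) (rcoT Y) z" "lco (btens L X Y) z = tensL (lcoT X) (lcoT Y) z"
proof -
  note RX = L.bicomodule_right[OF X] and RY = L.bicomodule_right[OF Y]
  note [simp] = L.comodule_facts[OF RX] L.comodule_facts[OF RY] L.bicomodule_facts[OF X] L.bicomodule_facts[OF Y] subL
  show "rco (btens L X Y) z = L.tensR (rcoT X) (rcoT Y) z" "lco (btens L X Y) z = tensL (lcoT X) (lcoT Y) z"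
    unfolding L.tensR_def tensL_def btens_def comod.simps bicomod.simps using z
    by (auto intro!: sw_swt bilinI simp: mL_eq)
qed

lemma btens_sp [simp]: "sp (btens L X Y) = sp X \<otimes>\<^sub>S sp Y"
  by (simp add: btens_def)

lemma btens_coT:
  assumes X: "is_bicomodule L X" and Y: "is_bicomodule L Y" and z: "z \<in> sp X \<otimes>\<^sub>S sp Y"
  shows "rcoT (btens L X Y) z = L.tensR (rcoT X) (rcoT Y) z" "lcoT (btens L X Y) z = tensL (lcoT X) (lcoT Y) z"
  using btens_rco[OF X Y z] z by (simp_all add: rcoT_def lcoT_def proj_id[OF subspace_tensS])

lemma btens_comodule:
  assumes X: "is_bicomodule L X" and Y: "is_bicomodule L Y"
  shows "is_right_comodule L (btens L X Y)"
proof -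
  note RX = L.bicomodule_right[OF X] and RY = L.bicomodule_right[OF Y]
  note c = L.coass_tensR[OF L.comodule_coass[OF RX] L.comodule_coass[OF RY]]
  note [simp] = lin_comp[OF L.lin_rcoT[OF RX]] lin_comp[OF L.lin_rcoT[OF RY]]
    lin_proj[OF L.comodule_sub[OF RX]] lin_proj[OF L.comodule_sub[OF RY]]
  show ?thesis
  proof (rule L.comoduleI[where r = "L.tensR (rcoT X) (rcoT Y)"])
    fix z assume "z \<in> sp (btens L X Y)"
    then have z: "z \<in> sp X \<otimes>\<^sub>S sp Y" by simp
    show "rco (btens L X Y) z = L.tensR (rcoT X) (rcoT Y) z" by (rule btens_rco[OF X Y z])
    show "L.tensR (rcoT X) (rcoT Y) z \<in> sp (btens L X Y) \<otimes>\<^sub>S carr L"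
      unfolding btens_sp by (rule L.tensR_in[OF L.lin_rcoT[OF RX] L.lin_rcoT[OF RY] L.rcoT_in[OF RX] L.rcoT_in[OF RY] z])
    have "(\<Oplus>x0 x1\<in>L.tensR (rcoT X) (rcoT Y) z. \<Oplus>u v\<in>L.tensR (rcoT X) (rcoT Y) x0. u \<otimes> v \<otimes> x1)
      = (\<Oplus>x0 x1\<in>L.tensR (rcoT X) (rcoT Y) z. \<Oplus>u v\<in>D x1. x0 \<otimes> u \<otimes> v)"
      by (rule L.coassD[OF c]) (simp add: trilinI)
    then show "(\<Oplus>x0 x1\<in>L.tensR (rcoT X) (rcoT Y) z. \<Oplus>u v\<in>L.tensR (rcoT X) (rcoT Y) x0. u \<otimes> v \<otimes> x1)
      = (\<Oplus>x0 x1\<in>L.tensR (rcoT X) (rcoT Y) z. x0 \<otimes> D x1)"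
      by (simp add: swt_id[OF D_in] flip: swt_tens_right)
    have "L.cpart (L.tensR (rcoT X) (rcoT Y)) z = (\<Oplus>m n\<in>z. L.cpart (rcoT X) m \<otimes> L.cpart (rcoT Y) n)"
    proof -
      have "L.cpart (rcoT X) m \<otimes> L.cpart (rcoT Y) n = (\<Oplus>m0 m1\<in>rcoT X m. \<Oplus>n0 n1\<in>rcoT Y n. scale (ep m1 * ep n1) (m0 \<otimes> n0))" for m n
        unfolding L.cpart_def by (subst swt_tens_left) (simp add: swt_tens_right tens_scale_left tens_scale_right mult.commute)
      then show ?thesis by (simp add: L.cpart_def L.tensR_def swt_simps)
    qed
    also have "\<dots> = (\<Oplus>m n\<in>z. m \<otimes> n)"
      unfolding L.comodule_counit[OF RX] L.comodule_counit[OF RY]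
      by (rule swt_cong_on[OF z]) (auto intro!: bilinI simp: proj_id L.comodule_sub[OF RX] L.comodule_sub[OF RY])
    also have "\<dots> = z" by (rule swt_id[OF z])
    finally show "L.cpart (L.tensR (rcoT X) (rcoT Y)) z = z" .
  qed (auto simp: subspace_tensS L.lin_tensR)
qed

text \<open>Required to use \<phi> at a tensor product, as the associativity constraint does. The
  laws of the factors are applied separately after exchanging sums; multiplicativity of the
  coproduct and counit of \<open>L\<close> reassembles them.\<close>

lemma btens_bicomodule:
  assumes X: "is_bicomodule L X" and Y: "is_bicomodule L Y"
  shows "is_bicomodule L (btens L X Y)"
proof -
  note RX = L.bicomodule_right[OF X] and RY = L.bicomodule_right[OF Y]
  let ?l = "lcoT X" and ?l' = "lcoT Y" and ?r = "rcoT X" and ?s = "rcoT Y"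
  note lr = L.lin_rcoT[OF RX] L.lin_rcoT[OF RY] L.lin_lcoT[OF X] L.lin_lcoT[OF Y]
  note [simp] = lin_comp[OF lr(1)] lin_comp[OF lr(2)] lin_comp[OF lr(3)] lin_comp[OF lr(4)]
    lin_proj[OF L.comodule_sub[OF RX]] lin_proj[OF L.comodule_sub[OF RY]]
  show ?thesis
  proof (rule L.bicomoduleI[where r = "L.tensR ?r ?s" and l = "tensL ?l ?l'"])
    show "is_right_comodule L (btens L X Y)" by (rule btens_comodule[OF X Y])
    show "lin (L.tensR ?r ?s)" "lin (tensL ?l ?l')" by (rule L.lin_tensR, rule lin_tensL)
    fix z assume "z \<in> sp (btens L X Y)"
    then have z: "z \<in> sp X \<otimes>\<^sub>S sp Y" by simp
    show "rco (btens L X Y) z = L.tensR ?r ?s z" "lco (btens L X Y) z = tensL ?l ?l' z" by (rule btens_rco[OF X Y z])+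
    show "L.tensR ?r ?s z \<in> sp (btens L X Y) \<otimes>\<^sub>S carr L"
      unfolding btens_sp by (rule L.tensR_in[OF lr(1,2) L.rcoT_in[OF RX] L.rcoT_in[OF RY] z])
    show "tensL ?l ?l' z \<in> carr L \<otimes>\<^sub>S sp (btens L X Y)"
      unfolding btens_sp tensL_def
      by (intro swt_mem[OF z] swt_mem[OF L.lcoT_in[OF X]] swt_mem[OF L.lcoT_in[OF Y]] subspace_tensS bilinI tens_in_tensS) simp_all
    have "(\<Oplus>h w\<in>tensL ?l ?l' z. h \<otimes> tensL ?l ?l' w) = (\<Oplus>x y\<in>z. \<Oplus>xm x0\<in>?l x. \<Oplus>ym y0\<in>?l' y. \<Oplus>xm' x00\<in>?l x0. \<Oplus>ym' y00\<in>?l' y0.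
        mL xm ym \<otimes> mL xm' ym' \<otimes> (x00 \<otimes> y00))"
      by (simp add: tensL_def swt_simps)
    also have "\<dots> = (\<Oplus>x y\<in>z. \<Oplus>xm x0\<in>?l x. \<Oplus>xm' x00\<in>?l x0. \<Oplus>ym y0\<in>?l' y. \<Oplus>ym' y00\<in>?l' y0.
        mL xm ym \<otimes> mL xm' ym' \<otimes> (x00 \<otimes> y00))"
      by (intro swt_swap swt_fun_cong)
    also have "\<dots> = (\<Oplus>x y\<in>z. \<Oplus>xm x0\<in>?l x. \<Oplus>x1 x2\<in>D xm. \<Oplus>ym y0\<in>?l' y. \<Oplus>ym' y00\<in>?l' y0.
        mL x1 ym \<otimes> mL x2 ym' \<otimes> (x0 \<otimes> y00))"
      by (intro swt_fun_cong L.lco_coass[OF X]) (simp add: trilinI)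
    also have "\<dots> = (\<Oplus>x y\<in>z. \<Oplus>xm x0\<in>?l x. \<Oplus>x1 x2\<in>D xm. \<Oplus>ym y0\<in>?l' y. \<Oplus>y1 y2\<in>D ym.
        mL x1 y1 \<otimes> mL x2 y2 \<otimes> (x0 \<otimes> y0))"
      by (intro swt_fun_cong L.lco_coass[OF Y]) (simp add: trilinI)
    also have "\<dots> = (\<Oplus>x y\<in>z. \<Oplus>xm x0\<in>?l x. \<Oplus>ym y0\<in>?l' y. \<Oplus>x1 x2\<in>D xm. \<Oplus>y1 y2\<in>D ym.
        mL x1 y1 \<otimes> mL x2 y2 \<otimes> (x0 \<otimes> y0))"
      by (intro swt_swap swt_fun_cong)
    also have "\<dots> = (\<Oplus>h w\<in>tensL ?l ?l' z. \<Oplus>h1 h2\<in>D h. h1 \<otimes> h2 \<otimes> w)"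
      by (simp add: tensL_def swt_simps L.F_D_mul)
    finally show "(\<Oplus>h w\<in>tensL ?l ?l' z. h \<otimes> tensL ?l ?l' w) = (\<Oplus>h w\<in>tensL ?l ?l' z. \<Oplus>h1 h2\<in>D h. h1 \<otimes> h2 \<otimes> w)" .
    have "(\<Oplus>h w\<in>tensL ?l ?l' z. scale (ep h) w) = (\<Oplus>x y\<in>z. proj (sp X) x \<otimes> proj (sp Y) y)"
    proof -
      have "proj (sp X) x \<otimes> proj (sp Y) y = (\<Oplus>xm x0\<in>?l x. \<Oplus>ym y0\<in>?l' y. scale (ep xm * ep ym) (x0 \<otimes> y0))" for x y
        unfolding L.lco_counit[OF X, symmetric] L.lco_counit[OF Y, symmetric]
        by (subst swt_tens_left) (simp add: swt_tens_right tens_scale_left tens_scale_right mult.commute)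
      then show ?thesis by (simp add: tensL_def swt_simps)
    qed
    also have "\<dots> = (\<Oplus>m n\<in>z. m \<otimes> n)"
      by (rule swt_cong_on[OF z]) (auto intro!: bilinI simp: proj_id L.comodule_sub[OF RX] L.comodule_sub[OF RY])
    also have "\<dots> = z" by (rule swt_id[OF z])
    finally show "(\<Oplus>h w\<in>tensL ?l ?l' z. scale (ep h) w) = z" .
    have "(\<Oplus>h w\<in>tensL ?l ?l' z. \<Oplus>v k\<in>L.tensR ?r ?s w. h \<otimes> v \<otimes> k) = (\<Oplus>x y\<in>z. \<Oplus>xm x0\<in>?l x. \<Oplus>ym y0\<in>?l' y. \<Oplus>x00 x1\<in>?r x0. \<Oplus>y00 y1\<in>?s y0.
        mL xm ym \<otimes> (x00 \<otimes> y00) \<otimes> mL x1 y1)"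
      by (simp add: tensL_def L.tensR_def swt_simps)
    also have "\<dots> = (\<Oplus>x y\<in>z. \<Oplus>xm x0\<in>?l x. \<Oplus>x00 x1\<in>?r x0. \<Oplus>ym y0\<in>?l' y. \<Oplus>y00 y1\<in>?s y0.
        mL xm ym \<otimes> (x00 \<otimes> y00) \<otimes> mL x1 y1)"
      by (intro swt_swap swt_fun_cong)
    also have "\<dots> = (\<Oplus>x y\<in>z. \<Oplus>x0 x1\<in>?r x. \<Oplus>xm x00\<in>?l x0. \<Oplus>ym y0\<in>?l' y. \<Oplus>y00 y1\<in>?s y0.
        mL xm ym \<otimes> (x00 \<otimes> y00) \<otimes> mL x1 y1)"
      by (intro swt_fun_cong L.lco_rco[OF X]) (simp add: trilinI)
    also have "\<dots> = (\<Oplus>x y\<in>z. \<Oplus>x0 x1\<in>?r x. \<Oplus>xm x00\<in>?l x0. \<Oplus>y0 y1\<in>?s y. \<Oplus>ym y00\<in>?l' y0.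
        mL xm ym \<otimes> (x00 \<otimes> y00) \<otimes> mL x1 y1)"
      by (intro swt_fun_cong L.lco_rco[OF Y]) (simp add: trilinI)
    also have "\<dots> = (\<Oplus>x y\<in>z. \<Oplus>x0 x1\<in>?r x. \<Oplus>y0 y1\<in>?s y. \<Oplus>xm x00\<in>?l x0. \<Oplus>ym y00\<in>?l' y0.
        mL xm ym \<otimes> (x00 \<otimes> y00) \<otimes> mL x1 y1)"
      by (intro swt_swap swt_fun_cong)
    also have "\<dots> = (\<Oplus>w k\<in>L.tensR ?r ?s z. \<Oplus>h v\<in>tensL ?l ?l' w. h \<otimes> v \<otimes> k)"
      by (simp add: tensL_def L.tensR_def swt_simps)
    finally show "(\<Oplus>h w\<in>tensL ?l ?l' z. \<Oplus>v k\<in>L.tensR ?r ?s w. h \<otimes> v \<otimes> k) = (\<Oplus>w k\<in>L.tensR ?r ?s z. \<Oplus>h v\<in>tensL ?l ?l' w. h \<otimes> v \<otimes> k)" .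
  qed
qed

lemma unitv_kline: "unitv \<in> kline"
  unfolding kline_def by (intro kv.span_base) simp

lemma sub_kline: "ksubspace kline"
  unfolding kline_def by (rule kv.subspace_span)

lemma bunit_sp [simp]: "sp (bunit L) = kline"
  by (simp add: bunit_def)

lemma bunit_coT [simp]: "rcoT (bunit L) unitv = unitv \<otimes> one L" "lcoT (bunit L) unitv = one L \<otimes> unitv"
  by (simp_all add: bunit_def rcoT_def lcoT_def proj_id[OF sub_kline unitv_kline])

lemma lin_bunit_coT: "lin (rcoT (bunit L))" "lin (lcoT (bunit L))"
  by (simp_all add: bunit_def rcoT_def[abs_def] lcoT_def[abs_def] lin_proj[OF sub_kline])

lemma bunit_comodule: "is_right_comodule L (bunit L)"
  by (rule L.comoduleI[where r = "\<lambda>c. c \<otimes> one L"])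
    (auto simp: bunit_def sub_kline tens_in_tensS L.cpart_def swt_simps D_one)

section \<open>The structure map on products of comodules\<close>

definition phi :: "('k, 'i) bicomod \<Rightarrow> ('k, 'i) bicomod \<Rightarrow> ('k, 'i) vec \<Rightarrow> ('k, 'i) vec"
  where "phi X Y z = (\<Oplus>u v\<in>z. phi2 (lcoT X) (rcoT Y) u v)"

lemma lin_phi: "lin (phi X Y)"
  unfolding phi_def[abs_def] by simp

abbreviation "F2 \<equiv> Gamma_hat2 L B act e \<omega>"

lemma F2_simps [simp]:
  "src (F2 X Y) = wtens H (\<Gamma>' X) (\<Gamma>' Y)" "trg (F2 X Y) = \<Gamma>' (btens L X Y)"
  "fn (F2 X Y) \<in> extensional (sp (wtens H (\<Gamma>' X) (\<Gamma>' Y)))"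
  by (simp_all add: Gamma_hat2_def Let_def)

lemma phi_in:
  assumes X: "is_bicomodule L X" and Y: "is_bicomodule L Y" and z: "z \<in> sp (\<Gamma>' X) \<otimes>\<^sub>S sp (\<Gamma>' Y)"
  shows "phi X Y z \<in> sp (\<Gamma>' (btens L X Y))"
  unfolding phi_def Gamma'_sp btens_sp
  by (rule swt_mem[OF z[unfolded Gamma'_sp] subspace_tensS bilin_phi2])
    (intro phi2_in L.lin_lcoT[OF X] L.lcoT_in[OF X] L.lin_rcoT[OF L.bicomodule_right[OF Y]] L.rcoT_in[OF L.bicomodule_right[OF Y]])

lemma F2_fn:
  assumes X: "is_bicomodule L X" and Y: "is_bicomodule L Y" and z: "z \<in> sp (wtens H (\<Gamma>' X) (\<Gamma>' Y))"
  shows "fn (F2 X Y) z = phi X Y z"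
proof -
  note RX = L.bicomodule_right[OF X] and RY = L.bicomodule_right[OF Y]
  note [simp] = L.comodule_facts[OF RX] L.comodule_facts[OF RY] L.bicomodule_facts[OF X] L.bicomodule_facts[OF Y] subL subB
  have z1: "z \<in> sp (\<Gamma>' X) \<otimes>\<^sub>S sp (\<Gamma>' Y)" using H.wtens_sub[OF Gamma'_comodule[OF X] Gamma'_comodule[OF Y]] z by auto
  show ?thesis using z z1 unfolding Gamma_hat2_def Let_def phi_def phi2_def Gamma_hat_simps arrow.simps restrict_apply Gamma'_sp
    by (auto intro!: sw_swt sw3_swt3 bilinI trilinI simp: subspace_tensS lact_eq mB_eq A_eq)
qed

text \<open>\<open>phi2_comodule\<close> is available on the whole tensor product. The smaller
  product matters only for evaluating the arrow and for identifying its coaction with the diagonal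
  one.\<close>

lemma F2_arr:
  assumes X: "is_bicomodule L X" and Y: "is_bicomodule L Y"
  shows "is_right_comodule H (src (F2 X Y))" "is_right_comodule H (trg (F2 X Y))" "is_right_comodule_map H (F2 X Y)"
proof -
  note RX = L.bicomodule_right[OF X] and RY = L.bicomodule_right[OF Y]
  note G = Gamma'_comodule[OF X] Gamma'_comodule[OF Y]
  show s: "is_right_comodule H (src (F2 X Y))" by (simp add: H.wtens_comodule G)
  show t: "is_right_comodule H (trg (F2 X Y))" by (simp add: Gamma_comodule btens_comodule X Y)
  have l: "lin (lcoT X)" "lin (rcoT Y)" "lin (rcoT X)" by (rule L.lin_lcoT[OF X], rule L.lin_rcoT[OF RY], rule L.lin_rcoT[OF RX])
  show "is_right_comodule_map H (F2 X Y)"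
  proof (rule H.comodule_mapI[OF s t lin_phi])
    fix z assume "z \<in> sp (src (F2 X Y))"
    then have z: "z \<in> sp (wtens H (\<Gamma>' X) (\<Gamma>' Y))" by simp
    show "fn (F2 X Y) z = phi X Y z" by (rule F2_fn[OF X Y z])
    have z1: "z \<in> sp (\<Gamma>' X) \<otimes>\<^sub>S sp (\<Gamma>' Y)" using H.wtens_sub[OF G] z by auto
    show p: "phi X Y z \<in> sp (trg (F2 X Y))" using phi_in[OF X Y z1] by simp
    have GX: "rho (rcoT X) x \<in> sp (\<Gamma>' X) \<otimes>\<^sub>S carr H" if "x \<in> sp (\<Gamma>' X)" for x
      using that unfolding Gamma'_sp by (rule rho_in) (rule l L.rcoT_in[OF RX])+
    have GY: "rho (rcoT Y) x \<in> sp (\<Gamma>' Y) \<otimes>\<^sub>S carr H" if "x \<in> sp (\<Gamma>' Y)" for x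
      using that unfolding Gamma'_sp by (rule rho_in) (rule l L.rcoT_in[OF RY])+
    note [simp] = lin_proj[OF subH] lin_comp[OF lin_phi]
    have "rcoT (trg (F2 X Y)) (phi X Y z) = rho (rcoT (btens L X Y)) (phi X Y z)"
      using p by (simp add: rcoT_Gamma btens_comodule[OF X Y])
    also have "\<dots> = rho (L.tensR (rcoT X) (rcoT Y)) (phi X Y z)"
      by (rule rho_cong[of _ "sp X \<otimes>\<^sub>S sp Y"])
        (use p in \<open>simp_all add: Gamma'_sp L.lin_rcoT[OF btens_comodule[OF X Y]] L.lin_tensR btens_coT[OF X Y]\<close>)
    also have "\<dots> = (\<Oplus>u v\<in>z. \<Oplus>u0 u1\<in>rho (rcoT X) u. \<Oplus>v0 v1\<in>rho (rcoT Y) v. phi2 (lcoT X) (rcoT Y) u0 v0 \<otimes> muH u1 v1)"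
      unfolding phi_def lin_swt_out[OF lin_rho[OF lin_id]]
      by (intro swt_fun_cong phi2_comodule L.comodule_coass[OF RX] L.comodule_coass[OF RY] l L.lco_rco[OF X])
    \<comment> \<open>The diagonal coaction is formulated with \<open>mulT H\<close>; it agrees with
      \<open>muH\<close> because the coaction legs lie in \<open>carr H\<close>.\<close>
    also have "\<dots> = (\<Oplus>u v\<in>z. \<Oplus>u0 u1\<in>rho (rcoT X) u. \<Oplus>v0 v1\<in>rho (rcoT Y) v. phi2 (lcoT X) (rcoT Y) u0 v0 \<otimes> mulT H u1 v1)"
      unfolding mulT_H
    proof (rule swt_cong_on[OF z1])
      fix u v assume u: "u \<in> sp (\<Gamma>' X)" and v: "v \<in> sp (\<Gamma>' Y)"
      show "(\<Oplus>u0 u1\<in>rho (rcoT X) u. \<Oplus>v0 v1\<in>rho (rcoT Y) v. phi2 (lcoT X) (rcoT Y) u0 v0 \<otimes> muH u1 v1)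
        = (\<Oplus>u0 u1\<in>rho (rcoT X) u. \<Oplus>v0 v1\<in>rho (rcoT Y) v. phi2 (lcoT X) (rcoT Y) u0 v0 \<otimes> muH (proj (carr H) u1) (proj (carr H) v1))"
        by (rule swt_cong_on[OF GX[OF u]]; (rule bilinI)?)
          (auto intro!: swt_cong_on[OF GY[OF v]] bilinI simp: proj_id[OF subH])
    qed (auto intro!: bilinI)
    also have "\<dots> = (\<Oplus>x0 x1\<in>H.tensR (rho (rcoT X)) (rho (rcoT Y)) z. phi X Y x0 \<otimes> x1)"
      by (simp add: H.tensR_def swt_simps phi_def)
    also have "H.tensR (rho (rcoT X)) (rho (rcoT Y)) z = H.tensR (rcoT (\<Gamma>' X)) (rcoT (\<Gamma>' Y)) z"
      by (rule H.tensR_cong[OF _ _ _ _ z1]) (auto simp: H.lin_rcoT G rcoT_Gamma RX RY)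
    also have "\<dots> = rcoT (src (F2 X Y)) z" using H.rcoT_wtens[OF G z] by simp
    finally show "rcoT (trg (F2 X Y)) (phi X Y z) = (\<Oplus>x0 x1\<in>rcoT (src (F2 X Y)) z. phi X Y x0 \<otimes> x1)" .
  qed simp
qed

section \<open>The unit object of comodules over \<open>H\<close> and the unit morphism\<close>

abbreviation "iB b \<equiv> one B \<otimes> one L \<otimes> b"

lemma iB_in: "b \<in> carr B \<Longrightarrow> iB b \<in> carr H"
  by (simp add: carr_H tens_in_tensS)

lemma rho_iB: "rho D (iB b) = (\<Oplus>e1 e2\<in>e. iB e1 \<otimes> (pB e2 \<otimes> one L \<otimes> b))"
  by (simp add: rho_tens lin_D D_one swt_tens bilinI)

lemma epH_out: "lin f \<Longrightarrow> f (epH u v) = epH u (f v)"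
  unfolding epH_def by (subst lin_swt3_out[of f]) (auto simp: linD)

lemma epH_in: "u \<in> carr H \<Longrightarrow> ksubspace V \<Longrightarrow> v \<in> V \<Longrightarrow> epH u v \<in> V"
  by (simp add: kv.subspace_scale flip: cou_H)

text \<open>By \<open>rho_iB\<close> the first legs of the coproduct of the unit have the form
  \<open>iB e1\<close>, so the counit applied to the second legs leaves a value in the image of
  \<open>iB\<close>.\<close>

lemma eps_s_H:
  assumes x: "x \<in> carr H"
  shows "eps_s H x = iB (\<Oplus>e1 e2\<in>e. epH (muH x (pB e2 \<otimes> one L \<otimes> one B)) e1)"
proof -
  have o: "one H = iB (one B)" by (simp add: qtg_def)
  have "eps_s H x = (\<Oplus>u1 u2\<in>rho D (iB (one B)). epH (muH x u2) u1)"
    unfolding eps_s_def o cop_H[OF iB_in[OF one_in(1)]]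
    using x by (intro sw_swt) (auto intro!: subH rho_D_in iB_in bilinI simp: cou_H[symmetric] mul_H muH_in)
  also have "\<dots> = (\<Oplus>e1 e2\<in>e. epH (muH x (pB e2 \<otimes> one L \<otimes> one B)) (iB e1))"
    by (simp add: rho_iB swt_simps)
  also have "\<dots> = (\<Oplus>e1 e2\<in>e. iB (epH (muH x (pB e2 \<otimes> one L \<otimes> one B)) e1))"
    by (simp add: epH_out[of "\<lambda>b. iB b"])
  finally show ?thesis by (simp add: swt_tens_right)
qed

text \<open>One inclusion is \<open>eps_s_H\<close>. For the other, \<open>eps_s H\<close> fixes
  each \<open>iB b\<close>, by the dual basis property of \<open>e\<close>.\<close>

lemma wunit_sp: "sp (wunit H) = iB ` carr B"
proof (intro equalityI subsetI)
  fix z assume "z \<in> sp (wunit H)"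
  then obtain x where x: "x \<in> carr H" "z = eps_s H x" by (auto simp: wunit_def)
  have "(\<Oplus>e1 e2\<in>e. epH (muH x (pB e2 \<otimes> one L \<otimes> one B)) e1) \<in> carr B"
  proof (rule swt_mem[OF e_in subB])
    fix u v assume u: "u \<in> carr B" and "v \<in> carr B"
    have "pB v \<otimes> one L \<otimes> one B \<in> carr H" by (simp add: carr_H tens_in_tensS)
    then show "epH (muH x (pB v \<otimes> one L \<otimes> one B)) u \<in> carr B"
      by (intro epH_in muH_in x(1) subB u)
  qed (simp add: bilinI)
  then show "z \<in> iB ` carr B" using x by (auto simp: eps_s_H)
next
  fix z assume "z \<in> iB ` carr B"
  then obtain b where b: "b \<in> carr B" "z = iB b" by auto
  have "eps_s H z = iB (\<Oplus>e1 e2\<in>e. scale (w (mB e2 b)) e1)"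
    by (simp add: b(2) eps_s_H[OF iB_in[OF b(1)]] muH_tens D_one swt_simps epH_tens)
  also have "\<dots> = z" using b by (simp add: e_w_right)
  finally show "z \<in> sp (wunit H)" using iB_in[OF b(1)] b(2) by (force simp: wunit_def)
qed

lemma sub_wunit: "ksubspace (sp (wunit H))"
  unfolding wunit_sp kv.subspace_def
proof (intro conjI ballI allI)
  have l: "lin (\<lambda>b. iB b)" by simp
  show "0 \<in> iB ` carr B"
    using lin_0[OF l] kv.subspace_0[OF subB] by force
  fix x assume "x \<in> iB ` carr B"
  then obtain b where b: "b \<in> carr B" "x = iB b" by auto
  show "scale c x \<in> iB ` carr B" for c
    unfolding b(2) linD(2)[OF l, symmetric] by (rule imageI) (rule kv.subspace_scale[OF subB b(1)])
  fix y assume "y \<in> iB ` carr B"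
  then obtain b' where b': "b' \<in> carr B" "y = iB b'" by auto
  show "x + y \<in> iB ` carr B"
    unfolding b(2) b'(2) linD(1)[OF l, symmetric] by (rule imageI) (rule kv.subspace_add[OF subB b(1) b'(1)])
qed

lemma wunit_H: "sp (wunit H) \<subseteq> carr H"
  by (auto simp: wunit_sp iB_in)

lemma wunit_rho: "z \<in> sp (wunit H) \<Longrightarrow> rho D z \<in> sp (wunit H) \<otimes>\<^sub>S carr H"
  by (auto simp: wunit_sp rho_iB carr_H intro!: swt_mem[OF e_in subspace_tensS] bilinI tens_in_tensS)

text \<open>The coproduct of \<open>H\<close> restricts because the first leg of
  \<open>rho D (iB b)\<close> is again of the form \<open>iB e1\<close>. The counit law comes from
  \<open>rho_counit\<close> together with the right counit law of \<open>L\<close>.\<close>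

lemma wunit_comodule: "is_right_comodule H (wunit H)"
proof (rule H.comoduleI[OF sub_wunit, where r = "rho D"])
  show "lin (rho D)" by (rule lin_rho[OF lin_id])
  fix z assume z: "z \<in> sp (wunit H)"
  then have zH: "z \<in> carr H" using wunit_H by auto
  show "rco (wunit H) z = rho D z" using cop_H[OF zH] by (simp add: wunit_def)
  show "rho D z \<in> sp (wunit H) \<otimes>\<^sub>S carr H" by (rule wunit_rho[OF z])
  have "(\<Oplus>x0 x1\<in>rho D z. \<Oplus>u v\<in>rho D x0. u \<otimes> v \<otimes> x1) = (\<Oplus>x0 x1\<in>rho D z. \<Oplus>u v\<in>rho D x1. x0 \<otimes> u \<otimes> v)"
    by (rule rho_coass[OF L_coass_D]) (simp add: trilinI)
  also have "\<dots> = (\<Oplus>x0 x1\<in>rho D z. x0 \<otimes> copT H x1)"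
    by (rule swt_cong_on[OF wunit_rho[OF z]]) (auto intro!: bilinI simp: lin_proj[OF subH] proj_id[OF subH] copT_H swt_id[OF rho_D_in] simp flip: swt_tens_right)
  finally show "(\<Oplus>x0 x1\<in>rho D z. \<Oplus>u v\<in>rho D x0. u \<otimes> v \<otimes> x1) = (\<Oplus>x0 x1\<in>rho D z. x0 \<otimes> copT H x1)" .
  obtain b where b: "b \<in> carr B" "z = iB b" using z by (auto simp: wunit_sp)
  have "H.cpart (rho D) z = (\<Oplus>a x b\<in>z. a \<otimes> L.cpart D x \<otimes> pB b)"
    unfolding H.cpart_def swt_cou_H[OF wunit_rho[OF z]] by (rule rho_counit[OF lin_D])
  also have "\<dots> = z"
    using b by (simp add: L.cpart_def counit_D2 swt_simps)
  finally show "H.cpart (rho D) z = z" .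
qed

lemma rcoT_wunit: "z \<in> sp (wunit H) \<Longrightarrow> rcoT (wunit H) z = rho D z"
  using wunit_H H.rco_eq[OF wunit_comodule, of z] cop_H[of z] by (auto simp: wunit_def)

text \<open>A linear formula replacing the description operator in \<open>Gamma_hat0\<close>: the
  counit of \<open>L\<close> removes the middle factor and equals 1 at \<open>one L\<close>.\<close>

definition f0 :: "('k, 'i) vec \<Rightarrow> ('k, 'i) vec"
  where "f0 z = (\<Oplus>a h b\<in>z. scale (ep h) (a \<otimes> unitv \<otimes> b))"

lemma lin_f0: "lin f0"
  unfolding f0_def[abs_def] by simp

lemma f0_iB: "f0 (iB b) = one B \<otimes> unitv \<otimes> b"
  by (simp add: f0_def swt_simps)

abbreviation "F0 \<equiv> Gamma_hat0 L B act e \<omega>"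

lemma F0_simps [simp]: "src F0 = wunit H" "trg F0 = \<Gamma>' (bunit L)" "fn F0 \<in> extensional (sp (wunit H))"
  by (simp_all add: Gamma_hat0_def)

lemma F0_fn: "z \<in> sp (wunit H) \<Longrightarrow> fn F0 z = f0 z"
proof -
  assume z: "z \<in> sp (wunit H)"
  then obtain b where b: "b \<in> carr B" "z = iB b" by (auto simp: wunit_sp)
  \<comment> \<open>A linear left inverse of \<open>iB\<close>, which makes the described element of
    \<open>B\<close> unique.\<close>
  have *: "swt3 (iB c) (\<lambda>a h b. scale (ep h) (mB a b)) = c" if "c \<in> carr B" for c
    using that by (simp add: swt_simps)
  have "(THE c. c \<in> carr B \<and> z = iB c) = b"
    using b * by (intro the_equality) metis+
  then show ?thesis using z b by (simp add: Gamma_hat0_def f0_iB)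
qed

lemma bunit_bicomodule: "is_bicomodule L (bunit L)"
proof -
  note [simp] = sub_kline subL tens_in_tensS
  show ?thesis
    unfolding is_bicomodule_def bunit_sp
  proof (intro conjI ballI bunit_comodule)
    show "linear_on kline (carr L \<otimes>\<^sub>S kline) (lco (bunit L))"
      by (auto simp: linear_on_def bunit_def tens_add_right tens_scale_right)
    fix x :: "('k, 'i) vec" assume x: "x \<in> kline"
    have "sw (carr L) kline (lco (bunit L) x) (\<lambda>y x0. y \<otimes> lco (bunit L) x0) = one L \<otimes> one L \<otimes> x"
      using x by (subst sw_swt[where g = "\<lambda>y x0. y \<otimes> one L \<otimes> x0"]) (auto simp: bunit_def bilinI swt_tens)
    moreover have "sw (carr L) kline (lco (bunit L) x) (\<lambda>y x0. sw (carr L) (carr L) (cop L y) (\<lambda>y1 y2. y1 \<otimes> y2 \<otimes> x0)) = one L \<otimes> one L \<otimes> x"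
      using x by (subst sw_swt[where g = "\<lambda>y x0. \<Oplus>y1 y2\<in>D y. y1 \<otimes> y2 \<otimes> x0"])
        (auto intro!: sw_swt bilinI simp: bunit_def swt_tens D_eq D_in D_one bilinI)
    ultimately show "sw (carr L) kline (lco (bunit L) x) (\<lambda>y x0. y \<otimes> lco (bunit L) x0)
      = sw (carr L) kline (lco (bunit L) x) (\<lambda>y x0. sw (carr L) (carr L) (cop L y) (\<lambda>y1 y2. y1 \<otimes> y2 \<otimes> x0))" by simp
    show "sw (carr L) kline (lco (bunit L) x) (\<lambda>y x0. scale (cou L y) x0) = x"
      using x by (subst sw_swt[where g = "\<lambda>y x0. scale (ep y) x0"]) (auto simp: bunit_def bilinI swt_tens ep_eq)
    have "sw (carr L) kline (lco (bunit L) x) (\<lambda>y x0. sw kline (carr L) (rco (bunit L) x0) (\<lambda>x00 z. y \<otimes> x00 \<otimes> z)) = one L \<otimes> x \<otimes> one L"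
      using x by (subst sw_swt[where g = "\<lambda>y x0. y \<otimes> x0 \<otimes> one L"])
        (auto intro!: bilinI trans[OF sw_swt[where g = "\<lambda>x00 z. _ \<otimes> x00 \<otimes> z"]] simp: bunit_def swt_tens bilinI)
    moreover have "sw kline (carr L) (rco (bunit L) x) (\<lambda>x0 z. sw (carr L) kline (lco (bunit L) x0) (\<lambda>y x00. y \<otimes> x00 \<otimes> z)) = one L \<otimes> x \<otimes> one L"
      using x by (subst sw_swt[where g = "\<lambda>x0 z. one L \<otimes> x0 \<otimes> z"])
        (auto intro!: bilinI trans[OF sw_swt[where g = "\<lambda>y x00. y \<otimes> x00 \<otimes> _"]] simp: bunit_def swt_tens bilinI)
    ultimately show "sw (carr L) kline (lco (bunit L) x) (\<lambda>y x0. sw kline (carr L) (rco (bunit L) x0) (\<lambda>x00 z. y \<otimes> x00 \<otimes> z))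
      = sw kline (carr L) (rco (bunit L) x) (\<lambda>x0 z. sw (carr L) kline (lco (bunit L) x0) (\<lambda>y x00. y \<otimes> x00 \<otimes> z))" by simp
  qed
qed

lemma f0_in: "z \<in> sp (wunit H) \<Longrightarrow> f0 z \<in> sp (\<Gamma>' (bunit L))"
  by (auto simp: wunit_sp f0_iB Gamma'_sp intro!: tens_in_tensS unitv_kline)

lemma F0_arr: "is_right_comodule_map H F0"
proof (rule H.comodule_mapI[OF _ _ lin_f0])
  show "is_right_comodule H (src F0)" "is_right_comodule H (trg F0)"
    by (simp_all add: wunit_comodule Gamma_comodule bunit_comodule)
  fix z assume "z \<in> sp (src F0)"
  then have z: "z \<in> sp (wunit H)" by simp
  then obtain b where b: "b \<in> carr B" "z = iB b" by (auto simp: wunit_sp)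
  show "fn F0 z = f0 z" by (rule F0_fn[OF z])
  show "f0 z \<in> sp (trg F0)" using f0_in[OF z] by simp
  have "rcoT (trg F0) (f0 z) = rho (rcoT (bunit L)) (f0 z)"
    using f0_in[OF z] by (simp add: rcoT_Gamma bunit_comodule)
  also have "\<dots> = (\<Oplus>e1 e2\<in>e. (one B \<otimes> unitv \<otimes> e1) \<otimes> (pB e2 \<otimes> one L \<otimes> b))"
    by (simp add: b(2) f0_iB rho_tens lin_bunit_coT D_one swt_simps)
  also have "\<dots> = (\<Oplus>x0 x1\<in>rho D z. f0 x0 \<otimes> x1)"
    by (simp add: b(2) rho_iB f0_iB swt_simps lin_comp[OF lin_f0])
  finally show "rcoT (trg F0) (f0 z) = (\<Oplus>x0 x1\<in>rcoT (src F0) z. f0 x0 \<otimes> x1)"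
    by (simp add: rcoT_wunit[OF z])
qed simp

section \<open>Naturality and associativity of the structure map\<close>

lemma fnT_eq: "ksubspace (sp (src f)) \<Longrightarrow> x \<in> sp (src f) \<Longrightarrow> fnT f x = fn f x"
  by (simp add: fnT_def proj_id)

text \<open>Trades the extension \<open>fnT\<close>, defined through a projection, for whichever
  linear formula is at hand on the source.\<close>

lemma tens_arr:
  assumes f: "is_right_comodule H (src f)" "is_right_comodule H (trg f)" "is_right_comodule_map H f"
    and g: "is_right_comodule H (src g)" "is_right_comodule H (trg g)" "is_right_comodule_map H g"
    and F: "lin F" "\<And>x. x \<in> sp (src f) \<Longrightarrow> fn f x = F x" and G: "lin G" "\<And>x. x \<in> sp (src g) \<Longrightarrow> fn g x = G x"
    and z: "z \<in> sp (wtens H (src f) (src g))"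
  shows "tmap F G z \<in> sp (wtens H (trg f) (trg g))" "fn (arr_tens (wtens H) f g) z = tmap F G z"
proof -
  have z1: "z \<in> sp (src f) \<otimes>\<^sub>S sp (src g)" using H.wtens_sub[OF f(1) g(1)] z by auto
  have "tmap (fnT f) (fnT g) z = tmap F G z"
    by (rule tmap_cong[OF z1]) (auto simp: F G H.comodule_map_fnT(1)[OF f] H.comodule_map_fnT(1)[OF g] fnT_eq[OF H.comodule_sub] f(1) g(1))
  then show "tmap F G z \<in> sp (wtens H (trg f) (trg g))" "fn (arr_tens (wtens H) f g) z = tmap F G z"
    using H.tmap_wtens[OF f g z] by auto
qed

lemma F2_natural:
  assumes f: "is_bicomodule L (src f)" "is_bicomodule L (trg f)" "is_bicomodule_map L f"
    and g: "is_bicomodule L (src g)" "is_bicomodule L (trg g)" "is_bicomodule_map L g"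
  shows "arr_comp (\<Gamma>A' (arr_tens (btens L) f g)) (F2 (src f) (src g))
    = arr_comp (F2 (trg f) (trg g)) (arr_tens (wtens H) (\<Gamma>A' f) (\<Gamma>A' g))"
proof (rule fn_eqI[where A = "sp (wtens H (\<Gamma>' (src f)) (\<Gamma>' (src g)))"])
  note rf = L.bicomodule_right[OF f(1)] L.bicomodule_right[OF f(2)] L.bicomodule_map_right[OF f]
  note rg = L.bicomodule_right[OF g(1)] L.bicomodule_right[OF g(2)] L.bicomodule_map_right[OF g]
  note F = L.comodule_map_fnT[OF rf] and G = L.comodule_map_fnT[OF rg]
  fix z assume z: "z \<in> sp (wtens H (\<Gamma>' (src f)) (\<Gamma>' (src g)))"
  then have z1: "z \<in> sp (\<Gamma>' (src f)) \<otimes>\<^sub>S sp (\<Gamma>' (src g))"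
    using H.wtens_sub[OF Gamma'_comodule[OF f(1)] Gamma'_comodule[OF g(1)]] by auto
  have t: "fn (arr_tens (btens L) f g) x = tmap (fnT f) (fnT g) x" if "x \<in> sp (btens L (src f) (src g))" for x
    using that by (intro arr_tens_fn L.comodule_sub rf rg L.comodule_map_linear_on) auto
  have "fn (\<Gamma>A' (arr_tens (btens L) f g)) (phi (src f) (src g) z) = gmap (tmap (fnT f) (fnT g)) (phi (src f) (src g) z)"
    using phi_in[OF f(1) g(1) z1] t by (intro Gamma_hat_fn) (auto simp: subspace_tensS lin_tmap)
  also have "\<dots> = phi (trg f) (trg g) (tmap (gmap (fnT f)) (gmap (fnT g)) z)"
    unfolding phi_def lin_swt_out[OF lin_gmap] tmap_def[of "gmap _"]
    using phi2_natural[OF L.lin_lcoT[OF f(1)] L.lin_rcoT[OF rg(1)] L.lin_lcoT[OF f(2)] L.lin_rcoT[OF rg(2)] F(1) G(1) L.bicomodule_map_lco(1)[OF f] L.comodule_map_rco[OF rg]]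
    by (simp add: swt_simps)
  finally have 1: "fn (\<Gamma>A' (arr_tens (btens L) f g)) (phi (src f) (src g) z) = phi (trg f) (trg g) (tmap (gmap (fnT f)) (gmap (fnT g)) z)" .
  have a: "is_right_comodule_map H (\<Gamma>A' f)" if "is_right_comodule L (src f)" "is_right_comodule L (trg f)" "is_right_comodule_map L f" for f :: "(('k, 'i) bicomod, 'k, 'i) arrow"
    using Gamma_arr(1)[of "FA forget_left f"] that by (simp add: Gamma_hat_def func_comp_def)
  have b: "fn (\<Gamma>A' f) z = gmap (fnT f) z" if "is_right_comodule L (src f)" "is_right_comodule L (trg f)" "is_right_comodule_map L f" "z \<in> sp (\<Gamma>' (src f))" for z and f :: "(('k, 'i) bicomod, 'k, 'i) arrow"
    using Gamma_arr(2)[of "FA forget_left f"] that by (simp add: Gamma_hat_def func_comp_def)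
  have "tmap (gmap (fnT f)) (gmap (fnT g)) z \<in> sp (wtens H (trg (\<Gamma>A' f)) (trg (\<Gamma>A' g)))"
    "fn (arr_tens (wtens H) (\<Gamma>A' f) (\<Gamma>A' g)) z = tmap (gmap (fnT f)) (gmap (fnT g)) z"
    using z by (intro tens_arr; simp add: Gamma_comodule rf rg a b lin_gmap)+
  then show "fn (arr_comp (\<Gamma>A' (arr_tens (btens L) f g)) (F2 (src f) (src g))) z
    = fn (arr_comp (F2 (trg f) (trg g)) (arr_tens (wtens H) (\<Gamma>A' f) (\<Gamma>A' g))) z"
    using z 1 by (simp add: F2_fn f g)
qed (auto intro!: arr_comp_ext)

text \<open>Once the arrows are evaluated this is \<open>phi2_assoc\<close>. The remaining work
  places each intermediate vector in the subspace on which the next extensional arrow is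
  meaningful.\<close>

lemma F2_assoc:
  assumes X: "is_bicomodule L X" and Y: "is_bicomodule L Y" and Z: "is_bicomodule L Z"
    and XY: "is_bicomodule L (btens L X Y)" and YZ: "is_bicomodule L (btens L Y Z)"
  shows "arr_comp (\<Gamma>A' (arr_assoc (btens L) X Y Z)) (arr_comp (F2 (btens L X Y) Z) (arr_tens (wtens H) (F2 X Y) (arr_id (\<Gamma>' Z))))
    = arr_comp (F2 X (btens L Y Z)) (arr_comp (arr_tens (wtens H) (arr_id (\<Gamma>' X)) (F2 Y Z)) (arr_assoc (wtens H) (\<Gamma>' X) (\<Gamma>' Y) (\<Gamma>' Z)))"
proof (rule fn_eqI[where A = "sp (wtens H (wtens H (\<Gamma>' X) (\<Gamma>' Y)) (\<Gamma>' Z))"])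
  note R = L.bicomodule_right[OF X] L.bicomodule_right[OF Y] L.bicomodule_right[OF Z]
  note G = Gamma'_comodule[OF X] Gamma'_comodule[OF Y] Gamma'_comodule[OF Z]
  note GXY = H.wtens_comodule[OF G(1,2)] and GYZ = H.wtens_comodule[OF G(2,3)]
  fix z assume z: "z \<in> sp (wtens H (wtens H (\<Gamma>' X) (\<Gamma>' Y)) (\<Gamma>' Z))"
  have z1: "z \<in> sp (wtens H (\<Gamma>' X) (\<Gamma>' Y)) \<otimes>\<^sub>S sp (\<Gamma>' Z)" using H.wtens_sub[OF GXY G(3)] z by auto
  note lr = L.lin_lcoT[OF X] L.lin_lcoT[OF Y] L.lin_rcoT[OF R(2)] L.lin_rcoT[OF R(3)]
  note [simp] = lin_comp[OF lin_phi] lin_comp[OF lin_tmap]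
  let ?l = "tmap (phi X Y) (\<lambda>x. x) z" and ?r = "tmap (\<lambda>x. x) (phi Y Z) (L.assocm z)"
  have l: "?l \<in> sp (wtens H (\<Gamma>' (btens L X Y)) (\<Gamma>' Z))" "fn (arr_tens (wtens H) (F2 X Y) (arr_id (\<Gamma>' Z))) z = ?l"
    using tens_arr[OF F2_arr[OF X Y], of "arr_id (\<Gamma>' Z)" "phi X Y" "\<lambda>x. x" z] z
    by (simp_all add: G H.arr_id_map lin_phi lin_id F2_fn[OF X Y])
  have as: "fn (arr_assoc (wtens H) (\<Gamma>' X) (\<Gamma>' Y) (\<Gamma>' Z)) z = L.assocm z"
  proof -
    have "z \<in> (sp (\<Gamma>' X) \<otimes>\<^sub>S sp (\<Gamma>' Y)) \<otimes>\<^sub>S sp (\<Gamma>' Z)" if "z \<in> sp (wtens H (wtens H (\<Gamma>' X) (\<Gamma>' Y)) (\<Gamma>' Z))" for z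
    proof -
      have "(\<Oplus>u v\<in>z. u \<otimes> v) \<in> (sp (\<Gamma>' X) \<otimes>\<^sub>S sp (\<Gamma>' Y)) \<otimes>\<^sub>S sp (\<Gamma>' Z)"
        by (rule swt_mem[of _ "sp (wtens H (\<Gamma>' X) (\<Gamma>' Y))" "sp (\<Gamma>' Z)", OF _ subspace_tensS bilin_tens])
          (use H.wtens_sub[OF GXY G(3)] H.wtens_sub[OF G(1,2)] that in \<open>auto intro: tens_in_tensS\<close>)
      then show ?thesis using swt_id[of z "sp (wtens H (\<Gamma>' X) (\<Gamma>' Y))" "sp (\<Gamma>' Z)"] H.wtens_sub[OF GXY G(3)] that by auto
    qed
    then show ?thesis unfolding L.assocm_def
      by (intro arr_assoc_fn H.comodule_sub[OF G(1)] H.wtens_sub[OF G(1,2)] z subsetI)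
  qed
  \<comment> \<open>Without this membership the next tensor product of arrows could not be evaluated
    at the reassociated vector.\<close>
  have az: "L.assocm z \<in> sp (wtens H (\<Gamma>' X) (wtens H (\<Gamma>' Y) (\<Gamma>' Z)))" by (rule H.assocm_wtens[OF G z])
  have r: "?r \<in> sp (wtens H (\<Gamma>' X) (\<Gamma>' (btens L Y Z)))" "fn (arr_tens (wtens H) (arr_id (\<Gamma>' X)) (F2 Y Z)) (L.assocm z) = ?r"
    using tens_arr[OF _ _ _ F2_arr[OF Y Z], of "arr_id (\<Gamma>' X)" "\<lambda>x. x" "phi Y Z" "L.assocm z"] az
    by (simp_all add: G H.arr_id_map lin_phi lin_id F2_fn[OF Y Z])
  have l1: "?l \<in> sp (\<Gamma>' (btens L X Y)) \<otimes>\<^sub>S sp (\<Gamma>' Z)" using l(1) H.wtens_sub[OF Gamma'_comodule[OF XY] G(3)] by auto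
  have "phi (btens L X Y) Z ?l = (\<Oplus>y x\<in>z. phi2 (lcoT (btens L X Y)) (rcoT Z) (phi X Y y) x)"
    by (simp add: phi_def[of "btens L X Y"] tmap_def swt_simps)
  \<comment> \<open>The coaction of a tensor product is given by \<open>tensL\<close> only on the
    tensor space itself, hence the detour through membership of \<open>phi X Y y\<close>.\<close>
  also have "\<dots> = (\<Oplus>y x\<in>z. phi2 (tensL (lcoT X) (lcoT Y)) (rcoT Z) (phi X Y y) x)"
  proof (rule swt_cong_on[OF z1])
    fix y x assume "y \<in> sp (wtens H (\<Gamma>' X) (\<Gamma>' Y))" and x: "x \<in> sp (\<Gamma>' Z)"
    then have "y \<in> sp (\<Gamma>' X) \<otimes>\<^sub>S sp (\<Gamma>' Y)" using H.wtens_sub[OF G(1,2)] by auto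
    from phi_in[OF X Y this] x
    show "phi2 (lcoT (btens L X Y)) (rcoT Z) (phi X Y y) x = phi2 (tensL (lcoT X) (lcoT Y)) (rcoT Z) (phi X Y y) x"
      unfolding Gamma'_sp by (rule phi2_cong) (auto simp: L.lin_lcoT[OF XY] lin_tensL lr btens_coT[OF X Y])
  qed (auto intro!: bilinI)
  finally have e: "phi (btens L X Y) Z ?l = (\<Oplus>y x\<in>z. phi2 (tensL (lcoT X) (lcoT Y)) (rcoT Z) (phi X Y y) x)" .
  have "fn (\<Gamma>A' (arr_assoc (btens L) X Y Z)) (phi (btens L X Y) Z ?l) = gmap L.assocm (phi (btens L X Y) Z ?l)"
  proof (rule Gamma_hat_fn)
    fix x assume "x \<in> sp (src (arr_assoc (btens L) X Y Z))"
    then show "fn (arr_assoc (btens L) X Y Z) x = L.assocm x"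
      unfolding L.assocm_def by (intro arr_assoc_fn L.comodule_sub R) auto
  qed (use phi_in[OF XY Z l1] in \<open>auto simp: subspace_tensS L.lin_assocm\<close>)
  also have "\<dots> = gmap L.assocm (\<Oplus>y x\<in>z. phi2 (tensL (lcoT X) (lcoT Y)) (rcoT Z) (phi X Y y) x)"
    by (simp only: e)
  also have "\<dots> = (\<Oplus>y x\<in>z. \<Oplus>u v\<in>y. gmap L.assocm (phi2 (tensL (lcoT X) (lcoT Y)) (rcoT Z) (phi2 (lcoT X) (rcoT Y) u v) x))"
    by (simp add: phi_def lin_swt_out[OF lin_gmap] lin_swt_out[OF bilin_comp1[OF bilin_phi2 lin_id]])
  also have "\<dots> = (\<Oplus>y x\<in>z. \<Oplus>u v\<in>y. phi2 (lcoT X) (L.tensR (rcoT Y) (rcoT Z)) u (phi2 (lcoT Y) (rcoT Z) v x))"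
    by (intro swt_fun_cong phi2_assoc lr L.comodule_coass[OF R(3)] L.lco_coass[OF X] L.lco_rco[OF Y])
  also have "\<dots> = (\<Oplus>x y\<in>?r. phi2 (lcoT X) (L.tensR (rcoT Y) (rcoT Z)) x y)"
    by (simp add: tmap_def L.assocm_def swt_simps) (simp add: phi_def swt_simps)
  also have "\<dots> = phi X (btens L Y Z) ?r"
    unfolding phi_def[of X]
  proof (rule swt_cong_on[of _ "sp (\<Gamma>' X)" "sp (\<Gamma>' (btens L Y Z))"])
    show "?r \<in> sp (\<Gamma>' X) \<otimes>\<^sub>S sp (\<Gamma>' (btens L Y Z))" using r(1) H.wtens_sub[OF G(1) Gamma'_comodule[OF YZ]] by auto
    fix x y assume "x \<in> sp (\<Gamma>' X)" "y \<in> sp (\<Gamma>' (btens L Y Z))"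
    then show "phi2 (lcoT X) (L.tensR (rcoT Y) (rcoT Z)) x y = phi2 (lcoT X) (rcoT (btens L Y Z)) x y"
      unfolding Gamma'_sp by (rule phi2_cong) (auto simp: L.lin_rcoT[OF btens_comodule[OF Y Z]] L.lin_tensR lr btens_coT[OF Y Z])
  qed (auto intro!: bilinI)
  finally show "fn (arr_comp (\<Gamma>A' (arr_assoc (btens L) X Y Z)) (arr_comp (F2 (btens L X Y) Z) (arr_tens (wtens H) (F2 X Y) (arr_id (\<Gamma>' Z))))) z
    = fn (arr_comp (F2 X (btens L Y Z)) (arr_comp (arr_tens (wtens H) (arr_id (\<Gamma>' X)) (F2 Y Z)) (arr_assoc (wtens H) (\<Gamma>' X) (\<Gamma>' Y) (\<Gamma>' Z)))) z"
    using z by (simp add: l as r F2_fn[OF XY Z] F2_fn[OF X YZ])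
qed (auto intro!: arr_comp_ext)

text \<open>The argument of \<open>rho_counit\<close> with an additional factor: multiplication by
  \<open>iB b\<close> splits off one more leg of \<open>x1\<close>, which acts on \<open>b\<close>,
  and the remaining two actions on \<open>e2\<close> cancel by \<open>A_La\<close>. The right side
  is \<phi> at \<open>iB b\<close> and \<open>m\<close> with trivial left coaction.\<close>

lemma left_unit_formula:
  assumes r: "lin r"
  shows "(\<Oplus>m0 m1\<in>rho r m. epH (muH (iB b) m1) m0) = (\<Oplus>a x b'\<in>m. \<Oplus>x0 x1\<in>r x. a \<otimes> x0 \<otimes> mB (A b x1) b')"
proof -
  note [simp] = lin_comp[OF r]
  have *: "(\<Oplus>x11 x12\<in>D x1. \<Oplus>e1 e2\<in>e. epH (muH (iB b) (La x11 e2 \<otimes> x12 \<otimes> b')) (a \<otimes> x0 \<otimes> e1)) = a \<otimes> x0 \<otimes> mB (A b x1) b'" for a x0 x1 b'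
  proof -
    define K where "K p q e1 = scale (w (mB p (mB (A b q) b'))) (a \<otimes> x0 \<otimes> e1)" for p q e1
    have [simp]: "lin f \<Longrightarrow> lin (\<lambda>u. K (f u) q e1)" "lin f \<Longrightarrow> lin (\<lambda>u. K p (f u) e1)" "lin f \<Longrightarrow> lin (\<lambda>u. K p q (f u))" for f p q e1
      by (simp_all add: K_def)
    have "(\<Oplus>x11 x12\<in>D x1. \<Oplus>e1 e2\<in>e. epH (muH (iB b) (La x11 e2 \<otimes> x12 \<otimes> b')) (a \<otimes> x0 \<otimes> e1))
      = (\<Oplus>e1 e2\<in>e. \<Oplus>x11 x12\<in>D x1. \<Oplus>k1 k2\<in>D x12. K (A (La x11 e2) k1) k2 e1)"
      by (subst swt_swap) (simp add: muH_tens D_one swt_simps lin_swt_out[OF bilin_comp1[OF bilin_epH lin_id]] epH_tens K_def)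
    also have "\<dots> = (\<Oplus>e1 e2\<in>e. \<Oplus>x11 k2\<in>D x1. \<Oplus>x11 k1\<in>D x11. K (A (La x11 e2) k1) k2 e1)"
      by (intro swt_fun_cong coass_D[symmetric]) (simp add: trilinI)
    also have "\<dots> = (\<Oplus>e1 e2\<in>e. \<Oplus>x11 k2\<in>D x1. K (scale (ep x11) (pB e2)) k2 e1)"
      by (simp add: A_La flip: lin_swt_out[of "\<lambda>p. K p _ _"])
    also have "\<dots> = (\<Oplus>e1 e2\<in>e. K e2 (\<Oplus>x11 k2\<in>D x1. scale (ep x11) k2) e1)"
      by (simp add: lin_swt_out[of "\<lambda>q. K _ q _"]) (simp add: K_def)
    also have "\<dots> = a \<otimes> x0 \<otimes> (\<Oplus>e1 e2\<in>e. scale (w (mB e2 (mB (A b x1) b'))) e1)"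
      by (simp add: counit_D1 K_def swt_tens_right tens_scale_right)
    finally show ?thesis by (simp add: e_w_right)
  qed
  show ?thesis unfolding rho_def by (simp add: swt_simps *)
qed

lemma right_unit_formula:
  assumes r: "lin r"
  shows "(\<Oplus>m0 m1\<in>rho r m. epH (muH m1 (iB b)) m0) = (\<Oplus>a x b'\<in>m. a \<otimes> L.cpart r x \<otimes> mB b' b)"
proof -
  note [simp] = lin_comp[OF r]
  have 1: "muH (c \<otimes> h \<otimes> b') (iB b) = pB c \<otimes> pL h \<otimes> mB b' b" for c h b'
  proof -
    have "muH (c \<otimes> h \<otimes> b') (iB b) = pB c \<otimes> (\<Oplus>h1 h2\<in>D h. scale (ep h1) (pL h2)) \<otimes> mB b' b"
      by (simp add: muH_tens D_one swt_simps tens_scale_left tens_scale_right)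
    also have "(\<Oplus>h1 h2\<in>D h. scale (ep h1) (pL h2)) = pL (\<Oplus>h1 h2\<in>D h. scale (ep h1) h2)"
      by (simp add: lin_swt_out[of pL] lin_proj'[OF subL])
    finally show ?thesis by (simp add: counit_D1)
  qed
  \<comment> \<open>The coaction leaves the last factor of \<open>m\<close> in the last factor of
    \<open>m1\<close>, so the multiplication may be carried out before coacting.\<close>
  have "(\<Oplus>m0 m1\<in>rho r m. epH (muH m1 (iB b)) m0) = (\<Oplus>m0 m1\<in>rho r (\<Oplus>a x b'\<in>m. a \<otimes> x \<otimes> mB b' b). epH m1 m0)"
    by (simp add: rho_def swt_simps 1 epH_tens)
  also have "\<dots> = (\<Oplus>a x b'\<in>m. a \<otimes> L.cpart r x \<otimes> mB b' b)"
    unfolding rho_counit[OF r] by (simp add: swt_simps L.lin_cpart[OF r])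
  finally show ?thesis .
qed

section \<open>Left and right unit constraints\<close>

lemma linf_lookup: "linf (\<lambda>c. Poly_Mapping.lookup c k)"
  by (simp add: linf_def lookup_add lookup_scale)

definition lunit :: "('k, 'i) vec \<Rightarrow> ('k, 'i) vec"
  where "lunit z = (\<Oplus>c x\<in>z. scale (Poly_Mapping.lookup c Triv) x)"

definition runit :: "('k, 'i) vec \<Rightarrow> ('k, 'i) vec"
  where "runit z = (\<Oplus>x c\<in>z. scale (Poly_Mapping.lookup c Triv) x)"

lemma lin_lookup [simp]: "lin f \<Longrightarrow> lin (\<lambda>x. scale (Poly_Mapping.lookup (f x) k) v)"
  by (rule lin_scale_left[OF linf_lookup])

lemma lin_lunit: "lin lunit" and lin_runit: "lin runit"
  unfolding lunit_def[abs_def] runit_def[abs_def] by simp_all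

lemma lookup_unitv [simp]: "Poly_Mapping.lookup unitv Triv = 1"
  by (simp add: unitv_def)

lemma lunit_unitv: "lunit (unitv \<otimes> x) = x" and runit_unitv: "runit (x \<otimes> unitv) = x"
  by (simp_all add: lunit_def runit_def swt_simps)

text \<open>The unit map of comodules is computed by \<open>left_unit_formula\<close>. On the other
  side the left coaction of the unit object is trivial, so \<phi> only multiplies by
  \<open>A b y1\<close>.\<close>

lemma F2_left_unit:
  assumes X: "is_bicomodule L X"
  shows "LUnit (wcomod_moncat H) (\<Gamma>' X) =
    arr_comp (\<Gamma>A' (LUnit (bicomod_moncat L) X)) (arr_comp (F2 (bunit L) X) (arr_tens (wtens H) F0 (arr_id (\<Gamma>' X))))"
proof (rule fn_eqI[where A = "sp (wtens H (wunit H) (\<Gamma>' X))"])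
  note R = L.bicomodule_right[OF X] and G = Gamma'_comodule[OF X] and U = bunit_bicomodule
  note sX = L.comodule_sub[OF R]
  have rX: "lin (rcoT X)" and lU: "lin (lcoT (bunit L))" by (rule L.lin_rcoT[OF R], rule lin_bunit_coT)
  note [simp] = lin_comp[OF lin_f0] lin_comp[OF rX] lin_comp[OF lU] lin_comp[OF lin_lunit] lin_comp[OF lin_tmap] lin_comp[OF lin_phi]
  fix z assume z: "z \<in> sp (wtens H (wunit H) (\<Gamma>' X))"
  then have z1: "z \<in> sp (wunit H) \<otimes>\<^sub>S sp (\<Gamma>' X)" using H.wtens_sub[OF wunit_comodule G] by auto
  have GX: "rho (rcoT X) x \<in> sp (\<Gamma>' X) \<otimes>\<^sub>S carr H" if "x \<in> sp (\<Gamma>' X)" for x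
    using that unfolding Gamma'_sp by (rule rho_in) (rule rX L.rcoT_in[OF R])+
  have rc: "rco (\<Gamma>' X) m = rho (rcoT X) m" if "m \<in> sp (\<Gamma>' X)" for m
    using that by (simp add: H.rco_eq[OF G] rcoT_Gamma R)
  have "fn (LUnit (wcomod_moncat H) (\<Gamma>' X)) z = (\<Oplus>x m\<in>z. \<Oplus>m0 m1\<in>rho (rcoT X) m. epH (muH x m1) m0)"
    unfolding wcomod_moncat_def moncat.simps arrow.simps restrict_apply if_P[OF z]
    using wunit_H by (intro sw_swt sub_wunit z1)
      (auto intro!: sw_swt H.comodule_sub[OF G] bilinI simp: rc GX mul_H cou_H muH_in subset_iff)
  also have "\<dots> = (\<Oplus>x m\<in>z. gmap lunit (phi2 (lcoT (bunit L)) (rcoT X) (f0 x) m))"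
  proof (rule swt_cong_on[OF z1])
    fix x m assume "x \<in> sp (wunit H)" and m: "m \<in> sp (\<Gamma>' X)"
    then obtain b where b: "b \<in> carr B" "x = iB b" by (auto simp: wunit_sp)
    have "gmap lunit (phi2 (lcoT (bunit L)) (rcoT X) (f0 x) m) = (\<Oplus>a y b'\<in>m. \<Oplus>y0 y1\<in>rcoT X y. pB a \<otimes> y0 \<otimes> mB (A b y1) b')"
      by (simp add: b(2) f0_iB phi2_def gmap_def swt_simps lunit_unitv)
    also have "\<dots> = (\<Oplus>a y b'\<in>m. \<Oplus>y0 y1\<in>rcoT X y. a \<otimes> y0 \<otimes> mB (A b y1) b')"
      by (rule swt3_cong_on[OF m[unfolded Gamma'_sp]]) (auto simp: trilinI)
    finally show "(\<Oplus>m0 m1\<in>rho (rcoT X) m. epH (muH x m1) m0) = gmap lunit (phi2 (lcoT (bunit L)) (rcoT X) (f0 x) m)"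
      by (simp add: b(2) left_unit_formula[OF rX])
  qed (auto intro!: bilinI)
  also have "\<dots> = gmap lunit (phi (bunit L) X (tmap f0 (\<lambda>x. x) z))"
    by (simp add: phi_def tmap_def swt_simps lin_swt_out[OF lin_gmap])
  finally have 1: "fn (LUnit (wcomod_moncat H) (\<Gamma>' X)) z = gmap lunit (phi (bunit L) X (tmap f0 (\<lambda>x. x) z))" .
  have t: "tmap f0 (\<lambda>x. x) z \<in> sp (wtens H (\<Gamma>' (bunit L)) (\<Gamma>' X))" "fn (arr_tens (wtens H) F0 (arr_id (\<Gamma>' X))) z = tmap f0 (\<lambda>x. x) z"
    using tens_arr[OF _ _ F0_arr, of "arr_id (\<Gamma>' X)" f0 "\<lambda>x. x" z] z
    by (simp_all add: G H.arr_id_map lin_f0 lin_id F0_fn wunit_comodule Gamma'_comodule[OF U])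
  have t1: "tmap f0 (\<lambda>x. x) z \<in> sp (\<Gamma>' (bunit L)) \<otimes>\<^sub>S sp (\<Gamma>' X)" using t(1) H.wtens_sub[OF Gamma'_comodule[OF U] G] by auto
  have "fn (\<Gamma>A' (LUnit (bicomod_moncat L) X)) (phi (bunit L) X (tmap f0 (\<lambda>x. x) z)) = gmap lunit (phi (bunit L) X (tmap f0 (\<lambda>x. x) z))"
  proof (rule Gamma_hat_fn)
    fix x assume "x \<in> sp (src (LUnit (bicomod_moncat L) X))"
    then show "fn (LUnit (bicomod_moncat L) X) x = lunit x"
      unfolding lunit_def bicomod_moncat_def moncat.simps arrow.simps by (auto intro!: sw_swt sub_kline bilinI)
  qed (use phi_in[OF U X t1] in \<open>auto simp: bicomod_moncat_def subspace_tensS lin_lunit\<close>)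
  then show "fn (LUnit (wcomod_moncat H) (\<Gamma>' X)) z =
    fn (arr_comp (\<Gamma>A' (LUnit (bicomod_moncat L) X)) (arr_comp (F2 (bunit L) X) (arr_tens (wtens H) F0 (arr_id (\<Gamma>' X))))) z"
    using 1 z by (simp add: t F2_fn[OF U X])
qed (auto intro!: arr_comp_ext simp: wcomod_moncat_def bicomod_moncat_def)

text \<open>The two sides use different counit laws of \<open>X\<close>: that of the right coaction
  through \<open>right_unit_formula\<close>, that of the left coaction through \<phi>. Both return
  the middle factor itself.\<close>

lemma F2_right_unit:
  assumes X: "is_bicomodule L X"
  shows "RUnit (wcomod_moncat H) (\<Gamma>' X) =
    arr_comp (\<Gamma>A' (RUnit (bicomod_moncat L) X)) (arr_comp (F2 X (bunit L)) (arr_tens (wtens H) (arr_id (\<Gamma>' X)) F0))"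
proof (rule fn_eqI[where A = "sp (wtens H (\<Gamma>' X) (wunit H))"])
  note R = L.bicomodule_right[OF X] and G = Gamma'_comodule[OF X] and U = bunit_bicomodule
  note sX = L.comodule_sub[OF R]
  have rX: "lin (rcoT X)" and lX: "lin (lcoT X)" and rU: "lin (rcoT (bunit L))" by (rule L.lin_rcoT[OF R], rule L.lin_lcoT[OF X], rule lin_bunit_coT)
  note [simp] = lin_comp[OF lin_f0] lin_comp[OF rX] lin_comp[OF lX] lin_comp[OF rU] lin_comp[OF lin_runit] lin_comp[OF lin_tmap] lin_comp[OF lin_phi] lin_proj[OF sX]
  fix z assume z: "z \<in> sp (wtens H (\<Gamma>' X) (wunit H))"
  then have z1: "z \<in> sp (\<Gamma>' X) \<otimes>\<^sub>S sp (wunit H)" using H.wtens_sub[OF G wunit_comodule] by auto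
  have GX: "rho (rcoT X) x \<in> sp (\<Gamma>' X) \<otimes>\<^sub>S carr H" if "x \<in> sp (\<Gamma>' X)" for x
    using that unfolding Gamma'_sp by (rule rho_in) (rule rX L.rcoT_in[OF R])+
  have rc: "rco (\<Gamma>' X) m = rho (rcoT X) m" if "m \<in> sp (\<Gamma>' X)" for m
    using that by (simp add: H.rco_eq[OF G] rcoT_Gamma R)
  have "fn (RUnit (wcomod_moncat H) (\<Gamma>' X)) z = (\<Oplus>m x\<in>z. \<Oplus>m0 m1\<in>rho (rcoT X) m. epH (muH m1 x) m0)"
    unfolding wcomod_moncat_def moncat.simps arrow.simps restrict_apply if_P[OF z]
    using wunit_H by (intro sw_swt H.comodule_sub[OF G] z1)
      (auto intro!: sw_swt H.comodule_sub[OF G] bilinI simp: rc GX mul_H cou_H muH_in subset_iff)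
  also have "\<dots> = (\<Oplus>m x\<in>z. gmap runit (phi2 (lcoT X) (rcoT (bunit L)) m (f0 x)))"
  proof (rule swt_cong_on[OF z1])
    fix m x assume "x \<in> sp (wunit H)" and m: "m \<in> sp (\<Gamma>' X)"
    then obtain b where b: "b \<in> carr B" "x = iB b" by (auto simp: wunit_sp)
    have "gmap runit (phi2 (lcoT X) (rcoT (bunit L)) m (f0 x)) = (\<Oplus>a y b'\<in>m. pB a \<otimes> (\<Oplus>ym y0\<in>lcoT X y. scale (ep ym) y0) \<otimes> mB b' b)"
      by (simp add: b(2) f0_iB phi2_def gmap_def swt_simps runit_unitv tens_scale_left tens_scale_right linD(2)[OF lin_swt3_arg[OF lin_id]])
    also have "\<dots> = (\<Oplus>a y b'\<in>m. pB a \<otimes> proj (sp X) y \<otimes> mB b' b)" by (simp add: L.lco_counit[OF X])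
    also have "\<dots> = (\<Oplus>a y b'\<in>m. a \<otimes> L.cpart (rcoT X) y \<otimes> mB b' b)"
      unfolding L.comodule_counit[OF R] by (rule swt3_cong_on[OF m[unfolded Gamma'_sp]]) (auto simp: trilinI)
    finally show "(\<Oplus>m0 m1\<in>rho (rcoT X) m. epH (muH m1 x) m0) = gmap runit (phi2 (lcoT X) (rcoT (bunit L)) m (f0 x))"
      by (simp add: b(2) right_unit_formula[OF rX])
  qed (auto intro!: bilinI)
  also have "\<dots> = gmap runit (phi X (bunit L) (tmap (\<lambda>x. x) f0 z))"
    by (simp add: phi_def tmap_def swt_simps lin_swt_out[OF lin_gmap])
  finally have 1: "fn (RUnit (wcomod_moncat H) (\<Gamma>' X)) z = gmap runit (phi X (bunit L) (tmap (\<lambda>x. x) f0 z))" .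
  have t: "tmap (\<lambda>x. x) f0 z \<in> sp (wtens H (\<Gamma>' X) (\<Gamma>' (bunit L)))" "fn (arr_tens (wtens H) (arr_id (\<Gamma>' X)) F0) z = tmap (\<lambda>x. x) f0 z"
    using tens_arr[OF _ _ _ _ _ F0_arr, of "arr_id (\<Gamma>' X)" "\<lambda>x. x" f0 z] z
    by (simp_all add: G H.arr_id_map lin_f0 lin_id F0_fn wunit_comodule Gamma'_comodule[OF U])
  have t1: "tmap (\<lambda>x. x) f0 z \<in> sp (\<Gamma>' X) \<otimes>\<^sub>S sp (\<Gamma>' (bunit L))" using t(1) H.wtens_sub[OF G Gamma'_comodule[OF U]] by auto
  have "fn (\<Gamma>A' (RUnit (bicomod_moncat L) X)) (phi X (bunit L) (tmap (\<lambda>x. x) f0 z)) = gmap runit (phi X (bunit L) (tmap (\<lambda>x. x) f0 z))"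
  proof (rule Gamma_hat_fn)
    fix x assume "x \<in> sp (src (RUnit (bicomod_moncat L) X))"
    then show "fn (RUnit (bicomod_moncat L) X) x = runit x"
      unfolding runit_def bicomod_moncat_def moncat.simps arrow.simps by (auto intro!: sw_swt sX bilinI)
  qed (use phi_in[OF X U t1] in \<open>auto simp: bicomod_moncat_def subspace_tensS lin_runit\<close>)
  then show "fn (RUnit (wcomod_moncat H) (\<Gamma>' X)) z =
    fn (arr_comp (\<Gamma>A' (RUnit (bicomod_moncat L) X)) (arr_comp (F2 X (bunit L)) (arr_tens (wtens H) (arr_id (\<Gamma>' X)) F0))) z"
    using 1 z by (simp add: t F2_fn[OF X U])
qed (auto intro!: arr_comp_ext simp: wcomod_moncat_def bicomod_moncat_def)

lemma lax_monoidal_Gamma_hat: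
  "lax_monoidal_functor (bicomod_moncat L) (wcomod_moncat H) G' F2 F0"
proof -
  have proj: "Obj (bicomod_moncat L) = {X. is_bicomodule L X}"
    "Arr (bicomod_moncat L) = {f. is_bicomodule L (src f) \<and> is_bicomodule L (trg f) \<and> is_bicomodule_map L f}"
    "TenO (bicomod_moncat L) = btens L" "TenA (bicomod_moncat L) = arr_tens (btens L)" "UnitO (bicomod_moncat L) = bunit L"
    "Assoc (bicomod_moncat L) = arr_assoc (btens L)" "Dom (bicomod_moncat L) = src" "Cod (bicomod_moncat L) = trg"
    "TenO (wcomod_moncat H) = wtens H" "TenA (wcomod_moncat H) = arr_tens (wtens H)" "UnitO (wcomod_moncat H) = wunit H"
    "Assoc (wcomod_moncat H) = arr_assoc (wtens H)" "Cmp (wcomod_moncat H) = arr_comp" "Id (wcomod_moncat H) = arr_id"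
    by (simp_all add: bicomod_moncat_def wcomod_moncat_def comod_cat_def)
  have hom: "f \<in> hom (wcomod_moncat H) X Y \<longleftrightarrow> is_right_comodule H (src f) \<and> is_right_comodule H (trg f)
      \<and> is_right_comodule_map H f \<and> src f = X \<and> trg f = Y" for f X Y
    by (auto simp: hom_def wcomod_moncat_def comod_cat_def)
  have F0: "is_right_comodule H (src F0)" "is_right_comodule H (trg F0)"
    by (simp_all add: wunit_comodule Gamma'_comodule bunit_bicomodule)
  show ?thesis
    unfolding lax_monoidal_functor_def proj Gamma_hat_simps hom
    by (intro conjI ballI functor_Gamma_hat F2_arr F0 F0_arr F2_natural F2_assoc F2_left_unit F2_right_unit btens_bicomodule)
      simp_all
qed

end

theorem theorem1p6:
  fixes L :: "('k::alg_closed_field, 'i) hopf"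
    and B :: "('k, 'i) alg"
    and act :: "('k, 'i) vec \<Rightarrow> ('k, 'i) vec \<Rightarrow> ('k, 'i) vec"
    and e :: "('k, 'i) vec"
    and \<omega> :: "('k, 'i) vec \<Rightarrow> 'k"
  assumes "qtg_data L B act e \<omega>"
  shows "is_functor (comod_cat L) (wcomod_moncat (qtg L B act e \<omega>)) (Gamma L B act e)
    \<and> lax_monoidal_functor (bicomod_moncat L) (wcomod_moncat (qtg L B act e \<omega>))
        (Gamma_hat L B act e) (Gamma_hat2 L B act e \<omega>) (Gamma_hat0 L B act e \<omega>)"
proof -
  interpret quantum_transformation_groupoid L B act e \<omega> by unfold_locales (rule assms)
  show ?thesis using functor_Gamma lax_monoidal_Gamma_hat by blast
qed

end
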